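(* Let $\ell_1=\ell_2=\ell>0$. For every tricycling geodesic, the paths of the points $y_1$ and $y_2$ in the plane are 2-soliton curves.
   Context: 2-linkage: a triple of points $x,m_1,m_2\in\mathbb{R}^2$ with $|xm_1|=\ell_1$, $|xm_2|=\ell_2$ fixed and $m_1\ne m_2$; ${\mathcal C}$ is the 4-dimensional space of such configurations. The segments $xm_1$, $xm_2$ are extended to $xy_1$, $xy_2$ by doubling their lengths: $y_i=x+2(m_i-x)$. A motion (curve in ${\mathcal C}$) is horizontal if the velocity of $m_i$ is parallel to the segment $xm_i$ for $i=1,2$. The length of a horizontal curve is the length of the trajectory of $x$ (which equals the lengths of the trajectories of $y_1$ and $y_2$). A tricycling geodesic is a horizontal curve in ${\mathcal C}$, parameterized by arc length, that locally minimizes length among horizontal curves with the same endpoints. A 2-soliton is a planar curve whose curvature $\kappa$, as a function of arc length, satisfies $aE_0+bE_2+E_4=0$ for some constants $a,b$, where $E_0=\kappa$, $E_2=\kappa''+\frac{\kappa^3}{2}$, $E_4=\kappa''''+\frac52\kappa^2\kappa''+\frac52\kappa(\kappa')^2+\frac38\kappa^5$. *)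

theory Defs
  imports "HOL-Analysis.Analysis"
begin

type_synonym plane = "real ^ 2"

text \<open>A configuration is a triple \<open>(x, m\<^sub>1, m\<^sub>2)\<close>.\<close>

type_synonym linkage = "plane \<times> plane \<times> plane"

definition pt_x :: "linkage \<Rightarrow> plane" where
  "pt_x p = fst p"

definition pt_m1 :: "linkage \<Rightarrow> plane" where
  "pt_m1 p = fst (snd p)"

definition pt_m2 :: "linkage \<Rightarrow> plane" where
  "pt_m2 p = snd (snd p)"

definition pt_y1 :: "linkage \<Rightarrow> plane" where
  "pt_y1 p = pt_x p + 2 *\<^sub>R (pt_m1 p - pt_x p)"

definition pt_y2 :: "linkage \<Rightarrow> plane" where
  "pt_y2 p = pt_x p + 2 *\<^sub>R (pt_m2 p - pt_x p)"

definition configuration_space :: "real \<Rightarrow> real \<Rightarrow> linkage set" where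
  "configuration_space l1 l2 =
     {p. dist (pt_x p) (pt_m1 p) = l1 \<and> dist (pt_x p) (pt_m2 p) = l2 \<and> pt_m1 p \<noteq> pt_m2 p}"

text \<open>Curves are continuous and continuously differentiable off finitely many parameters.
  The scalars \<open>k\<^sub>1\<close>, \<open>k\<^sub>2\<close> may vanish: a point \<open>m\<^sub>i\<close> may be momentarily at rest, for instance when
  \<open>x\<close> moves perpendicularly to its segment.\<close>

definition horizontal_curve :: "real \<Rightarrow> real \<Rightarrow> real \<Rightarrow> real \<Rightarrow> (real \<Rightarrow> linkage) \<Rightarrow> bool" where
  "horizontal_curve l1 l2 c d \<gamma> \<longleftrightarrow>
     \<gamma> piecewise_C1_differentiable_on {c..d} \<and>
     (\<forall>t\<in>{c..d}. \<gamma> t \<in> configuration_space l1 l2) \<and>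
     (\<exists>S. finite S \<and> (\<forall>t\<in>{c..d} - S. \<exists>k1 k2.
        ((\<lambda>s. pt_m1 (\<gamma> s)) has_vector_derivative k1 *\<^sub>R (pt_m1 (\<gamma> t) - pt_x (\<gamma> t))) (at t) \<and>
        ((\<lambda>s. pt_m2 (\<gamma> s)) has_vector_derivative k2 *\<^sub>R (pt_m2 (\<gamma> t) - pt_x (\<gamma> t))) (at t)))"

text \<open>The library's notion of piecewise \<open>C\<^sup>1\<close> allows the velocity to be unbounded near a breakpoint,
  so a curve can have infinite length; the value is therefore taken in \<^typ>\<open>ennreal\<close>.\<close>

definition curve_length :: "real \<Rightarrow> real \<Rightarrow> (real \<Rightarrow> linkage) \<Rightarrow> ennreal" where
  "curve_length c d \<gamma> =
     (\<integral>\<^sup>+ t \<in> {c..d}. ennreal (norm (vector_derivative (\<lambda>s. pt_x (\<gamma> s)) (at t))) \<partial>lborel)"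

text \<open>Local minimization means that sufficiently short arcs are shortest among all horizontal curves
  (not merely the nearby ones) joining their endpoints. The interval \<open>I\<close> may be bounded or
  unbounded, with or without its endpoints.\<close>

definition tricycling_geodesic :: "real \<Rightarrow> real \<Rightarrow> real set \<Rightarrow> (real \<Rightarrow> linkage) \<Rightarrow> bool" where
  "tricycling_geodesic l1 l2 I \<gamma> \<longleftrightarrow>
     is_interval I \<and> interior I \<noteq> {} \<and>
     (\<forall>c d. c \<le> d \<longrightarrow> {c..d} \<subseteq> I \<longrightarrow>
        horizontal_curve l1 l2 c d \<gamma> \<and> curve_length c d \<gamma> = ennreal (d - c)) \<and>
     (\<forall>t\<in>I. \<exists>e>0. \<forall>c d. c \<le> d \<longrightarrow> {c..d} \<subseteq> I \<inter> ball t e \<longrightarrow>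
        (\<forall>c' d' \<delta>. c' \<le> d' \<longrightarrow> horizontal_curve l1 l2 c' d' \<delta> \<longrightarrow>
           \<delta> c' = \<gamma> c \<longrightarrow> \<delta> d' = \<gamma> d \<longrightarrow> curve_length c d \<gamma> \<le> curve_length c' d' \<delta>))"

definition rot90 :: "plane \<Rightarrow> plane" where
  "rot90 v = vector [- v $ 2, v $ 1]"

text \<open>\<open>\<gamma>\<close> is parameterized by arc length on \<open>I\<close> and has signed curvature \<open>\<kappa>\<close>, via the Frenet equation
  \<open>T' = \<kappa> N\<close>.\<close>

definition arclength_curve_with_curvature ::
    "real set \<Rightarrow> (real \<Rightarrow> plane) \<Rightarrow> (real \<Rightarrow> real) \<Rightarrow> bool" where
  "arclength_curve_with_curvature I \<gamma> \<kappa> \<longleftrightarrow>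
     (\<exists>T. \<forall>t\<in>I. (\<gamma> has_vector_derivative T t) (at t within I) \<and> norm (T t) = 1 \<and>
        (T has_vector_derivative \<kappa> t *\<^sub>R rot90 (T t)) (at t within I))"

text \<open>The arguments \<open>k\<close>, \<open>k1\<close>, \<open>k2\<close>, \<open>k4\<close> stand for the values of \<open>\<kappa>\<close>, \<open>\<kappa>'\<close>, \<open>\<kappa>''\<close>, \<open>\<kappa>''''\<close>.\<close>

definition E0 :: "real \<Rightarrow> real" where
  "E0 k = k"

definition E2 :: "real \<Rightarrow> real \<Rightarrow> real" where
  "E2 k k2 = k2 + k ^ 3 / 2"

definition E4 :: "real \<Rightarrow> real \<Rightarrow> real \<Rightarrow> real \<Rightarrow> real" where
  "E4 k k1 k2 k4 = k4 + 5 / 2 * k ^ 2 * k2 + 5 / 2 * k * k1 ^ 2 + 3 / 8 * k ^ 5"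

definition two_soliton :: "real set \<Rightarrow> (real \<Rightarrow> plane) \<Rightarrow> bool" where
  "two_soliton I \<gamma> \<longleftrightarrow>
     (\<exists>\<kappa> \<kappa>1 \<kappa>2 \<kappa>3 \<kappa>4.
        arclength_curve_with_curvature I \<gamma> \<kappa> \<and>
        (\<forall>t\<in>I. (\<kappa> has_real_derivative \<kappa>1 t) (at t within I) \<and>
               (\<kappa>1 has_real_derivative \<kappa>2 t) (at t within I) \<and>
               (\<kappa>2 has_real_derivative \<kappa>3 t) (at t within I) \<and>
               (\<kappa>3 has_real_derivative \<kappa>4 t) (at t within I)) \<and>
        (\<exists>a b. \<forall>t\<in>I. a * E0 (\<kappa> t) + b * E2 (\<kappa> t) (\<kappa>2 t)
                        + E4 (\<kappa> t) (\<kappa>1 t) (\<kappa>2 t) (\<kappa>4 t) = 0))"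

end

theory Submission
  imports Defs
begin

text \<open>
  Let \<open>u\<^sub>1\<close>, \<open>u\<^sub>2\<close> be the unit vectors from \<open>x\<close> to \<open>m\<^sub>1\<close>, \<open>m\<^sub>2\<close>, write \<open>u\<^sub>1\<close> as
  the direction with angle \<open>\<theta>\<close>, let \<open>\<beta>\<close> be the angle from \<open>u\<^sub>1\<close> to \<open>u\<^sub>2\<close>, and put \<open>w = cot (\<beta>/2)\<close>. As
  \<open>m\<^sub>1 \<noteq> m\<^sub>2\<close>, the number \<open>w\<close> is finite, and \<open>(m\<^sub>1, \<theta>, w)\<close> are global coordinates on the configuration
  space. In them a motion is horizontal iff \<open>m\<^sub>1' = p u\<^sub>1\<close>, \<open>\<theta>' = \<omega>\<close> and \<open>w' = \<omega> - (p/l) w\<close> for two free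
  functions \<open>p\<close>, \<open>\<omega>\<close>. This is where equal lengths enter: the Riccati equation that \<open>cot (\<beta>/2)\<close>
  satisfies becomes linear. So every pair \<open>(p, \<omega>)\<close> of bounded piecewise continuous controls yields a
  horizontal curve by three integrations (\<open>driven_quadrature\<close>), without solving a differential
  equation, and the speed of \<open>x\<close> is the square root of \<open>p\<^sup>2 + l\<^sup>2 \<omega>\<^sup>2\<close>.

  The map sending controls to energy and endpoint cannot be open at a
  shortest arc of unit speed. Perturb the controls along the five gradients of this map: then the
  derivative of the perturbed values is the Gram matrix of these gradients, and by the open mapping
  property of maps with surjective derivative it must be singular. Its kernel is a vector of Lagrange
  multipliers for which the corresponding combination of gradients vanishes identically
  (\<open>first_order_conditions\<close>).

  If the multiplier of the energy is not zero, the conditions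
  express \<open>p\<close> and \<open>\<omega>\<close> through the state, which makes them differentiable, and the curvature \<open>\<kappa>\<close> of \<open>x\<close>
  satisfies \<open>\<kappa>' = \<mu> \<bullet> N\<close> with a fixed vector \<open>\<mu>\<close> and the normal \<open>N\<close> (\<open>elastic_if_normal\<close>). If it is
  zero, \<open>x\<close> moves along a line on which the position of \<open>x\<close> determines the whole configuration. A
  shortest arc visits no configuration twice, so \<open>x\<close> does not turn back and its path is a segment
  (\<open>elastic_if_abnormal\<close>). In both cases \<open>\<kappa>'' = \<kappa> (C - \<kappa>\<^sup>2/2)\<close>. The constants of overlapping short
  arcs agree (\<open>elastica_globalize\<close>).

  The velocity of \<open>y\<^sub>i\<close> is the reflection of the velocity of \<open>x\<close> in
  \<open>u\<^sub>i\<close>, so \<open>y\<^sub>i\<close> has curvature \<open>-\<kappa> - 2 q / l\<close> where \<open>q\<close> is the sine of an angle between \<open>u\<^sub>i\<close> and the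
  velocity of \<open>x\<close>. The quantities \<open>\<kappa>\<close>, \<open>\<kappa>'\<close>, \<open>q\<close> and the corresponding cosine satisfy a closed
  polynomial differential system with two first integrals, and the soliton equation for \<open>y\<^sub>i\<close> is an
  identity modulo these two integrals (\<open>soliton_equation_of_transform\<close>).
\<close>

section \<open>Piecewise continuous functions\<close>

definition piecewise_cont :: "real set \<Rightarrow> real \<Rightarrow> real \<Rightarrow> (real \<Rightarrow> 'v::real_normed_vector) \<Rightarrow> bool" where
  "piecewise_cont S c d f \<longleftrightarrow> bounded (f ` {c..d}) \<and> continuous_on ({c..d} - S) f"

text \<open>The endpoints of the interval count as breakpoints, so that off the breakpoints every derivative is
  two-sided.\<close>

locale breakpoints =
  fixes c d :: real and S :: "real set"
  assumes less: "c < d" and fin: "finite S" and cS: "c \<in> S" and dS: "d \<in> S"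
begin

abbreviation pc :: "(real \<Rightarrow> 'v::real_normed_vector) \<Rightarrow> bool" where
  "pc \<equiv> piecewise_cont S c d"

lemma open_pieces: "open ({c..d} - S)"
proof -
  have "{c..d} - S = {c<..<d} - S" using cS dS by (auto simp: less_le)
  then show ?thesis using fin by (simp add: finite_imp_closed open_Diff)
qed

lemma at_within_pieces: "t \<in> {c..d} - S \<Longrightarrow> at t within ({c..d} - S) = at t"
  using open_pieces by (rule at_within_open[rotated])

lemma at_within_piece: "t \<in> {c..d} - S \<Longrightarrow> at t within {c..d} = at t"
  using cS dS at_within_Icc_at[of c t d] by force

lemma pc_const [intro!]: "pc (\<lambda>t. a)"
  by (auto simp: piecewise_cont_def intro: bounded_subset[of "{a}"])

lemma pc_continuous: "continuous_on {c..d} f \<Longrightarrow> pc f"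
  unfolding piecewise_cont_def
  by (auto intro: compact_imp_bounded compact_continuous_image continuous_on_subset)

lemma pc_bounded_bilinear:
  assumes "bounded_bilinear b" "pc f" "pc g"
  shows "pc (\<lambda>t. b (f t) (g t))"
proof -
  interpret bounded_bilinear b by fact
  obtain A where A: "\<And>t. t \<in> {c..d} \<Longrightarrow> norm (f t) \<le> A"
    using assms(2) unfolding piecewise_cont_def bounded_iff by blast
  obtain B where B: "\<And>t. t \<in> {c..d} \<Longrightarrow> norm (g t) \<le> B"
    using assms(3) unfolding piecewise_cont_def bounded_iff by blast
  obtain K where K: "K \<ge> 0" "\<And>x y. norm (b x y) \<le> norm x * norm y * K"
    using nonneg_bounded by blast
  have "norm (b (f t) (g t)) \<le> A * B * K" if "t \<in> {c..d}" for t
  proof -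
    have "norm (f t) * norm (g t) \<le> A * B"
      using A[OF that] B[OF that] norm_ge_zero by (intro mult_mono) (auto intro: order_trans[OF norm_ge_zero])
    then show ?thesis using K by (meson mult_right_mono order_trans)
  qed
  then show ?thesis
    using assms(2,3) continuous_on unfolding piecewise_cont_def bounded_iff by blast
qed

lemmas pc_mult = pc_bounded_bilinear[OF bounded_bilinear_mult]
lemmas pc_scaleR = pc_bounded_bilinear[OF bounded_bilinear_scaleR]
lemmas pc_inner = pc_bounded_bilinear[OF bounded_bilinear_inner]

lemma pc_add: "pc f \<Longrightarrow> pc g \<Longrightarrow> pc (\<lambda>t. f t + g t)"
  unfolding piecewise_cont_def
  by (auto intro!: continuous_intros bounded_plus_comp)

lemma pc_minus: "pc f \<Longrightarrow> pc (\<lambda>t. - f t)"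
  unfolding piecewise_cont_def
  by (auto intro!: continuous_intros simp: bounded_iff)

lemma pc_diff: "pc f \<Longrightarrow> pc g \<Longrightarrow> pc (\<lambda>t. f t - g t)"
  using pc_add[OF _ pc_minus] by fastforce

lemma pc_Pair: "pc f \<Longrightarrow> pc g \<Longrightarrow> pc (\<lambda>t. (f t, g t))"
  unfolding piecewise_cont_def
  apply (auto intro!: continuous_intros)
  apply (rule bounded_subset[of "(f ` {c..d}) \<times> (g ` {c..d})"])
  apply (auto intro: bounded_Times)
  done

lemma pc_power2: "pc (f :: real \<Rightarrow> real) \<Longrightarrow> pc (\<lambda>t. (f t)\<^sup>2)"
  unfolding power2_eq_square by (rule pc_mult)

lemma pc_compose:
  fixes f :: "real \<Rightarrow> 'v::euclidean_space"
  assumes "continuous_on UNIV \<phi>" "pc f"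
  shows "pc (\<lambda>t. \<phi> (f t))"
proof -
  have "compact (closure (f ` {c..d}))"
    using assms(2) by (simp add: piecewise_cont_def)
  then have "bounded (\<phi> ` closure (f ` {c..d}))"
    by (meson assms(1) compact_continuous_image compact_imp_bounded continuous_on_subset subset_UNIV)
  then have "bounded ((\<lambda>t. \<phi> (f t)) ` {c..d})"
    by (rule bounded_subset) (auto intro!: imageI closure_subset[THEN subsetD])
  moreover have "continuous_on ({c..d} - S) (\<lambda>t. \<phi> (f t))"
    using assms by (auto simp: piecewise_cont_def intro: continuous_on_compose2)
  ultimately show ?thesis by (simp add: piecewise_cont_def)
qed

lemma pc_integrable:
  fixes f :: "real \<Rightarrow> 'v::euclidean_space"
  assumes "pc f" "{s..t} \<subseteq> {c..d}"
  shows "f integrable_on {s..t}"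
proof -
  obtain A where A: "\<And>t. t \<in> {c..d} \<Longrightarrow> norm (f t) \<le> A"
    using assms(1) unfolding piecewise_cont_def bounded_iff by blast
  have "f integrable_on {c..d} - S"
  proof (rule measurable_bounded_by_integrable_imp_integrable)
    show "f \<in> borel_measurable (lebesgue_on ({c..d} - S))"
      using assms(1) open_pieces unfolding piecewise_cont_def
      by (intro continuous_imp_measurable_on_sets_lebesgue) auto
    show "(\<lambda>_. A) integrable_on {c..d} - S"
      by (rule integrable_spike_set[of _ "{c..d}"])
        (auto intro: negligible_subset[OF negligible_finite[OF fin]])
    show "{c..d} - S \<in> sets lebesgue" using open_pieces by auto
  qed (use A in auto)
  then have "f integrable_on {c..d}"
    by (rule integrable_spike_set) (auto intro: negligible_subset[OF negligible_finite[OF fin]])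
  then show ?thesis using assms(2) integrable_on_subinterval by blast
qed

lemma pc_integrable': "pc (f :: real \<Rightarrow> 'v::euclidean_space) \<Longrightarrow> f integrable_on {c..d}"
  by (rule pc_integrable) auto

lemma antideriv:
  fixes f :: "real \<Rightarrow> 'v::euclidean_space"
  assumes "pc f" "t \<in> {c..d} - S"
  shows "((\<lambda>u. integral {c..u} f) has_vector_derivative f t) (at t)"
proof -
  have "continuous (at t within ({c..d} - S)) f"
    using assms unfolding piecewise_cont_def continuous_on_eq_continuous_within by blast
  from integral_has_vector_derivative_continuous_at[OF pc_integrable'[OF assms(1)] assms(2) fin this]
  show ?thesis by (simp add: at_within_pieces[OF assms(2)])
qed

lemma antideriv_continuous:
  fixes f :: "real \<Rightarrow> 'v::euclidean_space"
  assumes "pc f"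
  shows "continuous_on {c..d} (\<lambda>u. integral {c..u} f)"
  by (rule indefinite_integral_continuous_1[OF pc_integrable'[OF assms]])

lemma ftc:
  fixes F :: "real \<Rightarrow> 'v::euclidean_space"
  assumes "continuous_on {c..d} F"
    and "\<And>t. t \<in> {c..d} - S \<Longrightarrow> (F has_vector_derivative f t) (at t)"
    and "t \<in> {c..d}"
  shows "(f has_integral F t - F c) {c..t}"
  using assms by (intro fundamental_theorem_of_calculus_strong[OF fin])
    (auto intro: continuous_on_subset)

lemma const_if_derivative_zero:
  fixes F :: "real \<Rightarrow> 'v::euclidean_space"
  assumes "continuous_on {c..d} F"
    and "\<And>t. t \<in> {c..d} - S \<Longrightarrow> (F has_vector_derivative 0) (at t)"
    and "t \<in> {c..d}"
  shows "F t = F c"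
  using ftc[OF assms] by (simp add: has_integral_0_eq)

text \<open>Regularity is recovered from the first-order conditions by this lemma: they show that a velocity
  agrees off the breakpoints with a continuous function of the state, which excludes corners.\<close>

lemma derivative_extends:
  fixes F :: "real \<Rightarrow> 'v::euclidean_space"
  assumes F: "continuous_on {c..d} F" and g: "continuous_on {c..d} g"
    and der: "\<And>t. t \<in> {c..d} - S \<Longrightarrow> (F has_vector_derivative g t) (at t)"
    and t: "t \<in> {c..d}"
  shows "(F has_vector_derivative g t) (at t within {c..d})"
proof -
  have "((\<lambda>u. F c + integral {c..u} g) has_vector_derivative 0 + g t) (at t within {c..d})"
    by (intro has_vector_derivative_add has_vector_derivative_const integral_has_vector_derivative g t)
  from this have D: "((\<lambda>u. F c + integral {c..u} g) has_vector_derivative g t) (at t within {c..d})"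
    by simp
  have "F u = F c + integral {c..u} g" if "u \<in> {c..d}" for u
    using ftc[OF F der that] by (simp add: integral_unique)
  then show ?thesis
    by (rule has_vector_derivative_transform[OF t _ D])
qed

lemma eq_off_breakpoints:
  fixes f g :: "real \<Rightarrow> 'v::euclidean_space"
  assumes f: "continuous_on {c..d} f" and g: "continuous_on {c..d} g"
    and eq: "\<And>t. t \<in> {c..d} - S \<Longrightarrow> f t = g t" and t: "t \<in> {c..d}"
  shows "f t = g t"
proof -
  let ?F = "\<lambda>u. integral {c..u} f"
  have cF: "continuous_on {c..d} ?F" using antideriv_continuous pc_continuous f by blast
  have "(?F has_vector_derivative f t) (at t within {c..d})"
    by (rule integral_has_vector_derivative[OF f t])
  moreover have "(?F has_vector_derivative g t) (at t within {c..d})"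
    using antideriv[OF pc_continuous[OF f]] eq by (intro derivative_extends cF g t) auto
  ultimately show ?thesis
    using t less by (intro vector_derivative_unique_within[of t "{c..d}"])
      (auto simp: trivial_limit_within islimpt_Icc)
qed

text \<open>The integral from the left endpoint vanishes identically, and it can be differentiated off the
  breakpoints.\<close>

lemma zero_if_integral_zero:
  fixes f :: "real \<Rightarrow> real"
  assumes f: "pc f" and nn: "\<And>t. t \<in> {c..d} \<Longrightarrow> 0 \<le> f t" and 0: "integral {c..d} f = 0"
    and t: "t \<in> {c..d} - S"
  shows "f t = 0"
proof -
  let ?F = "\<lambda>u. integral {c..u} f"
  have z: "?F u = 0" if u: "u \<in> {c..d}" for u
  proof -
    have i1: "f integrable_on {c..u}" and i2: "f integrable_on {u..d}"
      using u by (auto intro!: pc_integrable[OF f])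
    have "?F u + integral {u..d} f = integral {c..d} f"
      using u by (intro Henstock_Kurzweil_Integration.integral_combine pc_integrable'[OF f]) auto
    moreover have "?F u \<ge> 0" "integral {u..d} f \<ge> 0"
      using u nn by (auto intro!: integral_nonneg i1 i2)
    ultimately show ?thesis using 0 by simp
  qed
  have "(?F has_vector_derivative f t) (at t within ({c..d} - S))"
    using antideriv[OF f t] has_vector_derivative_at_within by blast
  moreover have "(?F has_vector_derivative 0) (at t within ({c..d} - S))"
    by (rule has_vector_derivative_transform[OF t _ has_vector_derivative_const[of 0]]) (use z in auto)
  ultimately show ?thesis
    unfolding at_within_pieces[OF t] by (rule vector_derivative_unique_at)
qed

end

section \<open>Derivatives of integrals with respect to parameters\<close>

lemma bounded_on_bounded_interval:
  fixes g :: "real \<Rightarrow> 'v::euclidean_space"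
  assumes "continuous_on UNIV g"
  obtains B where "B > 0" "\<And>x. \<bar>x\<bar> \<le> R \<Longrightarrow> norm (g x) \<le> B"
proof -
  have "bounded (g ` {-R..R})"
    by (intro compact_imp_bounded compact_continuous_image continuous_on_subset[OF assms]) auto
  then obtain B where "B > 0" "\<And>y. y \<in> g ` {-R..R} \<Longrightarrow> norm y \<le> B"
    unfolding bounded_pos by blast
  then show thesis using that[of B] by (auto simp: abs_le_iff)
qed

lemma lipschitz_if_derivative_bounded:
  fixes f f' :: "real \<Rightarrow> 'v::real_normed_vector"
  assumes der: "\<And>x. (f has_vector_derivative f' x) (at x)"
    and B: "\<And>x. \<bar>x\<bar> \<le> R \<Longrightarrow> norm (f' x) \<le> B" and "\<bar>x\<bar> \<le> R" "\<bar>y\<bar> \<le> R"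
  shows "norm (f y - f x) \<le> B * \<bar>y - x\<bar>"
proof -
  have "norm (f y - f x) \<le> B * norm (y - x)"
  proof (rule differentiable_bound[of "{-R..R}" f "\<lambda>x h. h *\<^sub>R f' x"])
    fix x assume "x \<in> {-R..R}"
    then have "norm (f' x) \<le> B" using B by (simp add: abs_le_iff)
    then have "norm h * norm (f' x) \<le> norm h * B" for h :: real
      by (rule mult_left_mono) simp
    then show "onorm (\<lambda>h. h *\<^sub>R f' x) \<le> B"
      by (intro onorm_le) (simp add: mult.commute)
    show "(f has_derivative (\<lambda>h. h *\<^sub>R f' x)) (at x within {-R..R})"
      using der has_derivative_at_withinI unfolding has_vector_derivative_def by blast
  qed (use assms(3,4) in \<open>auto simp: abs_le_iff\<close>)
  then show ?thesis by simp
qed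

lemma has_derivative_quadratic_remainder:
  fixes f :: "'b::euclidean_space \<Rightarrow> 'v::real_normed_vector"
  assumes L: "linear L" and B: "\<And>e. norm e \<le> 1 \<Longrightarrow> norm (f e - f 0 - L e) \<le> B * (norm e)\<^sup>2"
  shows "(f has_derivative L) (at 0)"
proof (rule has_derivativeI_sandwich[of 1])
  show "bounded_linear L" using L by (simp add: linear_conv_bounded_linear)
  show "((\<lambda>e. B * norm e) \<longlongrightarrow> 0) (at 0)"
    by (auto intro!: tendsto_eq_intros)
  fix e :: 'b assume "e \<noteq> 0" "dist e 0 < 1"
  then show "norm (f e - f 0 - L (e - 0)) / norm (e - 0) \<le> B * norm e"
    using B[of e] by (simp add: divide_simps power2_eq_square mult.assoc)
qed simp

context breakpoints
begin

lemma pc_inner_const: "pc K \<Longrightarrow> pc (\<lambda>t. e \<bullet> K t)"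
  by (rule pc_inner[OF pc_const])

text \<open>The integrand is only piecewise continuous in \<open>t\<close>, so the Leibniz rule for jointly continuous
  integrands does not apply. The remainder is bounded by the Taylor formula instead, uniformly in \<open>t\<close>
  because all functions involved are bounded. The special form covers all that is needed: the
  choices of \<open>\<phi>\<close> are a constant, the identity, an exponential and the unit circle.\<close>

lemma param_integral_derivative_at_0:
  fixes k h :: "real \<Rightarrow> real" and K H :: "real \<Rightarrow> 'b::euclidean_space"
    and \<phi> \<phi>' \<phi>'' :: "real \<Rightarrow> 'v::euclidean_space"
  assumes k: "pc k" and h: "pc h" and K: "pc K" and H: "pc H"
    and d1: "\<And>x. (\<phi> has_vector_derivative \<phi>' x) (at x)"
    and d2: "\<And>x. (\<phi>' has_vector_derivative \<phi>'' x) (at x)"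
    and c2: "continuous_on UNIV \<phi>''"
  shows "((\<lambda>e. integral {c..d} (\<lambda>t. (k t + e \<bullet> K t) *\<^sub>R \<phi> (h t + e \<bullet> H t))) has_derivative
          (\<lambda>e. integral {c..d} (\<lambda>t. (e \<bullet> K t) *\<^sub>R \<phi> (h t) + (k t * (e \<bullet> H t)) *\<^sub>R \<phi>' (h t)))) (at 0)"
    (is "(?f has_derivative ?L) _")
proof -
  have c0: "continuous_on UNIV \<phi>" and c1: "continuous_on UNIV \<phi>'"
    using d1 d2 by (meson continuous_at_imp_continuous_on has_vector_derivative_continuous)+
  obtain A where A: "A > 0" "\<And>t. t \<in> {c..d} \<Longrightarrow> \<bar>k t\<bar> \<le> A" "\<And>t. t \<in> {c..d} \<Longrightarrow> \<bar>h t\<bar> \<le> A"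
    "\<And>t. t \<in> {c..d} \<Longrightarrow> norm (K t) \<le> A" "\<And>t. t \<in> {c..d} \<Longrightarrow> norm (H t) \<le> A"
  proof -
    have "bounded (k ` {c..d} \<union> h ` {c..d})" "bounded (K ` {c..d} \<union> H ` {c..d})"
      using k h K H by (simp_all add: piecewise_cont_def)
    then obtain A1 A2 where pos: "A1 > 0" "A2 > 0"
      and A1: "\<forall>x\<in>k ` {c..d} \<union> h ` {c..d}. norm x \<le> A1"
      and A2: "\<forall>x\<in>K ` {c..d} \<union> H ` {c..d}. norm x \<le> A2"
      unfolding bounded_pos by blast
    have "\<bar>k t\<bar> \<le> A1 + A2" "\<bar>h t\<bar> \<le> A1 + A2" "norm (K t) \<le> A1 + A2" "norm (H t) \<le> A1 + A2"
      if "t \<in> {c..d}" for t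
    proof -
      have "norm (k t) \<le> A1" "norm (h t) \<le> A1" "norm (K t) \<le> A2" "norm (H t) \<le> A2"
        using A1 A2 that by blast+
      then show "\<bar>k t\<bar> \<le> A1 + A2" "\<bar>h t\<bar> \<le> A1 + A2" "norm (K t) \<le> A1 + A2" "norm (H t) \<le> A1 + A2"
        using pos by auto
    qed
    then show thesis using that[of "A1 + A2"] pos by auto
  qed
  define R where "R = 2 * A"
  obtain B1 where B1: "B1 > 0" "\<And>x. \<bar>x\<bar> \<le> R \<Longrightarrow> norm (\<phi>' x) \<le> B1"
    using bounded_on_bounded_interval[OF c1] by blast
  obtain B2 where B2: "B2 > 0" "\<And>x. \<bar>x\<bar> \<le> R \<Longrightarrow> norm (\<phi>'' x) \<le> B2"
    using bounded_on_bounded_interval[OF c2] by blast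
  have seg: "closed_segment x y \<subseteq> {-R..R}" if "\<bar>x\<bar> \<le> R" "\<bar>y\<bar> \<le> R" for x y
    using that by (intro closed_segment_subset) (auto simp: abs_le_iff)
  have lip: "norm (\<phi> y - \<phi> x) \<le> B1 * \<bar>y - x\<bar>" if "\<bar>x\<bar> \<le> R" "\<bar>y\<bar> \<le> R" for x y
    using that by (intro lipschitz_if_derivative_bounded[OF d1 B1(2)])
  have lip': "norm (\<phi>' y - \<phi>' x) \<le> B2 * \<bar>y - x\<bar>" if "\<bar>x\<bar> \<le> R" "\<bar>y\<bar> \<le> R" for x y
    using that by (intro lipschitz_if_derivative_bounded[OF d2 B2(2)])
  have taylor: "norm (\<phi> y - \<phi> x - (y - x) *\<^sub>R \<phi>' x) \<le> B2 * (y - x)\<^sup>2" if xy: "\<bar>x\<bar> \<le> R" "\<bar>y\<bar> \<le> R" for x y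
  proof -
    have "norm (\<phi> y - \<phi> x - (y - x) *\<^sub>R \<phi>' x) \<le> norm (y - x) * (B2 * \<bar>y - x\<bar>)"
    proof (rule vector_differentiable_bound_linearization[of "closed_segment x y"])
      fix z assume z: "z \<in> closed_segment x y"
      then have "\<bar>z\<bar> \<le> R" using seg[OF xy] by (auto simp: abs_le_iff)
      moreover have "\<bar>z - x\<bar> \<le> \<bar>y - x\<bar>"
        using z segment_bound1[of z x y] by (simp add: norm_minus_commute)
      ultimately show "norm (\<phi>' z - \<phi>' x) \<le> B2 * \<bar>y - x\<bar>"
        using lip'[OF xy(1)] B2(1) by (meson mult_left_mono less_imp_le order_trans)
    qed (auto intro: has_vector_derivative_at_within d1)
    also have "\<dots> = B2 * (y - x)\<^sup>2"
      by (simp only: real_norm_def mult.left_commute abs_mult_self_eq power2_eq_square)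
    finally show ?thesis .
  qed
  have pcf: "pc (\<lambda>t. (k t + e \<bullet> K t) *\<^sub>R \<phi> (h t + e \<bullet> H t))" for e
    by (intro pc_scaleR pc_compose[OF c0] pc_add k h pc_inner_const K H)
  have pcL: "pc (\<lambda>t. (e \<bullet> K t) *\<^sub>R \<phi> (h t) + (k t * (e \<bullet> H t)) *\<^sub>R \<phi>' (h t))" for e
    by (intro pc_scaleR pc_compose[OF c0] pc_compose[OF c1] pc_add pc_mult k h pc_inner_const K H)
  have lin: "linear ?L"
  proof (rule linearI)
    fix x y
    show "?L (x + y) = ?L x + ?L y"
      by (subst integral_add[symmetric, OF pc_integrable'[OF pcL] pc_integrable'[OF pcL]])
        (simp add: algebra_simps)
    fix r show "?L (r *\<^sub>R x) = r *\<^sub>R ?L x"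
      by (subst integral_cmul[symmetric]) (simp add: algebra_simps)
  qed
  define B where "B = A * (B2 * A\<^sup>2) + A * (B1 * A)"
  show ?thesis
  proof (rule has_derivative_quadratic_remainder[OF lin, of _ "B * (d - c)"])
    fix e :: 'b assume e: "norm e \<le> 1"
    let ?r = "\<lambda>t. (k t + e \<bullet> K t) *\<^sub>R \<phi> (h t + e \<bullet> H t) - k t *\<^sub>R \<phi> (h t)
      - ((e \<bullet> K t) *\<^sub>R \<phi> (h t) + (k t * (e \<bullet> H t)) *\<^sub>R \<phi>' (h t))"
    have pc0: "pc (\<lambda>t. k t *\<^sub>R \<phi> (h t))"
      by (intro pc_scaleR pc_compose[OF c0] k h)
    have r: "norm (?r t) \<le> B * (norm e)\<^sup>2" if t: "t \<in> {c..d}" for t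
    proof -
      have eK: "\<bar>e \<bullet> K t\<bar> \<le> A * norm e" and eH: "\<bar>e \<bullet> H t\<bar> \<le> A * norm e"
        using Cauchy_Schwarz_ineq2[of e "K t"] Cauchy_Schwarz_ineq2[of e "H t"] A(4,5)[OF t]
        by (smt (verit, ccfv_threshold) mult.commute mult_left_mono norm_ge_zero)+
      then have "\<bar>e \<bullet> H t\<bar> \<le> A" using e A(1)
        by (meson mult_left_le order_trans less_imp_le)
      then have R: "\<bar>h t\<bar> \<le> R" "\<bar>h t + e \<bullet> H t\<bar> \<le> R" using A(1) A(3)[OF t] by (auto simp: R_def)
      let ?u = "\<phi> (h t + e \<bullet> H t) - \<phi> (h t)"
      have "?r t = k t *\<^sub>R (?u - (e \<bullet> H t) *\<^sub>R \<phi>' (h t)) + (e \<bullet> K t) *\<^sub>R ?u"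
        by (simp add: algebra_simps)
      then have "norm (?r t) \<le> \<bar>k t\<bar> * norm (?u - (e \<bullet> H t) *\<^sub>R \<phi>' (h t)) + \<bar>e \<bullet> K t\<bar> * norm ?u"
        by (metis norm_scaleR norm_triangle_ineq)
      also have "\<dots> \<le> A * (B2 * (A * norm e)\<^sup>2) + (A * norm e) * (B1 * (A * norm e))"
      proof (intro add_mono mult_mono A(2) t eK)
        have "norm (?u - (e \<bullet> H t) *\<^sub>R \<phi>' (h t)) \<le> B2 * (e \<bullet> H t)\<^sup>2"
          using taylor[OF R] by simp
        also have "\<dots> \<le> B2 * (A * norm e)\<^sup>2"
          using eH B2(1) by (intro mult_left_mono) (auto intro!: abs_le_square_iff[THEN iffD1])
        finally show "norm (?u - (e \<bullet> H t) *\<^sub>R \<phi>' (h t)) \<le> B2 * (A * norm e)\<^sup>2" .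
        have "norm ?u \<le> B1 * \<bar>e \<bullet> H t\<bar>" using lip[OF R] by simp
        also have "\<dots> \<le> B1 * (A * norm e)" using eH B1(1) by (intro mult_left_mono) auto
        finally show "norm ?u \<le> B1 * (A * norm e)" .
      qed (use A(1) in auto)
      also have "\<dots> = B * (norm e)\<^sup>2" by (simp add: B_def power2_eq_square algebra_simps)
      finally show ?thesis .
    qed
    have "?f e - ?f 0 - ?L e = integral {c..d} ?r"
      using pc_integrable'[OF pcf[of e]] pc_integrable'[OF pcL[of e]] pc_integrable'[OF pc0]
      by (simp add: integral_diff integrable_diff)
    moreover have "norm (integral {c..d} ?r) \<le> B * (norm e)\<^sup>2 * (d - c)"
    proof -
      have "pc ?r" by (intro pc_diff pcf pcL pc0)
      then have "norm (integral {c..d} ?r) \<le> integral {c..d} (\<lambda>t. B * (norm e)\<^sup>2)"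
        using r by (intro integral_norm_bound_integral pc_integrable') auto
      then show ?thesis using less by (simp add: mult_ac)
    qed
    ultimately show "norm (?f e - ?f 0 - ?L e) \<le> B * (d - c) * (norm e)\<^sup>2"
      by (simp add: mult_ac)
  qed
qed

lemma param_integral_derivative:
  fixes k h :: "real \<Rightarrow> real" and K H :: "real \<Rightarrow> 'b::euclidean_space"
    and \<phi> \<phi>' \<phi>'' :: "real \<Rightarrow> 'v::euclidean_space"
  assumes "pc k" "pc h" and K: "pc K" and H: "pc H"
    and "\<And>x. (\<phi> has_vector_derivative \<phi>' x) (at x)"
    and "\<And>x. (\<phi>' has_vector_derivative \<phi>'' x) (at x)"
    and "continuous_on UNIV \<phi>''"
  shows "((\<lambda>e. integral {c..d} (\<lambda>t. (k t + e \<bullet> K t) *\<^sub>R \<phi> (h t + e \<bullet> H t))) has_derivative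
          (\<lambda>e. integral {c..d} (\<lambda>t. (e \<bullet> K t) *\<^sub>R \<phi> (h t + z \<bullet> H t)
             + ((k t + z \<bullet> K t) * (e \<bullet> H t)) *\<^sub>R \<phi>' (h t + z \<bullet> H t)))) (at z)"
proof -
  have "pc (\<lambda>t. k t + z \<bullet> K t)" "pc (\<lambda>t. h t + z \<bullet> H t)"
    by (intro pc_add assms pc_inner_const K H)+
  note at_0 = param_integral_derivative_at_0[OF this K H assms(5-7)]
  define G where "G = (\<lambda>e. integral {c..d} (\<lambda>t. (k t + z \<bullet> K t + e \<bullet> K t) *\<^sub>R \<phi> (h t + z \<bullet> H t + e \<bullet> H t)))"
  have "((\<lambda>e. e - z) has_derivative (\<lambda>e. e)) (at z)"
    by (rule has_derivative_diff[OF has_derivative_ident has_derivative_const, simplified])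
  moreover have "(G has_derivative (\<lambda>e. integral {c..d} (\<lambda>t. (e \<bullet> K t) *\<^sub>R \<phi> (h t + z \<bullet> H t)
             + ((k t + z \<bullet> K t) * (e \<bullet> H t)) *\<^sub>R \<phi>' (h t + z \<bullet> H t)))) (at (z - z))"
    unfolding diff_self G_def by (rule at_0)
  ultimately have "((\<lambda>e. G (e - z)) has_derivative (\<lambda>e. integral {c..d} (\<lambda>t. (e \<bullet> K t) *\<^sub>R \<phi> (h t + z \<bullet> H t)
             + ((k t + z \<bullet> K t) * (e \<bullet> H t)) *\<^sub>R \<phi>' (h t + z \<bullet> H t)))) (at z)"
    by (rule has_derivative_compose)
  moreover have "G (e - z) = integral {c..d} (\<lambda>t. (k t + e \<bullet> K t) *\<^sub>R \<phi> (h t + e \<bullet> H t))" for e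
    by (simp add: G_def inner_diff_left)
  ultimately show ?thesis by simp
qed

end

section \<open>Coordinates on the configuration space\<close>

lemma rot90_components [simp]: "rot90 v $ 1 = - v $ 2" "rot90 v $ 2 = v $ 1"
  by (simp_all add: rot90_def)

lemma plane_eq_iff: "u = v \<longleftrightarrow> u $ 1 = v $ 1 \<and> u $ 2 = v $ 2" for u v :: plane
  by (simp add: vec_eq_iff forall_2)

lemma plane_inner: "u \<bullet> v = u $ 1 * v $ 1 + u $ 2 * v $ 2" for u v :: plane
  by (simp add: inner_vec_def sum_2)

lemma linear_rot90: "linear rot90"
  by (rule linearI) (simp_all add: plane_eq_iff)

lemma bounded_linear_rot90: "bounded_linear rot90"
  using linear_rot90 by (simp add: linear_conv_bounded_linear)

lemmas rot90_linear = linear_add[OF linear_rot90] linear_diff[OF linear_rot90]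
  linear_scale[OF linear_rot90] linear_neg[OF linear_rot90] linear_0[OF linear_rot90]

lemmas has_vector_derivative_rot90 [derivative_intros] =
  bounded_linear.has_vector_derivative[OF bounded_linear_rot90]

lemmas continuous_on_rot90 [continuous_intros] =
  bounded_linear.continuous_on[OF bounded_linear_rot90]

lemma rot90_rot90 [simp]: "rot90 (rot90 v) = - v"
  by (simp add: plane_eq_iff)

lemma inner_rot90_self [simp]: "v \<bullet> rot90 v = 0" "rot90 v \<bullet> v = 0"
  by (simp_all add: plane_inner)

lemma inner_rot90_rot90 [simp]: "rot90 u \<bullet> rot90 v = u \<bullet> v"
  by (simp add: plane_inner)

lemma inner_rot90_swap: "rot90 u \<bullet> v = - (u \<bullet> rot90 v)"
  by (simp add: plane_inner)

lemma norm_rot90 [simp]: "norm (rot90 v) = norm v"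
  by (simp add: norm_eq_sqrt_inner)

lemma frame_expansion:
  assumes "norm u = 1"
  shows "v = (v \<bullet> u) *\<^sub>R u + (v \<bullet> rot90 u) *\<^sub>R rot90 u"
proof -
  have "(u $ 1)\<^sup>2 + (u $ 2)\<^sup>2 = 1"
    using assms by (simp add: norm_eq_sqrt_inner plane_inner power2_eq_square)
  then show ?thesis by (simp add: plane_eq_iff plane_inner) algebra
qed

definition dir :: "real \<Rightarrow> plane" where
  "dir \<theta> = vector [cos \<theta>, sin \<theta>]"

lemma dir_components [simp]: "dir \<theta> $ 1 = cos \<theta>" "dir \<theta> $ 2 = sin \<theta>"
  by (simp_all add: dir_def)

lemma inner_dir_dir [simp]: "dir \<theta> \<bullet> dir \<theta> = 1"
  by (simp add: plane_inner power2_eq_square[symmetric])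

lemma norm_dir [simp]: "norm (dir \<theta>) = 1"
  by (simp add: norm_eq_sqrt_inner)

lemma unit_vector_eq_dir:
  assumes "norm (u :: plane) = 1"
  obtains \<theta> where "u = dir \<theta>"
proof -
  have "(u $ 1)\<^sup>2 + (u $ 2)\<^sup>2 = 1"
    using assms by (simp add: norm_eq_sqrt_inner plane_inner power2_eq_square)
  then obtain \<theta> where "u $ 1 = cos \<theta>" "u $ 2 = sin \<theta>"
    using sincos_total_2pi by metis
  then show thesis by (intro that[of \<theta>]) (simp add: plane_eq_iff)
qed

lemma has_vector_derivative_plane:
  fixes f :: "real \<Rightarrow> plane"
  assumes "((\<lambda>t. f t $ 1) has_real_derivative f' $ 1) F" "((\<lambda>t. f t $ 2) has_real_derivative f' $ 2) F"
  shows "(f has_vector_derivative f') F"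
proof -
  have "((\<lambda>t. (f t $ 1) *\<^sub>R axis 1 1 + (f t $ 2) *\<^sub>R axis 2 1) has_vector_derivative
    (f' $ 1) *\<^sub>R axis 1 1 + (f' $ 2) *\<^sub>R (axis 2 1 :: plane)) F"
    by (intro has_vector_derivative_add bounded_linear.has_vector_derivative[OF bounded_linear_scaleR_left]
        assms[unfolded has_real_derivative_iff_has_vector_derivative])
  moreover have "(v $ 1) *\<^sub>R axis 1 1 + (v $ 2) *\<^sub>R (axis 2 1 :: plane) = v" for v
    by (simp add: plane_eq_iff axis_def)
  ultimately show ?thesis by (simp only:)
qed

lemma has_vector_derivative_dir: "(dir has_vector_derivative rot90 (dir \<theta>)) (at \<theta>)"
  by (rule has_vector_derivative_plane) (auto intro!: derivative_eq_intros)

lemma has_vector_derivative_dir_comp: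
  assumes "(\<theta> has_real_derivative \<omega>) (at t within A)"
  shows "((\<lambda>t. dir (\<theta> t)) has_vector_derivative \<omega> *\<^sub>R rot90 (dir (\<theta> t))) (at t within A)"
  by (rule has_vector_derivative_plane) (use assms in \<open>auto intro!: derivative_eq_intros\<close>)

lemma continuous_on_dir [continuous_intros]:
  "continuous_on A \<theta> \<Longrightarrow> continuous_on A (\<lambda>t. dir (\<theta> t))"
  using has_vector_derivative_dir
  by (metis continuous_at_imp_continuous_on continuous_on_compose2 has_vector_derivative_continuous subset_UNIV)

lemma one_plus_square_neq_0 [simp]: "w\<^sup>2 + 1 \<noteq> (0 :: real)"
  by (metis add_pos_nonneg less_numeral_extra(3) zero_le_power2 zero_less_one add.commute)

text \<open>The unit vector at angle \<open>\<beta>\<close> from \<open>dir \<theta>\<close>, where \<open>w = cot (\<beta>/2)\<close>: the two coefficients are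
  \<open>cos \<beta>\<close> and \<open>sin \<beta>\<close>.\<close>

definition second_dir :: "real \<Rightarrow> real \<Rightarrow> plane" where
  "second_dir \<theta> w = ((w\<^sup>2 - 1) / (w\<^sup>2 + 1)) *\<^sub>R dir \<theta> + (2 * w / (w\<^sup>2 + 1)) *\<^sub>R rot90 (dir \<theta>)"

definition linkage_of :: "real \<Rightarrow> plane \<Rightarrow> real \<Rightarrow> real \<Rightarrow> linkage" where
  "linkage_of l m \<theta> w =
     (m - l *\<^sub>R dir \<theta>, m, m - l *\<^sub>R dir \<theta> + l *\<^sub>R second_dir \<theta> w)"

lemma pt_linkage_of [simp]:
  "pt_x (linkage_of l m \<theta> w) = m - l *\<^sub>R dir \<theta>"
  "pt_m1 (linkage_of l m \<theta> w) = m"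
  "pt_m2 (linkage_of l m \<theta> w) = m - l *\<^sub>R dir \<theta> + l *\<^sub>R second_dir \<theta> w"
  by (simp_all add: linkage_of_def pt_x_def pt_m1_def pt_m2_def)

lemma inner_second_dir:
  "second_dir \<theta> w \<bullet> dir \<theta> = (w\<^sup>2 - 1) / (w\<^sup>2 + 1)"
  "second_dir \<theta> w \<bullet> rot90 (dir \<theta>) = 2 * w / (w\<^sup>2 + 1)"
  by (simp_all add: second_dir_def inner_add_left)

lemma norm_second_dir: "norm (second_dir \<theta> w) = 1"
proof -
  have "w\<^sup>2 + 1 \<noteq> 0" by (rule one_plus_square_neq_0)
  then have "((w\<^sup>2 - 1) / (w\<^sup>2 + 1))\<^sup>2 + (2 * w / (w\<^sup>2 + 1))\<^sup>2 = 1"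
    by (simp add: power_divide add_divide_distrib[symmetric] divide_eq_eq) (simp add: power2_eq_square algebra_simps)
  then have "second_dir \<theta> w \<bullet> second_dir \<theta> w = 1"
    unfolding second_dir_def by (simp add: inner_add_left inner_add_right power2_eq_square)
  then show ?thesis by (simp add: norm_eq_sqrt_inner)
qed

lemma second_dir_neq: "second_dir \<theta> w \<noteq> dir \<theta>"
proof
  assume "second_dir \<theta> w = dir \<theta>"
  then have "(w\<^sup>2 - 1) / (w\<^sup>2 + 1) = 1" using inner_second_dir(1)[of \<theta> w] by simp
  then show False by (simp add: divide_eq_eq split: if_splits)
qed

lemma linkage_of_in_configuration_space:
  assumes "l > 0"
  shows "linkage_of l m \<theta> w \<in> configuration_space l l"
proof -
  have "l *\<^sub>R dir \<theta> \<noteq> l *\<^sub>R second_dir \<theta> w" using assms second_dir_neq[of \<theta> w] by simp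
  then show ?thesis
    using assms by (simp add: configuration_space_def dist_norm norm_second_dir algebra_simps)
qed

text \<open>The half-angle formula \<open>cot (\<beta>/2) = sin \<beta> / (1 - cos \<beta>)\<close>, whose denominator vanishes only for
  coinciding directions.\<close>

lemma second_dir_reconstruct:
  assumes v: "norm v = 1" "v \<noteq> dir \<theta>"
  shows "1 - v \<bullet> dir \<theta> \<noteq> 0" "v = second_dir \<theta> ((v \<bullet> rot90 (dir \<theta>)) / (1 - v \<bullet> dir \<theta>))"
proof -
  let ?C = "v \<bullet> dir \<theta>" and ?s = "v \<bullet> rot90 (dir \<theta>)"
  have e: "v = ?C *\<^sub>R dir \<theta> + ?s *\<^sub>R rot90 (dir \<theta>)"
    by (rule frame_expansion) simp
  have "v \<bullet> v = 1" using v(1) by (simp add: norm_eq_sqrt_inner)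
  then have cs: "?C\<^sup>2 + ?s\<^sup>2 = 1"
    by (subst (asm) (1 2) e) (simp add: inner_add_left inner_add_right power2_eq_square)
  show ne: "1 - ?C \<noteq> 0"
  proof
    assume "1 - ?C = 0"
    then have "?C = 1" "?s = 0" using cs by auto
    then show False using e v(2) by simp
  qed
  let ?w = "?s / (1 - ?C)"
  have den: "?w\<^sup>2 + 1 = 2 / (1 - ?C)" "?w\<^sup>2 - 1 = 2 * ?C / (1 - ?C)"
  proof -
    have "?s\<^sup>2 = (1 - ?C) * (1 + ?C)" using cs by (simp add: power2_eq_square algebra_simps)
    then have "?w\<^sup>2 = (1 + ?C) / (1 - ?C)" using ne by (simp add: power_divide power2_eq_square)
    then show "?w\<^sup>2 + 1 = 2 / (1 - ?C)" "?w\<^sup>2 - 1 = 2 * ?C / (1 - ?C)"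
      using ne by (simp_all add: field_simps)
  qed
  have "(?w\<^sup>2 - 1) / (?w\<^sup>2 + 1) = ?C" "2 * ?w / (?w\<^sup>2 + 1) = ?s"
    unfolding den using ne by simp_all
  then show "v = second_dir \<theta> ?w" unfolding second_dir_def using e by simp
qed

lemma has_vector_derivative_second_dir:
  assumes \<theta>: "(\<theta> has_real_derivative \<omega>) (at t)" and w: "(w has_real_derivative w') (at t)"
  shows "((\<lambda>t. second_dir (\<theta> t) (w t)) has_vector_derivative
     (\<omega> - 2 * w' / ((w t)\<^sup>2 + 1)) *\<^sub>R rot90 (second_dir (\<theta> t) (w t))) (at t)"
proof -
  have pos: "(w t)\<^sup>2 + 1 \<noteq> 0" by (rule one_plus_square_neq_0)
  let ?D = "(w t)\<^sup>2 + 1" let ?C = "((w t)\<^sup>2 - 1) / ?D" and ?s = "2 * w t / ?D"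
  have C: "((\<lambda>t. ((w t)\<^sup>2 - 1) / ((w t)\<^sup>2 + 1)) has_real_derivative (2 * w' / ?D) * ?s) (at t)"
    by (rule derivative_eq_intros w refl pos)+ (use pos in \<open>simp add: divide_simps, simp add: algebra_simps\<close>)
  have S: "((\<lambda>t. 2 * w t / ((w t)\<^sup>2 + 1)) has_real_derivative - (2 * w' / ?D) * ?C) (at t)"
    by (rule derivative_eq_intros w refl pos)+ (use pos in \<open>simp add: divide_simps, simp add: algebra_simps power2_eq_square\<close>)
  have turn: "C *\<^sub>R \<omega> *\<^sub>R rot90 u + (a * s) *\<^sub>R u + (s *\<^sub>R rot90 (\<omega> *\<^sub>R rot90 u) + (- a * C) *\<^sub>R rot90 u)
      = (\<omega> - a) *\<^sub>R rot90 (C *\<^sub>R u + s *\<^sub>R rot90 u)" for a C s u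
    by (simp add: rot90_linear algebra_simps)
  show ?thesis
    unfolding second_dir_def
    using has_vector_derivative_add[OF has_vector_derivative_scaleR[OF C has_vector_derivative_dir_comp[OF \<theta>]]
        has_vector_derivative_scaleR[OF S has_vector_derivative_rot90[OF has_vector_derivative_dir_comp[OF \<theta>]]]]
    by (rule has_vector_derivative_eq_rhs) (rule turn)
qed

text \<open>Differentiating \<open>cot (\<beta>/2)\<close> turns the condition that \<open>m\<^sub>2\<close> moves along its segment into the linear
  equation for \<open>w\<close>.\<close>

lemma linkage_velocity:
  assumes m: "(m has_vector_derivative p *\<^sub>R dir (\<theta> t)) (at t)"
    and \<theta>: "(\<theta> has_real_derivative \<omega>) (at t)"
    and w: "(w has_real_derivative \<omega> - p / l * w t) (at t)" and l: "l \<noteq> 0"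
  shows "((\<lambda>t. m t - l *\<^sub>R dir (\<theta> t)) has_vector_derivative
      p *\<^sub>R dir (\<theta> t) - (l * \<omega>) *\<^sub>R rot90 (dir (\<theta> t))) (at t)" (is ?X)
    and "((\<lambda>t. m t - l *\<^sub>R dir (\<theta> t) + l *\<^sub>R second_dir (\<theta> t) (w t)) has_vector_derivative
      ((p * ((w t)\<^sup>2 - 1) - 2 * l * \<omega> * w t) / ((w t)\<^sup>2 + 1)) *\<^sub>R second_dir (\<theta> t) (w t)) (at t)" (is ?M)
proof -
  show X: ?X
    unfolding scaleR_scaleR[symmetric]
    by (intro has_vector_derivative_diff m has_vector_derivative_dir_comp[OF \<theta>]
        bounded_linear.has_vector_derivative[OF bounded_linear_scaleR_right])
  have pos: "(w t)\<^sup>2 + 1 \<noteq> 0" by (rule one_plus_square_neq_0)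
  let ?W = "w t" let ?D = "?W\<^sup>2 + 1" let ?k = "(p * (?W\<^sup>2 - 1) - 2 * l * \<omega> * ?W) / ?D"
  have "((\<lambda>t. m t - l *\<^sub>R dir (\<theta> t) + l *\<^sub>R second_dir (\<theta> t) (w t)) has_vector_derivative
      (p *\<^sub>R dir (\<theta> t) - (l * \<omega>) *\<^sub>R rot90 (dir (\<theta> t)))
       + l *\<^sub>R ((\<omega> - 2 * (\<omega> - p / l * ?W) / ?D) *\<^sub>R rot90 (second_dir (\<theta> t) ?W))) (at t)"
    by (intro has_vector_derivative_add X has_vector_derivative_second_dir \<theta> w
        bounded_linear.has_vector_derivative[OF bounded_linear_scaleR_right])
  moreover have "(p *\<^sub>R dir (\<theta> t) - (l * \<omega>) *\<^sub>R rot90 (dir (\<theta> t)))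
       + l *\<^sub>R ((\<omega> - 2 * (\<omega> - p / l * ?W) / ?D) *\<^sub>R rot90 (second_dir (\<theta> t) ?W))
      = ?k *\<^sub>R second_dir (\<theta> t) ?W"
  proof -
    define a where "a = l * (\<omega> - 2 * (\<omega> - p / l * ?W) / ?D)"
    have a: "a = (l * \<omega> * (?W\<^sup>2 - 1) + 2 * p * ?W) / ?D"
      unfolding a_def using l pos by (simp add: divide_simps) (simp add: algebra_simps)
    have 1: "p - a * (2 * ?W / ?D) = ?k * ((?W\<^sup>2 - 1) / ?D)"
      unfolding a using pos by (simp add: divide_simps) (simp add: algebra_simps power2_eq_square)
    have 2: "a * ((?W\<^sup>2 - 1) / ?D) - l * \<omega> = ?k * (2 * ?W / ?D)"
      unfolding a using pos by (simp add: divide_simps) (simp add: algebra_simps power2_eq_square)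
    have "(p *\<^sub>R dir (\<theta> t) - (l * \<omega>) *\<^sub>R rot90 (dir (\<theta> t))) + a *\<^sub>R rot90 (second_dir (\<theta> t) ?W)
      = (p - a * (2 * ?W / ?D)) *\<^sub>R dir (\<theta> t) + (a * ((?W\<^sup>2 - 1) / ?D) - l * \<omega>) *\<^sub>R rot90 (dir (\<theta> t))"
      unfolding second_dir_def by (simp add: rot90_linear algebra_simps)
    also have "\<dots> = ?k *\<^sub>R second_dir (\<theta> t) ?W"
      unfolding 1 2 second_dir_def by (simp add: algebra_simps)
    finally show ?thesis by (simp add: a_def)
  qed
  ultimately show ?M by simp
qed

section \<open>Horizontal curves as quadratures\<close>

context breakpoints
begin

text \<open>The control system in the coordinates \<open>(m, \<theta>, w)\<close>: the control \<open>p\<close> is the signed speed of \<open>m\<^sub>1\<close>, the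
  control \<open>\<omega>\<close> is the angular velocity of its segment.\<close>

definition driven :: "real \<Rightarrow> (real \<Rightarrow> real) \<Rightarrow> (real \<Rightarrow> real) \<Rightarrow> (real \<Rightarrow> plane) \<Rightarrow> (real \<Rightarrow> real) \<Rightarrow> (real \<Rightarrow> real) \<Rightarrow> bool" where
  "driven l p \<omega> m \<theta> w \<longleftrightarrow> pc p \<and> pc \<omega> \<and>
     continuous_on {c..d} m \<and> continuous_on {c..d} \<theta> \<and> continuous_on {c..d} w \<and>
     (\<forall>t\<in>{c..d} - S. (m has_vector_derivative p t *\<^sub>R dir (\<theta> t)) (at t) \<and>
        (\<theta> has_real_derivative \<omega> t) (at t) \<and>
        (w has_real_derivative \<omega> t - p t / l * w t) (at t))"

lemma drivenD:
  assumes "driven l p \<omega> m \<theta> w"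
  shows "pc p" "pc \<omega>" "continuous_on {c..d} m" "continuous_on {c..d} \<theta>" "continuous_on {c..d} w"
    "\<And>t. t \<in> {c..d} - S \<Longrightarrow> (m has_vector_derivative p t *\<^sub>R dir (\<theta> t)) (at t)"
    "\<And>t. t \<in> {c..d} - S \<Longrightarrow> (\<theta> has_real_derivative \<omega> t) (at t)"
    "\<And>t. t \<in> {c..d} - S \<Longrightarrow> (w has_real_derivative \<omega> t - p t / l * w t) (at t)"
  using assms unfolding driven_def by blast+

lemma pc_continuous_on: "pc f \<Longrightarrow> continuous_on ({c..d} - S) f"
  by (simp add: piecewise_cont_def)

lemma driven_horizontal:
  assumes l: "l > 0" and dr: "driven l p \<omega> m \<theta> w"
  shows "horizontal_curve l l c d (\<lambda>t. linkage_of l (m t) (\<theta> t) (w t))"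
proof -
  note D = drivenD[OF dr]
  let ?u = "\<lambda>t. dir (\<theta> t)" and ?v = "\<lambda>t. second_dir (\<theta> t) (w t)"
  let ?x' = "\<lambda>t. p t *\<^sub>R ?u t - (l * \<omega> t) *\<^sub>R rot90 (?u t)"
  let ?k = "\<lambda>t. (p t * ((w t)\<^sup>2 - 1) - 2 * l * \<omega> t * w t) / ((w t)\<^sup>2 + 1)"
  have vel: "((\<lambda>t. m t - l *\<^sub>R ?u t) has_vector_derivative ?x' t) (at t)"
    "((\<lambda>t. m t - l *\<^sub>R ?u t + l *\<^sub>R ?v t) has_vector_derivative ?k t *\<^sub>R ?v t) (at t)"
    if "t \<in> {c..d} - S" for t
    using linkage_velocity[OF D(6-8)[OF that]] l by simp_all
  have cont: "continuous_on {c..d} (\<lambda>t. linkage_of l (m t) (\<theta> t) (w t))"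
    unfolding linkage_of_def second_dir_def by (intro continuous_intros D one_plus_square_neq_0 ballI)
  have "(\<lambda>t. linkage_of l (m t) (\<theta> t) (w t)) C1_differentiable_on {c..d} - S"
    unfolding C1_differentiable_on_def
  proof (intro exI conjI ballI)
    fix t assume t: "t \<in> {c..d} - S"
    show "((\<lambda>t. linkage_of l (m t) (\<theta> t) (w t)) has_vector_derivative
      (?x' t, p t *\<^sub>R ?u t, ?k t *\<^sub>R ?v t)) (at t)"
      unfolding linkage_of_def by (intro has_vector_derivative_Pair vel D(6) t)
  next
    have sub: "{c..d} - S \<subseteq> {c..d}" by auto
    note c' = D(3-5)[THEN continuous_on_subset, OF sub] D(1,2)[THEN pc_continuous_on]
    show "continuous_on ({c..d} - S) (\<lambda>t. (?x' t, p t *\<^sub>R ?u t, ?k t *\<^sub>R ?v t))"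
      unfolding second_dir_def by (intro continuous_intros c' one_plus_square_neq_0 ballI)
  qed
  moreover have "\<exists>k1 k2. (m has_vector_derivative k1 *\<^sub>R (l *\<^sub>R ?u t)) (at t) \<and>
      ((\<lambda>t. m t - l *\<^sub>R ?u t + l *\<^sub>R ?v t) has_vector_derivative k2 *\<^sub>R (l *\<^sub>R ?v t)) (at t)"
    if t: "t \<in> {c..d} - S" for t
    using D(6)[OF t] vel(2)[OF t] l
    by (intro exI[of _ "p t / l"] exI[of _ "?k t / l"]) simp
  ultimately show ?thesis
    using cont fin linkage_of_in_configuration_space[OF l]
    unfolding horizontal_curve_def piecewise_C1_differentiable_on_def
    by (auto intro!: exI[of _ S] simp del: scaleR_scaleR)
qed

text \<open>The speed \<open>v\<close> satisfies \<open>v \<le> (v\<^sup>2 + 1)/2\<close>, with equality at unit speed. Hence lowering the energy of a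
  curve of unit speed over a fixed interval lowers the length, while the energy is quadratic in the
  controls.\<close>

lemma driven_length_le_energy:
  assumes l: "l > 0" and dr: "driven l p \<omega> m \<theta> w"
  shows "curve_length c d (\<lambda>t. linkage_of l (m t) (\<theta> t) (w t))
    \<le> ennreal (integral {c..d} (\<lambda>t. ((p t)\<^sup>2 + l\<^sup>2 * (\<omega> t)\<^sup>2) / 2) + (d - c) / 2)"
proof -
  note D = drivenD[OF dr]
  let ?e = "\<lambda>t. ((p t)\<^sup>2 + l\<^sup>2 * (\<omega> t)\<^sup>2) / 2"
  have "pc (\<lambda>t. (1/2) * ((p t)\<^sup>2 + l\<^sup>2 * (\<omega> t)\<^sup>2))"
    by (intro pc_mult pc_const pc_add pc_power2 D)
  then have pce: "pc ?e" by simp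
  have "(?e has_integral integral {c..d} ?e) {c..d}"
    by (intro integrable_integral pc_integrable' pce)
  moreover have "((\<lambda>t. 1 / 2) has_integral (d - c) / 2) {c..d}"
    using has_integral_const_real[of "1/2 :: real" c d] less by simp
  ultimately have int: "((\<lambda>t. ?e t + 1 / 2) has_integral integral {c..d} ?e + (d - c) / 2) {c..d}"
    by (rule has_integral_add)
  have speed: "norm (vector_derivative (\<lambda>s. pt_x (linkage_of l (m s) (\<theta> s) (w s))) (at t)) \<le> ?e t + 1 / 2"
    if t: "t \<in> {c..d} - S" for t
  proof -
    let ?v = "p t *\<^sub>R dir (\<theta> t) - (l * \<omega> t) *\<^sub>R rot90 (dir (\<theta> t))"
    have "((\<lambda>s. pt_x (linkage_of l (m s) (\<theta> s) (w s))) has_vector_derivative ?v) (at t)"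
      using linkage_velocity(1)[OF D(6-8)[OF t]] l by simp
    then have "vector_derivative (\<lambda>s. pt_x (linkage_of l (m s) (\<theta> s) (w s))) (at t) = ?v"
      by (rule vector_derivative_at)
    moreover have "(norm ?v)\<^sup>2 = 2 * ?e t"
      by (simp add: power2_norm_eq_inner inner_diff_left inner_diff_right) (simp add: power2_eq_square)
    moreover have "2 * norm ?v \<le> (norm ?v)\<^sup>2 + 1"
      using zero_le_power2[of "norm ?v - 1"] by (simp add: power2_diff)
    ultimately show ?thesis by (simp only:)
  qed
  have "AE t in lborel. t \<notin> S"
    using fin by (intro AE_not_in finite_imp_null_set_lborel)
  then have "curve_length c d (\<lambda>t. linkage_of l (m t) (\<theta> t) (w t))
     \<le> (\<integral>\<^sup>+ t. ennreal (?e t + 1 / 2) * indicator {c..d} t \<partial>lborel)"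
    unfolding curve_length_def
  proof (intro nn_integral_mono_AE, eventually_elim)
    case (elim t)
    show ?case
    proof (cases "t \<in> {c..d}")
      case True
      with elim speed show ?thesis by (intro mult_right_mono ennreal_leI) auto
    qed simp
  qed
  also have "\<dots> = ennreal (integral {c..d} ?e + (d - c) / 2)"
    by (intro nn_integral_has_integral_lebesgue' int) (auto intro: add_nonneg_nonneg)
  finally show ?thesis .
qed

definition heading :: "real \<Rightarrow> (real \<Rightarrow> real) \<Rightarrow> real \<Rightarrow> real" where
  "heading \<theta>0 \<omega> t = \<theta>0 + integral {c..t} \<omega>"

text \<open>The linear equation for \<open>w\<close> solved by variation of constants.\<close>

definition slope :: "real \<Rightarrow> real \<Rightarrow> (real \<Rightarrow> real) \<Rightarrow> (real \<Rightarrow> real) \<Rightarrow> real \<Rightarrow> real" where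
  "slope l w0 p \<omega> t = exp (- (integral {c..t} p / l)) *
     (w0 + integral {c..t} (\<lambda>s. \<omega> s * exp (integral {c..s} p / l)))"

definition track :: "plane \<Rightarrow> real \<Rightarrow> (real \<Rightarrow> real) \<Rightarrow> (real \<Rightarrow> real) \<Rightarrow> real \<Rightarrow> plane" where
  "track m0 \<theta>0 p \<omega> t = m0 + integral {c..t} (\<lambda>s. p s *\<^sub>R dir (heading \<theta>0 \<omega> s))"

lemma antideriv_real:
  fixes f :: "real \<Rightarrow> real"
  shows "pc f \<Longrightarrow> t \<in> {c..d} - S \<Longrightarrow> ((\<lambda>u. integral {c..u} f) has_real_derivative f t) (at t)"
  unfolding has_real_derivative_iff_has_vector_derivative by (rule antideriv)

lemma driven_quadrature:
  assumes p: "pc p" and \<omega>: "pc \<omega>" and l: "l \<noteq> 0"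
  shows "driven l p \<omega> (track m0 \<theta>0 p \<omega>) (heading \<theta>0 \<omega>) (slope l w0 p \<omega>)"
proof -
  have ch: "continuous_on {c..d} (heading \<theta>0 \<omega>)"
    unfolding heading_def by (intro continuous_intros antideriv_continuous \<omega>)
  have cP: "continuous_on {c..d} (\<lambda>t. integral {c..t} p)"
    by (intro antideriv_continuous p)
  have pcm: "pc (\<lambda>s. p s *\<^sub>R dir (heading \<theta>0 \<omega> s))"
    by (intro pc_scaleR p pc_continuous continuous_intros ch)
  have pcW: "pc (\<lambda>s. \<omega> s * exp (integral {c..s} p / l))"
    by (intro pc_mult \<omega> pc_continuous continuous_intros cP) (use l in auto)
  have cm: "continuous_on {c..d} (track m0 \<theta>0 p \<omega>)"
    unfolding track_def by (intro continuous_intros antideriv_continuous pcm)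
  have cw: "continuous_on {c..d} (slope l w0 p \<omega>)"
    unfolding slope_def by (intro continuous_intros antideriv_continuous pcW p) (use l in auto)
  have dh: "(heading \<theta>0 \<omega> has_real_derivative \<omega> t) (at t)" if "t \<in> {c..d} - S" for t
    unfolding heading_def using antideriv_real[OF \<omega> that] by (auto intro!: derivative_eq_intros)
  have dm: "(track m0 \<theta>0 p \<omega> has_vector_derivative p t *\<^sub>R dir (heading \<theta>0 \<omega> t)) (at t)"
    if "t \<in> {c..d} - S" for t
    unfolding track_def using has_vector_derivative_add[OF has_vector_derivative_const antideriv[OF pcm that]]
    by simp
  have dw: "(slope l w0 p \<omega> has_real_derivative \<omega> t - p t / l * slope l w0 p \<omega> t) (at t)"
    if t: "t \<in> {c..d} - S" for t
    unfolding slope_def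
    by (rule DERIV_cong[OF DERIV_mult[OF DERIV_fun_exp[OF DERIV_minus[OF DERIV_cdivide[OF antideriv_real[OF p t]]]]
          DERIV_add[OF DERIV_const antideriv_real[OF pcW t]]]])
      (simp add: algebra_simps exp_minus)
  show ?thesis
    unfolding driven_def using p \<omega> ch cm cw dh dm dw by blast
qed

lemma driven_unique:
  assumes dr: "driven l p \<omega> m \<theta> w" and l: "l \<noteq> 0" and t: "t \<in> {c..d}"
  shows "\<theta> t = heading (\<theta> c) \<omega> t" "w t = slope l (w c) p \<omega> t" "m t = track (m c) (\<theta> c) p \<omega> t"
proof -
  note D = drivenD[OF dr]
  have th: "\<theta> t = heading (\<theta> c) \<omega> t" if "t \<in> {c..d}" for t
    unfolding heading_def
    using integral_unique[OF ftc[OF D(4) D(7)[unfolded has_real_derivative_iff_has_vector_derivative] that]]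
    by simp
  then show "\<theta> t = heading (\<theta> c) \<omega> t" using t .
  have cP: "continuous_on {c..d} (\<lambda>t. integral {c..t} p)"
    by (intro antideriv_continuous D)
  have "((\<lambda>s. \<omega> s * exp (integral {c..s} p / l)) has_integral
      w t * exp (integral {c..t} p / l) - w c * exp (integral {c..c} p / l)) {c..t}"
  proof (rule ftc[OF _ _ t])
    show "continuous_on {c..d} (\<lambda>t. w t * exp (integral {c..t} p / l))"
      by (intro continuous_intros D cP) (use l in auto)
    fix t assume t: "t \<in> {c..d} - S"
    show "((\<lambda>t. w t * exp (integral {c..t} p / l)) has_vector_derivative \<omega> t * exp (integral {c..t} p / l)) (at t)"
      unfolding has_real_derivative_iff_has_vector_derivative[symmetric]
      by (rule DERIV_cong[OF DERIV_mult[OF D(8)[OF t] DERIV_fun_exp[OF DERIV_cdivide[OF antideriv_real[OF D(1) t]]]]])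
        (simp add: algebra_simps)
  qed
  from integral_unique[OF this] show "w t = slope l (w c) p \<omega> t"
    unfolding slope_def by (simp add: exp_minus)
  have "((\<lambda>s. p s *\<^sub>R dir (\<theta> s)) has_integral m t - m c) {c..t}"
    by (rule ftc[OF D(3) D(6) t])
  moreover have "integral {c..t} (\<lambda>s. p s *\<^sub>R dir (\<theta> s)) = integral {c..t} (\<lambda>s. p s *\<^sub>R dir (heading (\<theta> c) \<omega> s))"
    by (rule integral_cong, rule arg_cong[OF th]) (use t in auto)
  ultimately show "m t = track (m c) (\<theta> c) p \<omega> t"
    unfolding track_def by (simp add: integral_unique diff_eq_eq add.commute)
qed

end

section \<open>First-order conditions for shortest curves\<close>

text \<open>A continuous map is open at a point where its derivative is onto. This form of the inverse function
  theorem rests on Brouwer's fixed point theorem.\<close>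

lemma interior_range_if_derivative_injective:
  fixes \<Phi> :: "'b::euclidean_space \<Rightarrow> 'b"
  assumes "continuous_on UNIV \<Phi>" and D: "(\<Phi> has_derivative D) (at 0)"
    and inj: "\<And>e. D e = 0 \<Longrightarrow> e = 0"
  shows "\<Phi> 0 \<in> interior (range \<Phi>)"
proof -
  have lin: "linear D" using D has_derivative_linear by blast
  then have "surj D"
    using inj by (simp add: linear_injective_0 linear_injective_imp_surjective)
  then obtain g where g: "linear g" "D \<circ> g = id"
    using linear_surjective_right_inverse[OF lin] by blast
  show ?thesis
    by (rule sussmann_open_mapping[OF open_UNIV assms(1) UNIV_I D _ g(2)])
      (use g(1) in \<open>auto simp: linear_conv_bounded_linear\<close>)
qed

context breakpoints
begin

lemma antideriv_inner:
  fixes F :: "real \<Rightarrow> 'b::euclidean_space"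
  assumes "pc F" "t \<in> {c..d}"
  shows "integral {c..t} (\<lambda>s. e \<bullet> F s) = e \<bullet> integral {c..t} F"
  using integral_linear[OF pc_integrable[OF assms(1), of c t] bounded_linear_inner_right[of e]] assms(2)
  by (simp add: o_def)

text \<open>The left-hand side is the derivative of the final value of \<open>w\<close>, written as \<open>slope\<close>, when the controls
  vary by \<open>f\<close> and \<open>g\<close>. Integration by parts removes the primitive \<open>z\<close> of \<open>f\<close> and thereby exhibits the
  gradient with respect to the controls.\<close>

lemma slope_variation:
  assumes dr: "driven l p \<omega> m \<theta> w" and l: "l \<noteq> 0" and f: "pc f" and g: "pc g"
  defines "P \<equiv> \<lambda>t. integral {c..t} p" and "z \<equiv> \<lambda>t. integral {c..t} f"
  shows "- (exp (- (P d / l)) * (z d / l)) * (w c + integral {c..d} (\<lambda>t. \<omega> t * exp (P t / l)))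
      + exp (- (P d / l)) * integral {c..d} (\<lambda>t. g t * exp (P t / l) + (\<omega> t * z t) * (exp (P t / l) / l))
    = integral {c..d} (\<lambda>t. exp ((P t - P d) / l) * g t - exp ((P t - P d) / l) * w t / l * f t)"
proof -
  note D = drivenD[OF dr]
  have cP: "continuous_on {c..d} P" and cz: "continuous_on {c..d} z"
    unfolding P_def z_def by (intro antideriv_continuous D f)+
  have dP: "(P has_real_derivative p t) (at t)" and dz: "(z has_real_derivative f t) (at t)"
    if "t \<in> {c..d} - S" for t
    unfolding P_def z_def using that by (auto intro!: antideriv_real D f)
  define E where "E = (\<lambda>t. exp ((P t - P d) / l))"
  have cE: "continuous_on {c..d} E"
    unfolding E_def
    by (intro continuous_on_exp continuous_on_divide continuous_on_diff cP continuous_on_const) (use l in simp)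
  have dE: "(E has_real_derivative E t * (p t / l)) (at t)" if "t \<in> {c..d} - S" for t
    unfolding E_def
    by (rule DERIV_cong[OF DERIV_fun_exp[OF DERIV_cdivide[OF DERIV_diff[OF dP[OF that] DERIV_const]]]]) simp
  have Eexp: "exp (- (P d / l)) * exp (P t / l) = E t" for t
    by (simp add: E_def mult_exp_exp diff_divide_distrib)
  have zc: "z c = 0" and Ed: "E d = 1" by (simp_all add: z_def E_def)
  have "((\<lambda>t. E t * \<omega> t * z t / l + E t * w t * f t / l) has_integral E d * w d * z d / l - E c * w c * z c / l) {c..d}"
  proof (rule ftc)
    show "continuous_on {c..d} (\<lambda>t. E t * w t * z t / l)"
      by (intro continuous_intros cE cz D) (use l in auto)
    fix t assume t: "t \<in> {c..d} - S"
    show "((\<lambda>t. E t * w t * z t / l) has_vector_derivative E t * \<omega> t * z t / l + E t * w t * f t / l) (at t)"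
      unfolding has_real_derivative_iff_has_vector_derivative[symmetric]
      by (rule DERIV_cong[OF DERIV_cdivide[OF DERIV_mult[OF DERIV_mult[OF dE[OF t] D(8)[OF t]] dz[OF t]]]])
        (simp add: add_divide_distrib[symmetric] algebra_simps)
  qed (use less in auto)
  then have parts: "((\<lambda>t. E t * \<omega> t * z t / l + E t * w t * f t / l) has_integral w d * z d / l) {c..d}"
    by (simp add: zc Ed)
  have "w d = slope l (w c) p \<omega> d"
    by (rule driven_unique(2)[OF dr l]) (use less in auto)
  then have wd: "exp (- (P d / l)) * (w c + integral {c..d} (\<lambda>t. \<omega> t * exp (P t / l))) = w d"
    by (simp add: slope_def P_def)
  have pcs: "pc (\<lambda>t. g t * exp (P t / l) + (\<omega> t * z t) * (exp (P t / l) / l))"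
    by (intro pc_add pc_mult g D pc_continuous cz continuous_intros cP) (use l in auto)
  have "((\<lambda>t. exp (- (P d / l)) * (g t * exp (P t / l) + (\<omega> t * z t) * (exp (P t / l) / l))) has_integral
     exp (- (P d / l)) * integral {c..d} (\<lambda>t. g t * exp (P t / l) + (\<omega> t * z t) * (exp (P t / l) / l))) {c..d}"
    by (intro has_integral_mult_right integrable_integral pc_integrable' pcs)
  also have "(\<lambda>t. exp (- (P d / l)) * (g t * exp (P t / l) + (\<omega> t * z t) * (exp (P t / l) / l)))
      = (\<lambda>t. E t * g t + E t * \<omega> t * z t / l)"
    by (simp add: Eexp[symmetric] algebra_simps)
  finally have "((\<lambda>t. E t * g t + E t * \<omega> t * z t / l - (E t * \<omega> t * z t / l + E t * w t * f t / l)) has_integral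
     exp (- (P d / l)) * integral {c..d} (\<lambda>t. g t * exp (P t / l) + (\<omega> t * z t) * (exp (P t / l) / l))
      - w d * z d / l) {c..d}"
    by (rule has_integral_diff[OF _ parts])
  then have "((\<lambda>t. E t * g t - E t * w t / l * f t) has_integral
     exp (- (P d / l)) * integral {c..d} (\<lambda>t. g t * exp (P t / l) + (\<omega> t * z t) * (exp (P t / l) / l))
      - w d * z d / l) {c..d}"
    by (simp add: algebra_simps)
  from integral_unique[OF this, unfolded E_def]
  have "integral {c..d} (\<lambda>t. exp ((P t - P d) / l) * g t - exp ((P t - P d) / l) * w t / l * f t)
    = exp (- (P d / l)) * integral {c..d} (\<lambda>t. g t * exp (P t / l) + (\<omega> t * z t) * (exp (P t / l) / l))
      - w d * z d / l" .
  moreover have "exp (- (P d / l)) * (z d / l) * (w c + integral {c..d} (\<lambda>t. \<omega> t * exp (P t / l))) = w d * z d / l"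
    unfolding wd[symmetric] by simp
  ultimately show ?thesis unfolding mult_minus_left by linarith
qed

text \<open>The corresponding gradient for the final position of \<open>m\<^sub>1\<close>. Integration by parts applies because the
  integral of \<open>p\<close> times the normal direction is a rotated displacement of \<open>m\<^sub>1\<close>.\<close>

lemma track_variation:
  assumes dr: "driven l p \<omega> m \<theta> w" and f: "pc f" and g: "pc g"
  shows "integral {c..d} (\<lambda>t. f t *\<^sub>R dir (\<theta> t) + (p t * integral {c..t} g) *\<^sub>R rot90 (dir (\<theta> t)))
    = integral {c..d} (\<lambda>t. f t *\<^sub>R dir (\<theta> t) + g t *\<^sub>R rot90 (m d - m t))"
proof -
  note D = drivenD[OF dr]
  let ?y = "\<lambda>t. integral {c..t} g"
  have cy: "continuous_on {c..d} ?y" by (intro antideriv_continuous g)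
  have "((\<lambda>t. g t *\<^sub>R rot90 (m d - m t) - (p t * ?y t) *\<^sub>R rot90 (dir (\<theta> t)))
     has_integral ?y d *\<^sub>R rot90 (m d - m d) - ?y c *\<^sub>R rot90 (m d - m c)) {c..d}"
  proof (rule ftc)
    show "continuous_on {c..d} (\<lambda>t. ?y t *\<^sub>R rot90 (m d - m t))"
      by (intro continuous_intros cy D)
    fix t assume t: "t \<in> {c..d} - S"
    show "((\<lambda>t. ?y t *\<^sub>R rot90 (m d - m t)) has_vector_derivative
       g t *\<^sub>R rot90 (m d - m t) - (p t * ?y t) *\<^sub>R rot90 (dir (\<theta> t))) (at t)"
      by (rule has_vector_derivative_eq_rhs[OF has_vector_derivative_scaleR[OF antideriv_real[OF g t]
          has_vector_derivative_rot90[OF has_vector_derivative_diff[OF has_vector_derivative_const D(6)[OF t]]]]])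
        (simp add: rot90_linear algebra_simps)
  qed (use less in auto)
  then have z: "((\<lambda>t. g t *\<^sub>R rot90 (m d - m t) - (p t * ?y t) *\<^sub>R rot90 (dir (\<theta> t))) has_integral 0) {c..d}"
    by (simp add: rot90_linear)
  have "pc (\<lambda>t. f t *\<^sub>R dir (\<theta> t) + (p t * ?y t) *\<^sub>R rot90 (dir (\<theta> t)))"
    by (intro pc_add pc_scaleR pc_mult f D pc_continuous cy continuous_intros)
  from has_integral_add[OF integrable_integral[OF pc_integrable'[OF this]] z]
  have "((\<lambda>t. f t *\<^sub>R dir (\<theta> t) + g t *\<^sub>R rot90 (m d - m t)) has_integral
     integral {c..d} (\<lambda>t. f t *\<^sub>R dir (\<theta> t) + (p t * ?y t) *\<^sub>R rot90 (dir (\<theta> t)))) {c..d}"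
    by (simp add: algebra_simps)
  then show ?thesis by (rule integral_unique[symmetric])
qed

text \<open>The numbers \<open>a\<close>, \<open>b\<close>, \<open>s\<close> and the vector \<open>v\<close> are the multipliers of energy, final heading, final slope
  and final position of \<open>m\<^sub>1\<close>. If \<open>F\<close> and \<open>G\<close> collect the gradients of these functionals with respect to
  \<open>p\<close> and \<open>\<omega>\<close>, then perturbing the controls by \<open>e \<bullet> F\<close> and \<open>e \<bullet> G\<close> gives a map of a five-dimensional
  space to itself whose derivative at \<open>0\<close> sends \<open>e\<close> to the integral of \<open>(e \<bullet> F) F + (e \<bullet> G) G\<close>. A
  surjective derivative would allow the energy to be lowered with the endpoint fixed. So the derivative
  kills some \<open>\<Lambda> \<noteq> 0\<close>, and pairing with \<open>\<Lambda>\<close> shows that \<open>(\<Lambda> \<bullet> F)\<^sup>2 + (\<Lambda> \<bullet> G)\<^sup>2\<close> has integral zero.\<close>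

lemma first_order_conditions:
  assumes l: "l > 0" and dr: "driven l p \<omega> m \<theta> w"
    and speed: "\<And>t. t \<in> {c..d} - S \<Longrightarrow> (p t)\<^sup>2 + l\<^sup>2 * (\<omega> t)\<^sup>2 = 1"
    and minimal: "\<And>\<delta>. horizontal_curve l l c d \<delta> \<Longrightarrow> \<delta> c = linkage_of l (m c) (\<theta> c) (w c) \<Longrightarrow>
      \<delta> d = linkage_of l (m d) (\<theta> d) (w d) \<Longrightarrow> ennreal (d - c) \<le> curve_length c d \<delta>"
  defines "P \<equiv> \<lambda>t. integral {c..t} p"
  shows "\<exists>a b s v. (a, b, s, v) \<noteq> 0 \<and> (\<forall>t\<in>{c..d} - S.
      a * p t - s * (exp ((P t - P d) / l) * w t / l) + v \<bullet> dir (\<theta> t) = 0 \<and>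
      a * (l\<^sup>2 * \<omega> t) + b + s * exp ((P t - P d) / l) + v \<bullet> rot90 (m d - m t) = 0)"
proof -
  note D = drivenD[OF dr]
  have l0: "l \<noteq> 0" using l by simp
  have cd: "d \<in> {c..d}" using less by simp
  define E where "E = (\<lambda>t. exp ((P t - P d) / l))"
  define F where "F = (\<lambda>t. (p t, 0 :: real, - (E t * w t / l), dir (\<theta> t)))"
  define G where "G = (\<lambda>t. (l\<^sup>2 * \<omega> t, 1 :: real, E t, rot90 (m d - m t)))"
  have cP: "continuous_on {c..d} P" unfolding P_def by (intro antideriv_continuous D)
  have cE: "continuous_on {c..d} E"
    unfolding E_def
    by (intro continuous_on_exp continuous_on_divide continuous_on_diff cP continuous_on_const) (use l in simp)
  have pF: "pc F"
    unfolding F_def by (intro pc_Pair pc_const D pc_continuous continuous_intros cE) (use l in auto)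
  have pG: "pc G"
    unfolding G_def by (intro pc_Pair pc_const pc_mult D pc_continuous continuous_intros cE)
  define Z where "Z = (\<lambda>t. integral {c..t} F)"
  define Y where "Y = (\<lambda>t. integral {c..t} G)"
  have pZ: "pc Z" and pY: "pc Y"
    unfolding Z_def Y_def by (intro pc_continuous antideriv_continuous pF pG)+
  have pP: "pc P" and p\<theta>: "pc \<theta>" by (intro pc_continuous cP D)+
  define pe where "pe = (\<lambda>e t. p t + e \<bullet> F t)"
  define we where "we = (\<lambda>e t. \<omega> t + e \<bullet> G t)"
  have ppe: "pc (pe e)" and pwe: "pc (we e)" for e
    unfolding pe_def we_def by (intro pc_add pc_inner_const D pF pG)+
  define \<Phi> where "\<Phi> = (\<lambda>e. (integral {c..d} (\<lambda>t. ((pe e t)\<^sup>2 + l\<^sup>2 * (we e t)\<^sup>2) / 2),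
     heading (\<theta> c) (we e) d, slope l (w c) (pe e) (we e) d, track (m c) (\<theta> c) (pe e) (we e) d))"

  \<comment> \<open>The primitives and the heading depend affinely on the parameter, so each component of the
    endpoint map is built from integrals of the form treated in \<open>param_integral_derivative\<close>.\<close>
  have Pe: "integral {c..t} (pe e) = P t + e \<bullet> Z t" if "t \<in> {c..d}" for t e
    unfolding pe_def P_def Z_def antideriv_inner[OF pF that, symmetric]
    by (rule integral_add) (use that in \<open>auto intro!: pc_integrable D pc_inner_const pF\<close>)
  have he: "heading (\<theta> c) (we e) t = \<theta> t + e \<bullet> Y t" if "t \<in> {c..d}" for t e
  proof -
    have "integral {c..t} (we e) = integral {c..t} \<omega> + e \<bullet> Y t"
      unfolding we_def Y_def antideriv_inner[OF pG that, symmetric]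
      by (rule integral_add) (use that in \<open>auto intro!: pc_integrable D pc_inner_const pG\<close>)
    then show ?thesis using driven_unique(1)[OF dr l0 that] by (simp add: heading_def)
  qed
  define Ip where "Ip = (\<lambda>e. integral {c..d} (\<lambda>t. (p t + e \<bullet> F t) *\<^sub>R (p t + e \<bullet> F t)))"
  define Iw where "Iw = (\<lambda>e. integral {c..d} (\<lambda>t. (\<omega> t + e \<bullet> G t) *\<^sub>R (\<omega> t + e \<bullet> G t)))"
  define Ih where "Ih = (\<lambda>e. integral {c..d} (\<lambda>t. (\<omega> t + e \<bullet> G t) *\<^sub>R (1 :: real)))"
  define Is where "Is = (\<lambda>e. integral {c..d} (\<lambda>t. (\<omega> t + e \<bullet> G t) *\<^sub>R exp ((P t + e \<bullet> Z t) / l)))"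
  define Im where "Im = (\<lambda>e. integral {c..d} (\<lambda>t. (p t + e \<bullet> F t) *\<^sub>R dir (\<theta> t + e \<bullet> Y t)))"
  have \<Phi>_eq: "\<Phi> = (\<lambda>e. ((1/2) * (Ip e + l\<^sup>2 * Iw e), \<theta> c + Ih e,
     exp (- ((P d + e \<bullet> Z d) / l)) * (w c + Is e), m c + Im e))"
  proof
    fix e
    have "integral {c..d} (\<lambda>t. ((pe e t)\<^sup>2 + l\<^sup>2 * (we e t)\<^sup>2) / 2) = (1/2) * (Ip e + l\<^sup>2 * Iw e)"
    proof -
      have i: "(\<lambda>t. (pe e t)\<^sup>2) integrable_on {c..d}" "(\<lambda>t. (we e t)\<^sup>2) integrable_on {c..d}"
        by (intro pc_integrable' pc_power2 ppe pwe)+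
      have "((\<lambda>t. (1/2) * ((pe e t)\<^sup>2 + l\<^sup>2 * (we e t)\<^sup>2)) has_integral
         (1/2) * (integral {c..d} (\<lambda>t. (pe e t)\<^sup>2) + l\<^sup>2 * integral {c..d} (\<lambda>t. (we e t)\<^sup>2))) {c..d}"
        by (intro has_integral_mult_right has_integral_add integrable_integral i)
      from integral_unique[OF this] show ?thesis
        by (simp add: Ip_def Iw_def pe_def we_def power2_eq_square)
    qed
    moreover have "heading (\<theta> c) (we e) d = \<theta> c + Ih e"
      by (simp add: heading_def Ih_def we_def)
    moreover have "integral {c..d} (\<lambda>s. we e s * exp (integral {c..s} (pe e) / l)) = Is e"
      unfolding Is_def by (rule integral_cong) (simp add: Pe we_def)
    moreover have "integral {c..d} (\<lambda>s. pe e s *\<^sub>R dir (heading (\<theta> c) (we e) s)) = Im e"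
      unfolding Im_def by (rule integral_cong) (simp add: he pe_def)
    ultimately show "\<Phi> e = ((1/2) * (Ip e + l\<^sup>2 * Iw e), \<theta> c + Ih e,
       exp (- ((P d + e \<bullet> Z d) / l)) * (w c + Is e), m c + Im e)"
      unfolding \<Phi>_def slope_def track_def using Pe[OF cd] by simp
  qed

  have dexp: "((\<lambda>x. exp (x / l)) has_vector_derivative exp (x / l) / l) (at x)"
    "((\<lambda>x. exp (x / l) / l) has_vector_derivative exp (x / l) / l / l) (at x)" for x
    unfolding has_real_derivative_iff_has_vector_derivative[symmetric]
    using l0 by (auto intro!: derivative_eq_intros)
  have cexp: "continuous_on UNIV (\<lambda>x. exp (x / l) / l / l)"
    by (intro continuous_intros) (use l in auto)
  have did: "((\<lambda>x. x) has_vector_derivative 1) (at x)" "((\<lambda>x. 1) has_vector_derivative (0::real)) (at x)" for x :: real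
    by (auto intro: derivative_intros)
  have ddir: "((\<lambda>x. rot90 (dir x)) has_vector_derivative - dir x) (at x)" for x
    using has_vector_derivative_rot90[OF has_vector_derivative_dir, of x] by simp
  have cdir: "continuous_on UNIV (\<lambda>x. - dir x)"
    by (intro continuous_intros)
  note par = param_integral_derivative
  note dIp = par[OF D(1) D(1) pF pF did continuous_on_const, folded Ip_def]
    and dIw = par[OF D(2) D(2) pG pG did continuous_on_const, folded Iw_def]
    and dIh = par[OF D(2) D(2) pG pG did(2) has_vector_derivative_const continuous_on_const, folded Ih_def]
    and dIs = par[OF D(2) pP pG pZ dexp cexp, folded Is_def]
    and dIm = par[OF D(1) p\<theta> pF pY has_vector_derivative_dir ddir cdir, folded Im_def]
  have cont: "continuous_on UNIV \<Phi>"
    unfolding \<Phi>_eq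
    by (intro continuous_intros continuous_at_imp_continuous_on ballI
        has_derivative_continuous[OF dIp] has_derivative_continuous[OF dIw] has_derivative_continuous[OF dIh]
        has_derivative_continuous[OF dIs] has_derivative_continuous[OF dIm]) (use l in auto)

  define Lp where "Lp = (\<lambda>e. integral {c..d} (\<lambda>t. (e \<bullet> F t) * p t + p t * (e \<bullet> F t)))"
  define Lw where "Lw = (\<lambda>e. integral {c..d} (\<lambda>t. (e \<bullet> G t) * \<omega> t + \<omega> t * (e \<bullet> G t)))"
  define Lh where "Lh = (\<lambda>e. integral {c..d} (\<lambda>t. e \<bullet> G t))"
  define Ls where "Ls = (\<lambda>e. - (exp (- (P d / l)) * (e \<bullet> Z d / l)) * (w c + integral {c..d} (\<lambda>t. \<omega> t * exp (P t / l)))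
      + exp (- (P d / l)) * integral {c..d} (\<lambda>t. (e \<bullet> G t) * exp (P t / l) + (\<omega> t * (e \<bullet> Z t)) * (exp (P t / l) / l)))"
  define Lm where "Lm = (\<lambda>e. integral {c..d} (\<lambda>t. (e \<bullet> F t) *\<^sub>R dir (\<theta> t) + (p t * (e \<bullet> Y t)) *\<^sub>R rot90 (dir (\<theta> t))))"
  have d1: "((\<lambda>e. (1/2) * (Ip e + l\<^sup>2 * Iw e)) has_derivative (\<lambda>e. (1/2) * (Lp e + l\<^sup>2 * Lw e))) (at 0)"
    using dIp[of 0] dIw[of 0] unfolding Lp_def Lw_def
    by (intro has_derivative_mult_right has_derivative_add) simp_all
  have d2: "((\<lambda>e. \<theta> c + Ih e) has_derivative Lh) (at 0)"
    using has_derivative_add[OF has_derivative_const dIh[of 0]] unfolding Lh_def by simp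
  have d3: "((\<lambda>e. exp (- ((P d + e \<bullet> Z d) / l)) * (w c + Is e)) has_derivative Ls) (at 0)"
  proof -
    have "((\<lambda>e. exp (- ((P d + e \<bullet> Z d) / l))) has_derivative (\<lambda>e. exp (- (P d / l)) * (- (e \<bullet> Z d / l)))) (at 0)"
      using l by (auto intro!: derivative_eq_intros)
    from has_derivative_mult[OF this has_derivative_add[OF has_derivative_const[of "w c"] dIs[of 0]]]
    show ?thesis
      by (rule has_derivative_eq_rhs) (simp add: Ls_def Is_def fun_eq_iff algebra_simps)
  qed
  have d4: "((\<lambda>e. m c + Im e) has_derivative Lm) (at 0)"
    using has_derivative_add[OF has_derivative_const dIm[of 0]] unfolding Lm_def by simp
  have der: "(\<Phi> has_derivative (\<lambda>e. ((1/2) * (Lp e + l\<^sup>2 * Lw e), Lh e, Ls e, Lm e))) (at 0)"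
    unfolding \<Phi>_eq by (intro has_derivative_Pair d1 d2 d3 d4)

  \<comment> \<open>Moving the first component of the value down by half the radius of a ball in the range lowers
    the energy and keeps the endpoint.\<close>
  have endpoint0: "\<Phi> 0 = ((d - c) / 2, \<theta> d, w d, m d)"
  proof -
    have "integral {c..d} (\<lambda>t. ((p t)\<^sup>2 + l\<^sup>2 * (\<omega> t)\<^sup>2) / 2) = integral {c..d} (\<lambda>t. 1 / 2)"
      by (rule integral_spike[OF negligible_finite[OF fin]]) (use speed in auto)
    then show ?thesis
      using driven_unique[OF dr l0 cd] less by (simp add: \<Phi>_def pe_def we_def)
  qed
  have "\<Phi> 0 \<notin> interior (range \<Phi>)"
  proof
    assume "\<Phi> 0 \<in> interior (range \<Phi>)"
    then obtain r where r: "r > 0" "ball (\<Phi> 0) r \<subseteq> range \<Phi>"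
      unfolding mem_interior by blast
    have "\<Phi> 0 - (r / 2, 0, 0, 0) \<in> ball (\<Phi> 0) r"
      using r(1) by (simp add: dist_norm norm_Pair)
    then obtain e where "\<Phi> e = \<Phi> 0 - (r / 2, 0, 0, 0)" using r(2) by (metis imageE subsetD)
    then have e: "integral {c..d} (\<lambda>t. ((pe e t)\<^sup>2 + l\<^sup>2 * (we e t)\<^sup>2) / 2) = (d - c) / 2 - r / 2"
      "heading (\<theta> c) (we e) d = \<theta> d" "slope l (w c) (pe e) (we e) d = w d"
      "track (m c) (\<theta> c) (pe e) (we e) d = m d"
      unfolding endpoint0 by (simp_all add: \<Phi>_def)
    have dre: "driven l (pe e) (we e) (track (m c) (\<theta> c) (pe e) (we e)) (heading (\<theta> c) (we e)) (slope l (w c) (pe e) (we e))"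
      by (rule driven_quadrature[OF ppe pwe l0])
    let ?\<delta> = "\<lambda>t. linkage_of l (track (m c) (\<theta> c) (pe e) (we e) t) (heading (\<theta> c) (we e) t) (slope l (w c) (pe e) (we e) t)"
    have "ennreal (d - c) \<le> curve_length c d ?\<delta>"
      by (rule minimal[OF driven_horizontal[OF l dre]])
        (simp add: track_def heading_def slope_def, simp only: e)
    also have "\<dots> \<le> ennreal ((d - c) / 2 - r / 2 + (d - c) / 2)"
      using driven_length_le_energy[OF l dre] unfolding e(1) .
    also have "\<dots> < ennreal (d - c)"
      using r(1) less by (intro ennreal_lessI) (auto simp: field_simps)
    finally show False by simp
  qed
  then obtain \<Lambda> where \<Lambda>: "\<Lambda> \<noteq> 0" "(1/2) * (Lp \<Lambda> + l\<^sup>2 * Lw \<Lambda>) = 0" "Lh \<Lambda> = 0" "Ls \<Lambda> = 0" "Lm \<Lambda> = 0"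
    using interior_range_if_derivative_injective[OF cont der] by (auto simp: zero_prod_def)
  obtain a b s v where abs: "\<Lambda> = (a, b, s, v)" by (metis prod.collapse)
  let ?f = "\<lambda>t. \<Lambda> \<bullet> F t" and ?g = "\<lambda>t. \<Lambda> \<bullet> G t"
  have pf: "pc ?f" and pg: "pc ?g" by (intro pc_inner_const pF pG)+
  have zZ: "\<Lambda> \<bullet> Z t = integral {c..t} ?f" and yY: "\<Lambda> \<bullet> Y t = integral {c..t} ?g" if "t \<in> {c..d}" for t
    unfolding Z_def Y_def using antideriv_inner[OF pF that] antideriv_inner[OF pG that] by simp_all

  \<comment> \<open>Each component of the derivative at \<open>\<Lambda>\<close> is the inner product of \<open>(?f, ?g)\<close> with a gradient. The
    combination of these four equations with coefficients \<open>\<Lambda>\<close> has the integrand \<open>?f\<^sup>2 + ?g\<^sup>2\<close>.\<close>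
  have h1: "((\<lambda>t. ?f t * p t + l\<^sup>2 * (?g t * \<omega> t)) has_integral 0) {c..d}"
  proof -
    have "((\<lambda>t. (1/2) * ((?f t * p t + p t * ?f t) + l\<^sup>2 * (?g t * \<omega> t + \<omega> t * ?g t))) has_integral (1/2) * (Lp \<Lambda> + l\<^sup>2 * Lw \<Lambda>)) {c..d}"
      unfolding Lp_def Lw_def
      by (intro has_integral_mult_right has_integral_add integrable_integral pc_integrable' pc_add pc_mult pf pg D)
    then show ?thesis unfolding \<Lambda>(2) by (simp add: algebra_simps)
  qed
  have h2: "(?g has_integral 0) {c..d}"
    using integrable_integral[OF pc_integrable'[OF pg]] \<Lambda>(3) by (simp add: Lh_def)
  have h3: "((\<lambda>t. E t * ?g t - E t * w t / l * ?f t) has_integral 0) {c..d}"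
  proof -
    have "integral {c..d} (\<lambda>t. ?g t * exp (P t / l) + (\<omega> t * (\<Lambda> \<bullet> Z t)) * (exp (P t / l) / l))
        = integral {c..d} (\<lambda>t. ?g t * exp (P t / l) + (\<omega> t * integral {c..t} ?f) * (exp (P t / l) / l))"
      by (rule integral_cong) (simp add: zZ)
    then have L: "Ls \<Lambda> = integral {c..d} (\<lambda>t. E t * ?g t - E t * w t / l * ?f t)"
      using slope_variation[OF dr l0 pf pg] unfolding Ls_def zZ[OF cd] E_def P_def by simp
    have "pc (\<lambda>t. E t * ?g t - E t * w t / l * ?f t)"
      by (intro pc_diff pc_mult pf pg pc_continuous continuous_intros cE D) (use l in auto)
    from integrable_integral[OF pc_integrable'[OF this]] show ?thesis
      unfolding L[symmetric] \<Lambda>(4) .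
  qed
  have h4: "((\<lambda>t. ?f t *\<^sub>R dir (\<theta> t) + ?g t *\<^sub>R rot90 (m d - m t)) has_integral 0) {c..d}"
  proof -
    have "Lm \<Lambda> = integral {c..d} (\<lambda>t. ?f t *\<^sub>R dir (\<theta> t) + (p t * integral {c..t} ?g) *\<^sub>R rot90 (dir (\<theta> t)))"
      unfolding Lm_def by (rule integral_cong) (simp add: yY)
    then have L: "Lm \<Lambda> = integral {c..d} (\<lambda>t. ?f t *\<^sub>R dir (\<theta> t) + ?g t *\<^sub>R rot90 (m d - m t))"
      unfolding track_variation[OF dr pf pg] .
    have "pc (\<lambda>t. ?f t *\<^sub>R dir (\<theta> t) + ?g t *\<^sub>R rot90 (m d - m t))"
      by (intro pc_add pc_scaleR pf pg pc_continuous continuous_intros D)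
    from integrable_integral[OF pc_integrable'[OF this]] show ?thesis
      unfolding L[symmetric] \<Lambda>(5) .
  qed
  have h4': "((\<lambda>t. v \<bullet> (?f t *\<^sub>R dir (\<theta> t) + ?g t *\<^sub>R rot90 (m d - m t))) has_integral 0) {c..d}"
    using has_integral_linear[OF h4 bounded_linear_inner_right[of v]] by (simp add: o_def)
  have fx: "?f t = a * p t - s * (E t * w t / l) + v \<bullet> dir (\<theta> t)" for t
    by (simp add: abs F_def)
  have gx: "?g t = a * (l\<^sup>2 * \<omega> t) + b + s * E t + v \<bullet> rot90 (m d - m t)" for t
    by (simp add: abs G_def)
  have "((\<lambda>t. a * (?f t * p t + l\<^sup>2 * (?g t * \<omega> t)) + b * ?g t + s * (E t * ?g t - E t * w t / l * ?f t)
       + v \<bullet> (?f t *\<^sub>R dir (\<theta> t) + ?g t *\<^sub>R rot90 (m d - m t))) has_integral a * 0 + b * 0 + s * 0 + 0) {c..d}"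
    by (intro has_integral_add has_integral_mult_right h1 h2 h3 h4')
  moreover have "a * (?f t * p t + l\<^sup>2 * (?g t * \<omega> t)) + b * ?g t + s * (E t * ?g t - E t * w t / l * ?f t)
       + v \<bullet> (?f t *\<^sub>R dir (\<theta> t) + ?g t *\<^sub>R rot90 (m d - m t)) = (?f t)\<^sup>2 + (?g t)\<^sup>2" for t
  proof -
    have "(?f t)\<^sup>2 = ?f t * (a * p t - s * (E t * w t / l) + v \<bullet> dir (\<theta> t))"
      unfolding fx[symmetric] by (rule power2_eq_square)
    moreover have "(?g t)\<^sup>2 = ?g t * (a * (l\<^sup>2 * \<omega> t) + b + s * E t + v \<bullet> rot90 (m d - m t))"
      unfolding gx[symmetric] by (rule power2_eq_square)
    ultimately show ?thesis by (simp add: inner_add_right algebra_simps)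
  qed
  ultimately have "((\<lambda>t. (?f t)\<^sup>2 + (?g t)\<^sup>2) has_integral 0) {c..d}" by simp
  then have int0: "integral {c..d} (\<lambda>t. (?f t)\<^sup>2 + (?g t)\<^sup>2) = 0" by (rule integral_unique)
  have pq: "pc (\<lambda>t. (?f t)\<^sup>2 + (?g t)\<^sup>2)" by (intro pc_add pc_power2 pf pg)
  have zero: "?f t = 0 \<and> ?g t = 0" if "t \<in> {c..d} - S" for t
  proof -
    have "(?f t)\<^sup>2 + (?g t)\<^sup>2 = 0"
      by (rule zero_if_integral_zero[OF pq _ int0 that]) simp
    then show ?thesis by (simp only: sum_power2_eq_zero_iff)
  qed
  have "(a, b, s, v) \<noteq> 0" using \<Lambda>(1) abs by simp
  moreover have "\<forall>t\<in>{c..d} - S.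
      a * p t - s * (exp ((P t - P d) / l) * w t / l) + v \<bullet> dir (\<theta> t) = 0 \<and>
      a * (l\<^sup>2 * \<omega> t) + b + s * exp ((P t - P d) / l) + v \<bullet> rot90 (m d - m t) = 0"
    using zero fx gx by (simp add: E_def)
  ultimately show ?thesis by blast
qed

end

section \<open>Elastic arcs from the first-order conditions\<close>

text \<open>With tangent angle \<open>\<phi>\<close> the last condition says \<open>\<phi>'' = \<mu> \<bullet> N\<close>, the equation of a pendulum: this is
  Kirchhoff's description of Euler's elastica. Straight segments are included with \<open>\<mu> = 0\<close>.\<close>

definition elastic_on :: "real set \<Rightarrow> (real \<Rightarrow> plane) \<Rightarrow> bool" where
  "elastic_on J x \<longleftrightarrow> (\<exists>T \<kappa> \<mu>. \<forall>t\<in>J. (x has_vector_derivative T t) (at t within J) \<and> norm (T t) = 1 \<and>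
     (T has_vector_derivative \<kappa> t *\<^sub>R rot90 (T t)) (at t within J) \<and>
     (\<kappa> has_real_derivative \<mu> \<bullet> rot90 (T t)) (at t within J))"

context breakpoints
begin

lemma real_derivative_extends:
  fixes f g :: "real \<Rightarrow> real"
  assumes "continuous_on {c..d} f" "continuous_on {c..d} g"
    "\<And>t. t \<in> {c..d} - S \<Longrightarrow> (f has_real_derivative g t) (at t)" "t \<in> {c..d}"
  shows "(f has_real_derivative g t) (at t within {c..d})"
  using derivative_extends[of f g t] assms unfolding has_real_derivative_iff_has_vector_derivative by blast

lemma derivative_zero_if_zero:
  fixes f :: "real \<Rightarrow> real"
  assumes t: "t \<in> {c..d} - S" and "(f has_real_derivative D) (at t)" and z: "\<And>t. t \<in> {c..d} \<Longrightarrow> f t = 0"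
  shows "D = 0"
proof -
  have "((\<lambda>_. 0) has_real_derivative D) (at t)"
    by (rule has_field_derivative_transform_within_open[OF assms(2) open_pieces t]) (use z in auto)
  then show ?thesis using DERIV_unique DERIV_const by metis
qed

text \<open>The energy multiplier is normalized to \<open>1\<close>. The multiplier \<open>v\<close> of the position, divided by \<open>l\<^sup>2\<close>,
  becomes the vector \<open>\<mu>\<close> of the elastica.\<close>

lemma elastic_if_normal:
  assumes l: "l > 0" and dr: "driven l p \<omega> m \<theta> w"
    and speed: "\<And>t. t \<in> {c..d} - S \<Longrightarrow> (p t)\<^sup>2 + l\<^sup>2 * (\<omega> t)\<^sup>2 = 1"
  defines "E \<equiv> \<lambda>t. exp ((integral {c..t} p - integral {c..d} p) / l)"
  assumes p_eq: "\<And>t. t \<in> {c..d} - S \<Longrightarrow> p t = s * (E t * w t / l) - v \<bullet> dir (\<theta> t)"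
    and \<omega>_eq: "\<And>t. t \<in> {c..d} - S \<Longrightarrow> l\<^sup>2 * \<omega> t = - (b + s * E t + v \<bullet> rot90 (m d - m t))"
  shows "elastic_on {c..d} (\<lambda>t. m t - l *\<^sub>R dir (\<theta> t))"
proof -
  note D = drivenD[OF dr]
  have cP: "continuous_on {c..d} (\<lambda>t. integral {c..t} p)" by (intro antideriv_continuous D)
  have cE: "continuous_on {c..d} E"
    unfolding E_def
    by (intro continuous_on_exp continuous_on_divide continuous_on_diff cP continuous_on_const) (use l in simp)
  \<comment> \<open>The functions \<open>q\<close> and \<open>\<Omega>\<close> are the continuous extensions of \<open>p\<close> and \<open>\<omega>\<close> that the hypotheses
    provide. Up to the factor \<open>l\<close>, the function \<open>h\<close> is the adjoint variable of \<open>w\<close>.\<close>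
  define h where "h = (\<lambda>t. s / l * E t)"
  define q where "q = (\<lambda>t. h t * w t - v \<bullet> dir (\<theta> t))"
  define \<Omega> where "\<Omega> = (\<lambda>t. - (b + l * h t + v \<bullet> rot90 (m d - m t)) / l\<^sup>2)"
  have ch: "continuous_on {c..d} h" unfolding h_def by (intro continuous_intros cE)
  have cq: "continuous_on {c..d} q" unfolding q_def by (intro continuous_intros ch D)
  have c\<Omega>: "continuous_on {c..d} \<Omega>" unfolding \<Omega>_def by (intro continuous_intros ch D) (use l in auto)
  have pq: "p t = q t" if "t \<in> {c..d} - S" for t
    using p_eq[OF that] by (simp add: q_def h_def)
  have \<omega>\<Omega>: "\<omega> t = \<Omega> t" if "t \<in> {c..d} - S" for t
    using \<omega>_eq[OF that] l by (simp add: \<Omega>_def h_def field_simps)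

  let ?A = "\<lambda>t. at t within {c..d}"
  have dm: "(m has_vector_derivative q t *\<^sub>R dir (\<theta> t)) (?A t)" if "t \<in> {c..d}" for t
    by (rule derivative_extends[OF D(3) _ _ that]) (use D(6) pq in \<open>auto intro!: continuous_intros cq D\<close>)
  have d\<theta>: "(\<theta> has_real_derivative \<Omega> t) (?A t)" if "t \<in> {c..d}" for t
    by (rule real_derivative_extends[OF D(4) c\<Omega> _ that]) (use D(7) \<omega>\<Omega> in auto)
  have dw: "(w has_real_derivative \<Omega> t - q t / l * w t) (?A t)" if "t \<in> {c..d}" for t
    by (rule real_derivative_extends[OF D(5) _ _ that])
      (use D(8) \<omega>\<Omega> pq l in \<open>auto intro!: continuous_intros cq c\<Omega> D\<close>)
  have dh: "(h has_real_derivative h t * q t / l) (?A t)" if "t \<in> {c..d}" for t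
  proof (rule real_derivative_extends[OF ch _ _ that])
    show "continuous_on {c..d} (\<lambda>t. h t * q t / l)" by (intro continuous_intros ch cq) (use l in auto)
    fix t assume t: "t \<in> {c..d} - S"
    show "(h has_real_derivative h t * q t / l) (at t)"
      unfolding h_def E_def
      by (rule DERIV_cong[OF DERIV_cmult[OF DERIV_fun_exp[OF DERIV_cdivide[OF DERIV_diff[OF antideriv_real[OF D(1) t] DERIV_const]]]]])
        (simp add: pq[OF t])
  qed

  let ?u = "\<lambda>t. dir (\<theta> t)" let ?n = "\<lambda>t. rot90 (dir (\<theta> t))"
  define T where "T = (\<lambda>t. q t *\<^sub>R ?u t - (l * \<Omega> t) *\<^sub>R ?n t)"
  define \<kappa> where "\<kappa> = (\<lambda>t. (l * \<Omega> t + h t - v \<bullet> ?n t) / l)"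
  have du: "((\<lambda>t. ?u t) has_vector_derivative \<Omega> t *\<^sub>R ?n t) (?A t)" if "t \<in> {c..d}" for t
    by (rule has_vector_derivative_dir_comp[OF d\<theta>[OF that]])
  have dn: "((\<lambda>t. ?n t) has_vector_derivative - (\<Omega> t *\<^sub>R ?u t)) (?A t)" if "t \<in> {c..d}" for t
    using has_vector_derivative_rot90[OF du[OF that]] by (simp add: rot90_linear)
  have dinner: "((\<lambda>t. v \<bullet> f t) has_real_derivative v \<bullet> f') F"
    if "(f has_vector_derivative f') F" for f :: "real \<Rightarrow> plane" and f' F
    using bounded_linear.has_vector_derivative[OF bounded_linear_inner_right[of v] that]
    by (simp add: has_real_derivative_iff_has_vector_derivative)
  have dq: "(q has_real_derivative \<Omega> t * (h t - v \<bullet> ?n t)) (?A t)" if t: "t \<in> {c..d}" for t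
    unfolding q_def
    by (rule DERIV_cong[OF DERIV_diff[OF DERIV_mult[OF dh[OF t] dw[OF t]] dinner[OF du[OF t]]]])
      (simp add: algebra_simps q_def)
  have d\<Omega>: "(\<Omega> has_real_derivative - (q t * (h t - v \<bullet> ?n t)) / l\<^sup>2) (?A t)" if t: "t \<in> {c..d}" for t
    unfolding \<Omega>_def
    by (rule DERIV_cong[OF DERIV_cdivide[OF DERIV_minus[OF DERIV_add[OF DERIV_add[OF DERIV_const DERIV_cmult[OF dh[OF t]]]
        dinner[OF has_vector_derivative_rot90[OF has_vector_derivative_diff[OF has_vector_derivative_const dm[OF t]]]]]]]])
      (use l in \<open>simp add: rot90_linear algebra_simps\<close>)
  have dx: "((\<lambda>t. m t - l *\<^sub>R ?u t) has_vector_derivative T t) (?A t)" if t: "t \<in> {c..d}" for t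
    unfolding T_def scaleR_scaleR[symmetric]
    by (intro has_vector_derivative_diff dm du t
        bounded_linear.has_vector_derivative[OF bounded_linear_scaleR_right])
  have dT: "(T has_vector_derivative \<kappa> t *\<^sub>R rot90 (T t)) (?A t)" if t: "t \<in> {c..d}" for t
  proof -
    define r where "r = h t - v \<bullet> ?n t"
    have \<kappa>: "\<kappa> t = (l * \<Omega> t + r) / l" by (simp add: \<kappa>_def r_def)
    have "(T has_vector_derivative
        (q t *\<^sub>R \<Omega> t *\<^sub>R ?n t + (\<Omega> t * r) *\<^sub>R ?u t)
        - ((l * \<Omega> t) *\<^sub>R - (\<Omega> t *\<^sub>R ?u t) + (l * (- (q t * r) / l\<^sup>2)) *\<^sub>R ?n t)) (?A t)"
      unfolding T_def r_def
      by (intro has_vector_derivative_diff has_vector_derivative_scaleR DERIV_cmult dq d\<Omega> du dn t)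
    moreover have "(q t *\<^sub>R \<Omega> t *\<^sub>R ?n t + (\<Omega> t * r) *\<^sub>R ?u t)
        - ((l * \<Omega> t) *\<^sub>R - (\<Omega> t *\<^sub>R ?u t) + (l * (- (q t * r) / l\<^sup>2)) *\<^sub>R ?n t)
      = (q t * \<Omega> t + q t * r / l) *\<^sub>R ?n t + (\<Omega> t * r + l * \<Omega> t * \<Omega> t) *\<^sub>R ?u t"
      using l by (simp add: algebra_simps power2_eq_square)
    moreover have "\<dots> = \<kappa> t *\<^sub>R rot90 (T t)"
    proof -
      have "q t * \<Omega> t + q t * r / l = \<kappa> t * q t" "\<Omega> t * r + l * \<Omega> t * \<Omega> t = \<kappa> t * (l * \<Omega> t)"
        unfolding \<kappa> using l by (simp_all add: field_simps)
      then show ?thesis by (simp add: T_def rot90_linear scaleR_add_right)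
    qed
    ultimately show ?thesis by simp
  qed
  have d\<kappa>: "(\<kappa> has_real_derivative ((1 / l\<^sup>2) *\<^sub>R v) \<bullet> rot90 (T t)) (?A t)" if t: "t \<in> {c..d}" for t
    unfolding \<kappa>_def
    by (rule DERIV_cong[OF DERIV_cdivide[OF DERIV_diff[OF DERIV_add[OF DERIV_cmult[OF d\<Omega>[OF t]] dh[OF t]] dinner[OF dn[OF t]]]]])
      (use l in \<open>simp add: T_def rot90_linear inner_add_right inner_diff_right field_simps power2_eq_square\<close>)
  have "norm (T t) = 1" if t: "t \<in> {c..d}" for t
  proof (rule eq_off_breakpoints[OF _ _ _ t])
    show "continuous_on {c..d} (\<lambda>t. norm (T t))"
      unfolding T_def by (intro continuous_intros cq c\<Omega> D)
    fix t assume t: "t \<in> {c..d} - S"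
    have "T t \<bullet> T t = (q t)\<^sup>2 + l\<^sup>2 * (\<Omega> t)\<^sup>2"
      unfolding T_def by (simp add: inner_diff_left inner_diff_right) (simp add: power2_eq_square)
    also have "\<dots> = 1" using speed[OF t] pq[OF t] \<omega>\<Omega>[OF t] by simp
    finally show "norm (T t) = 1" by (simp add: norm_eq_sqrt_inner)
  qed simp
  then show ?thesis
    unfolding elastic_on_def using dx dT d\<kappa> by blast
qed

lemma elastic_if_straight:
  assumes x: "continuous_on {c..d} x" and T: "norm (T :: plane) = 1"
    and der: "\<And>t. t \<in> {c..d} - S \<Longrightarrow> (x has_vector_derivative T) (at t)"
  shows "elastic_on {c..d} x"
  unfolding elastic_on_def
proof (intro exI[of _ "\<lambda>_. T"] exI[of _ "\<lambda>_. 0"] exI[of _ 0] ballI conjI)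
  show "(x has_vector_derivative T) (at t within {c..d})" if "t \<in> {c..d}" for t
    by (rule derivative_extends[OF x continuous_on_const der that])
qed (use T in simp_all)

text \<open>An injective continuous function is monotone, so its derivative cannot change sign.\<close>

lemma constant_velocity_if_injective:
  fixes f f' :: "real \<Rightarrow> real"
  assumes f: "continuous_on {c..d} f" and inj: "inj_on f {c..d}"
    and der: "\<And>t. t \<in> {c..d} - S \<Longrightarrow> (f has_real_derivative f' t) (at t)"
    and unit: "\<And>t. t \<in> {c..d} - S \<Longrightarrow> (f' t)\<^sup>2 = 1"
  obtains e where "e\<^sup>2 = 1" "\<And>t. t \<in> {c..d} - S \<Longrightarrow> f' t = e"
proof -
  have int: "t \<in> interior {c..d}" if "t \<in> {c..d} - S" for t
    using that cS dS by (auto simp: less_le)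
  have pm: "f' t = 1 \<or> f' t = -1" if "t \<in> {c..d} - S" for t
    using unit[OF that] by (simp add: power2_eq_1_iff)
  have "strict_mono_on {c..d} f \<or> strict_antimono_on {c..d} f"
    using injective_eq_monotone_map[OF is_interval_cc f] inj by blast
  then show thesis
  proof
    assume "strict_mono_on {c..d} f"
    then have "mono_on {c..d} f" by (rule strict_mono_on_imp_mono_on)
    then have "f' t \<ge> 0" if "t \<in> {c..d} - S" for t
      using mono_on_imp_deriv_nonneg[OF _ der[OF that] int[OF that]] by blast
    then show thesis using pm by (intro that[of 1]) force+
  next
    assume "strict_antimono_on {c..d} f"
    then have "mono_on {c..d} (\<lambda>t. - f t)"
      by (auto simp: monotone_on_def less_le)
    then have "- f' t \<ge> 0" if "t \<in> {c..d} - S" for t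
      using mono_on_imp_deriv_nonneg[OF _ DERIV_minus[OF der[OF that]] int[OF that]] by blast
    then show thesis using pm by (intro that[of "-1"]) force+
  qed
qed

text \<open>With \<open>h = s E / l\<close>, where \<open>E\<close> is the exponential factor, differentiating the two conditions gives
  \<open>v = h (w u + n)\<close> for the frame \<open>u\<close>, \<open>n = rot90 u\<close>, and \<open>h\<close> never vanishes. Differentiating once more shows that
  the velocity of \<open>x\<close> is parallel to \<open>v\<close>. Along this line \<open>arsinh w\<close> is an affine function of the position
  \<open>\<sigma>\<close> of \<open>x\<close>, so \<open>\<sigma>\<close> determines \<open>w\<close>, then \<open>h\<close>, then \<open>u\<close>, and hence the configuration. The only freedom
  left by the conditions is the sign of the velocity, and injectivity of the curve forbids changing it.\<close>

lemma elastic_if_abnormal: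
  assumes l: "l > 0" and dr: "driven l p \<omega> m \<theta> w"
    and speed: "\<And>t. t \<in> {c..d} - S \<Longrightarrow> (p t)\<^sup>2 + l\<^sup>2 * (\<omega> t)\<^sup>2 = 1"
    and inj: "inj_on (\<lambda>t. linkage_of l (m t) (\<theta> t) (w t)) {c..d}"
  defines "E \<equiv> \<lambda>t. exp ((integral {c..t} p - integral {c..d} p) / l)"
  assumes nonzero: "(b, s, v) \<noteq> 0"
    and c1: "\<And>t. t \<in> {c..d} - S \<Longrightarrow> s * (E t * w t / l) = v \<bullet> dir (\<theta> t)"
    and c2: "\<And>t. t \<in> {c..d} - S \<Longrightarrow> b + s * E t + v \<bullet> rot90 (m d - m t) = 0"
  shows "elastic_on {c..d} (\<lambda>t. m t - l *\<^sub>R dir (\<theta> t))"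
proof -
  note D = drivenD[OF dr]
  have cP: "continuous_on {c..d} (\<lambda>t. integral {c..t} p)" by (intro antideriv_continuous D)
  have cE: "continuous_on {c..d} E"
    unfolding E_def
    by (intro continuous_on_exp continuous_on_divide continuous_on_diff cP continuous_on_const) (use l in simp)
  define h where "h = (\<lambda>t. s / l * E t)"
  have ch: "continuous_on {c..d} h" unfolding h_def by (intro continuous_intros cE)
  have dh: "(h has_real_derivative h t * p t / l) (at t)" if t: "t \<in> {c..d} - S" for t
    unfolding h_def E_def
    by (rule DERIV_cong[OF DERIV_cmult[OF DERIV_fun_exp[OF DERIV_cdivide[OF DERIV_diff[OF antideriv_real[OF D(1) t] DERIV_const]]]]])
      simp
  let ?u = "\<lambda>t. dir (\<theta> t)" let ?n = "\<lambda>t. rot90 (dir (\<theta> t))"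
  have du: "((\<lambda>t. ?u t) has_vector_derivative \<omega> t *\<^sub>R ?n t) (at t)" if "t \<in> {c..d} - S" for t
    by (rule has_vector_derivative_dir_comp[OF D(7)[OF that]])
  have dn: "((\<lambda>t. ?n t) has_vector_derivative - (\<omega> t *\<^sub>R ?u t)) (at t)" if "t \<in> {c..d} - S" for t
    using has_vector_derivative_rot90[OF du[OF that]] by (simp add: rot90_linear)
  have dinner: "((\<lambda>t. a \<bullet> f t) has_real_derivative a \<bullet> f') F"
    if "(f has_vector_derivative f') F" for f :: "real \<Rightarrow> plane" and a f' F
    using bounded_linear.has_vector_derivative[OF bounded_linear_inner_right[of a] that]
    by (simp add: has_real_derivative_iff_has_vector_derivative)

  \<comment> \<open>The conditions hold everywhere, so they may be differentiated.\<close>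
  have hw: "h t * w t - v \<bullet> ?u t = 0" if "t \<in> {c..d}" for t
  proof (rule eq_off_breakpoints[OF _ continuous_on_const _ that])
    show "continuous_on {c..d} (\<lambda>t. h t * w t - v \<bullet> ?u t)" by (intro continuous_intros ch D)
    show "h t * w t - v \<bullet> ?u t = 0" if "t \<in> {c..d} - S" for t
      using c1[OF that] by (simp add: h_def mult.assoc)
  qed
  have hb: "b + l * h t + v \<bullet> rot90 (m d - m t) = 0" if "t \<in> {c..d}" for t
  proof (rule eq_off_breakpoints[OF _ continuous_on_const _ that])
    show "continuous_on {c..d} (\<lambda>t. b + l * h t + v \<bullet> rot90 (m d - m t))"
      by (intro continuous_intros ch D)
    show "b + l * h t + v \<bullet> rot90 (m d - m t) = 0" if "t \<in> {c..d} - S" for t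
      using c2[OF that] l by (simp add: h_def)
  qed
  have "\<omega> t * (h t - v \<bullet> ?n t) = 0" if t: "t \<in> {c..d} - S" for t
    by (rule derivative_zero_if_zero[OF t DERIV_cong[OF DERIV_diff[OF DERIV_mult[OF dh[OF t] D(8)[OF t]] dinner[OF du[OF t]]]] hw])
      (simp_all add: algebra_simps)
  moreover have "p t * (h t - v \<bullet> ?n t) = 0" if t: "t \<in> {c..d} - S" for t
    by (rule derivative_zero_if_zero[OF t DERIV_cong[OF DERIV_add[OF DERIV_add[OF DERIV_const DERIV_cmult[OF dh[OF t]]]
        dinner[OF has_vector_derivative_rot90[OF has_vector_derivative_diff[OF has_vector_derivative_const D(6)[OF t]]]]]] hb])
      (use l in \<open>simp_all add: rot90_linear algebra_simps\<close>)
  ultimately have hn': "h t = v \<bullet> ?n t" if t: "t \<in> {c..d} - S" for t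
    using speed[OF t] t by force
  have hn: "h t - v \<bullet> ?n t = 0" if "t \<in> {c..d}" for t
    by (rule eq_off_breakpoints[OF _ continuous_on_const _ that])
      (use hn' in \<open>simp_all add: continuous_on_diff ch continuous_on_inner continuous_on_rot90 continuous_on_dir D\<close>)
  have v_exp: "v = h t *\<^sub>R (w t *\<^sub>R ?u t + ?n t)" if "t \<in> {c..d}" for t
  proof -
    have "v = (v \<bullet> ?u t) *\<^sub>R ?u t + (v \<bullet> ?n t) *\<^sub>R ?n t" by (rule frame_expansion) simp
    then show ?thesis using hw[OF that] hn[OF that] by (simp add: algebra_simps)
  qed
  have cd: "c \<in> {c..d}" using less by simp
  have s0: "s \<noteq> 0"
  proof
    assume "s = 0"
    then have "h c = 0" by (simp add: h_def)
    then have "v = 0" using v_exp[OF cd] by simp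
    then show False using hb[OF cd] \<open>h c = 0\<close> \<open>s = 0\<close> nonzero by (simp add: zero_prod_def)
  qed
  have hsgn: "h t = sgn s * \<bar>h t\<bar>" "h t \<noteq> 0" for t
    using l s0 by (simp_all add: h_def E_def abs_mult sgn_mult_abs flip: mult.assoc)
  define V where "V = norm v"
  have V: "V = \<bar>h t\<bar> * sqrt ((w t)\<^sup>2 + 1)" if "t \<in> {c..d}" for t
  proof -
    have "norm (w t *\<^sub>R ?u t + ?n t) = sqrt ((w t)\<^sup>2 + 1)"
      by (simp add: norm_eq_sqrt_inner inner_add_left inner_add_right power2_eq_square)
    then show ?thesis unfolding V_def by (subst v_exp[OF that]) simp
  qed
  have Vpos: "V > 0" unfolding V[OF cd] using hsgn(2) by (simp add: add_nonneg_pos)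
  have pw: "p t = - (l * \<omega> t * w t)" if t: "t \<in> {c..d} - S" for t
  proof -
    have "h t * p t / l + \<omega> t * (v \<bullet> ?u t) = 0"
      by (rule derivative_zero_if_zero[OF t DERIV_cong[OF DERIV_diff[OF dh[OF t] dinner[OF dn[OF t]]]] hn])
        (simp_all add: algebra_simps)
    then have "h t * (p t + l * \<omega> t * w t) = 0"
      using hw[of t] t l by (simp add: field_simps)
    then show ?thesis using hsgn(2)[of t] by (simp add: add_eq_0_iff)
  qed

  \<comment> \<open>The point x runs on a line parallel to v.\<close>
  define x where "x = (\<lambda>t. m t - l *\<^sub>R ?u t)"
  have cx: "continuous_on {c..d} x" unfolding x_def by (intro continuous_intros D)
  have dx: "(x has_vector_derivative - (l * \<omega> t / h t) *\<^sub>R v) (at t)" if t: "t \<in> {c..d} - S" for t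
  proof -
    have "(x has_vector_derivative p t *\<^sub>R ?u t - (l * \<omega> t) *\<^sub>R ?n t) (at t)"
      unfolding x_def scaleR_scaleR[symmetric]
      by (intro has_vector_derivative_diff D(6) du t
          bounded_linear.has_vector_derivative[OF bounded_linear_scaleR_right])
    moreover have "p t *\<^sub>R ?u t - (l * \<omega> t) *\<^sub>R ?n t = - (l * \<omega> t / h t) *\<^sub>R v"
      by (subst v_exp[of t]) (use t pw[OF t] hsgn(2)[of t] in \<open>simp_all add: algebra_simps\<close>)
    ultimately show ?thesis by simp
  qed
  define \<sigma> where "\<sigma> = (\<lambda>t. v \<bullet> x t / V)"
  have vv: "v \<bullet> v = V\<^sup>2" by (simp add: V_def power2_norm_eq_inner)
  have c\<sigma>: "continuous_on {c..d} \<sigma>" unfolding \<sigma>_def by (intro continuous_intros cx) (use Vpos in auto)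
  have d\<sigma>: "(\<sigma> has_real_derivative - (l * \<omega> t * V / h t)) (at t)" if t: "t \<in> {c..d} - S" for t
    unfolding \<sigma>_def
    by (rule DERIV_cong[OF DERIV_cdivide[OF dinner[OF dx[OF t]]]]) (use Vpos in \<open>simp add: vv power2_eq_square\<close>)
  have unit: "(- (l * \<omega> t * V / h t))\<^sup>2 = 1" if t: "t \<in> {c..d} - S" for t
  proof -
    have "V\<^sup>2 = (h t)\<^sup>2 * ((w t)\<^sup>2 + 1)" using V[of t] t by (simp add: power_mult_distrib)
    then have "(- (l * \<omega> t * V / h t))\<^sup>2 = (l * \<omega> t * w t)\<^sup>2 + l\<^sup>2 * (\<omega> t)\<^sup>2"
      using hsgn(2)[of t] by (simp add: power_divide power_mult_distrib field_simps)
    then show ?thesis using speed[OF t] pw[OF t] by simp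
  qed
  have dw: "((\<lambda>t. arsinh (w t)) has_real_derivative \<omega> t * sqrt ((w t)\<^sup>2 + 1)) (at t)" if t: "t \<in> {c..d} - S" for t
  proof -
    have "\<omega> t - p t / l * w t = \<omega> t * ((w t)\<^sup>2 + 1)"
      unfolding pw[OF t] using l by (simp add: power2_eq_square algebra_simps)
    then have "(1 / sqrt ((w t)\<^sup>2 + 1)) * (\<omega> t - p t / l * w t) = \<omega> t * sqrt ((w t)\<^sup>2 + 1)"
      by (simp add: real_div_sqrt divide_simps)
    then show ?thesis using DERIV_chain2[OF arsinh_real_has_field_derivative D(8)[OF t]] by simp
  qed
  have w\<sigma>: "arsinh (w t) + sgn s / l * \<sigma> t = arsinh (w c) + sgn s / l * \<sigma> c" if "t \<in> {c..d}" for t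
  proof (rule const_if_derivative_zero[OF _ _ that])
    show "continuous_on {c..d} (\<lambda>t. arsinh (w t) + sgn s / l * \<sigma> t)"
      by (intro continuous_intros D c\<sigma>)
    fix t assume t: "t \<in> {c..d} - S"
    have "sgn s * (l * \<omega> t * V / h t) / l = \<omega> t * sqrt ((w t)\<^sup>2 + 1)"
    proof -
      have "sgn s * V = sgn s * \<bar>h t\<bar> * sqrt ((w t)\<^sup>2 + 1)" using V t by simp
      also have "\<dots> = h t * sqrt ((w t)\<^sup>2 + 1)" by (simp only: hsgn(1)[symmetric])
      finally have "\<omega> t * (sgn s * V) / h t = \<omega> t * sqrt ((w t)\<^sup>2 + 1)" using hsgn(2)[of t] by simp
      then show ?thesis using l by (simp add: mult_ac)
    qed
    then have "\<omega> t * sqrt ((w t)\<^sup>2 + 1) + sgn s / l * - (l * \<omega> t * V / h t) = 0" using l by simp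
    then show "((\<lambda>t. arsinh (w t) + sgn s / l * \<sigma> t) has_vector_derivative 0) (at t)"
      unfolding has_real_derivative_iff_has_vector_derivative[symmetric]
      by (rule DERIV_cong[OF DERIV_add[OF dw[OF t] DERIV_cmult[OF d\<sigma>[OF t]]]])
  qed
  have xperp: "rot90 v \<bullet> x t = rot90 v \<bullet> x c" if "t \<in> {c..d}" for t
  proof (rule const_if_derivative_zero[OF _ _ that])
    show "continuous_on {c..d} (\<lambda>t. rot90 v \<bullet> x t)" by (intro continuous_intros cx)
    fix t assume "t \<in> {c..d} - S"
    from dinner[OF dx[OF this], of "rot90 v"]
    show "((\<lambda>t. rot90 v \<bullet> x t) has_vector_derivative 0) (at t)"
      by (simp add: has_real_derivative_iff_has_vector_derivative)
  qed
  have "inj_on \<sigma> {c..d}"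
  proof (rule inj_onI)
    fix t1 t2 assume t: "t1 \<in> {c..d}" "t2 \<in> {c..d}" and eq: "\<sigma> t1 = \<sigma> t2"
    have "arsinh (w t1) = arsinh (w t2)" using w\<sigma>[OF t(1)] w\<sigma>[OF t(2)] eq by simp
    then have w: "w t1 = w t2" by (metis sinh_arsinh_real)
    have "\<bar>h t1\<bar> = \<bar>h t2\<bar>" using V[OF t(1)] V[OF t(2)] w by (simp add: add_nonneg_eq_0_iff)
    then have h: "h t1 = h t2" using hsgn(1) by metis
    have u_exp: "?u t = (1 / V\<^sup>2) *\<^sub>R ((h t * w t) *\<^sub>R v - h t *\<^sub>R rot90 v)" if "t \<in> {c..d}" for t
    proof -
      have V2: "V\<^sup>2 = (h t)\<^sup>2 * ((w t)\<^sup>2 + 1)" using V[OF that] by (simp add: power_mult_distrib)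
      have "(h t * w t) *\<^sub>R v - h t *\<^sub>R rot90 v = V\<^sup>2 *\<^sub>R ?u t"
        unfolding V2 by (subst (1 2) v_exp[OF that])
          (simp add: rot90_linear algebra_simps power2_eq_square)
      then show ?thesis using Vpos by simp
    qed
    have u: "?u t1 = ?u t2" unfolding u_exp[OF t(1)] u_exp[OF t(2)] by (simp add: w h)
    have "v \<bullet> x t1 = v \<bullet> x t2" using eq Vpos by (simp add: \<sigma>_def)
    moreover have "rot90 v \<bullet> x t1 = rot90 v \<bullet> x t2" using xperp t by metis
    ultimately have x: "x t1 = x t2"
    proof -
      assume a: "v \<bullet> x t1 = v \<bullet> x t2" and b: "rot90 v \<bullet> x t1 = rot90 v \<bullet> x t2"
      let ?e = "(1 / V) *\<^sub>R v"
      have e: "norm ?e = 1" using Vpos by (simp add: V_def)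
      show ?thesis
        using frame_expansion[OF e, of "x t1"] frame_expansion[OF e, of "x t2"] a b
        by (simp add: rot90_linear inner_commute)
    qed
    then have "linkage_of l (m t1) (\<theta> t1) (w t1) = linkage_of l (m t2) (\<theta> t2) (w t2)"
      using u w by (simp add: linkage_of_def second_dir_def x_def)
    then show "t1 = t2" using inj t by (simp add: inj_on_def)
  qed
  from constant_velocity_if_injective[OF c\<sigma> this d\<sigma> unit]
  obtain e where e: "e\<^sup>2 = 1" "\<And>t. t \<in> {c..d} - S \<Longrightarrow> - (l * \<omega> t * V / h t) = e" by blast
  have "elastic_on {c..d} x"
  proof (rule elastic_if_straight[OF cx, of "(e / V) *\<^sub>R v"])
    have "\<bar>e\<bar> = 1" using e(1) by (auto simp: power2_eq_1_iff)
    then show "norm ((e / V) *\<^sub>R v) = 1" using Vpos by (simp add: V_def)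
    fix t assume t: "t \<in> {c..d} - S"
    have "- (l * \<omega> t / h t) = e / V" using e(2)[OF t] Vpos by (simp add: field_simps)
    then show "(x has_vector_derivative (e / V) *\<^sub>R v) (at t)" using dx[OF t] by metis
  qed
  then show ?thesis by (simp add: x_def)
qed

end

section \<open>Coordinates along a given horizontal curve\<close>

context breakpoints
begin

text \<open>Both velocities are forced by the velocity of \<open>x\<close>, since the length of the segment is constant.\<close>

lemma arm_velocity:
  fixes m x :: "real \<Rightarrow> plane"
  assumes l: "l > 0" and len: "\<And>t. t \<in> {c..d} \<Longrightarrow> dist (x t) (m t) = l"
    and t: "t \<in> {c..d} - S"
    and x: "(x has_vector_derivative X) (at t)"
    and m: "(m has_vector_derivative k *\<^sub>R (m t - x t)) (at t)"
  defines "u \<equiv> \<lambda>t. (1 / l) *\<^sub>R (m t - x t)"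
  shows "(m has_vector_derivative (X \<bullet> u t) *\<^sub>R u t) (at t)"
    and "(u has_vector_derivative (- (X \<bullet> rot90 (u t)) / l) *\<^sub>R rot90 (u t)) (at t)"
proof -
  have unit: "norm (u t) = 1" if "t \<in> {c..d}" for t
    using len[OF that] l by (simp add: u_def dist_norm norm_minus_commute)
  have t': "t \<in> {c..d}" using t by simp
  have mx: "m t - x t = l *\<^sub>R u t" using l by (simp add: u_def)
  have m': "(m has_vector_derivative (k * l) *\<^sub>R u t) (at t)" using m unfolding mx by simp
  have u': "(u has_vector_derivative (1 / l) *\<^sub>R ((k * l) *\<^sub>R u t - X)) (at t)"
    using bounded_linear.has_vector_derivative[OF bounded_linear_scaleR_right has_vector_derivative_diff[OF m' x], of "1 / l"]
    unfolding u_def .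
  have "((\<lambda>t. u t \<bullet> u t - 1) has_real_derivative
     u t \<bullet> ((1 / l) *\<^sub>R ((k * l) *\<^sub>R u t - X)) + ((1 / l) *\<^sub>R ((k * l) *\<^sub>R u t - X)) \<bullet> u t - 0) (at t)"
    unfolding has_real_derivative_iff_has_vector_derivative
    by (intro has_vector_derivative_diff has_vector_derivative_const
        bounded_bilinear.has_vector_derivative[OF bounded_bilinear_inner] u')
  then have "u t \<bullet> ((1 / l) *\<^sub>R ((k * l) *\<^sub>R u t - X)) + ((1 / l) *\<^sub>R ((k * l) *\<^sub>R u t - X)) \<bullet> u t - 0 = 0"
    by (rule derivative_zero_if_zero[OF t]) (use unit in \<open>simp add: norm_eq_1\<close>)
  then have k: "k * l = X \<bullet> u t"
    using unit[OF t'] l by (simp add: inner_diff_left inner_diff_right inner_commute norm_eq_1)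
  show "(m has_vector_derivative (X \<bullet> u t) *\<^sub>R u t) (at t)" using m' unfolding k .
  have "(1 / l) *\<^sub>R ((X \<bullet> u t) *\<^sub>R u t - X) = (- (X \<bullet> rot90 (u t)) / l) *\<^sub>R rot90 (u t)"
    by (subst (2) frame_expansion[OF unit[OF t'], of X]) simp
  then show "(u has_vector_derivative (- (X \<bullet> rot90 (u t)) / l) *\<^sub>R rot90 (u t)) (at t)"
    using u' unfolding k by simp
qed

text \<open>The counterpart of \<open>linkage_velocity\<close>: two arms of equal length obeying the no-skid condition produce
  the linear equation for \<open>w\<close>.\<close>

lemma slope_derivative:
  fixes u v :: "real \<Rightarrow> plane"
  assumes l: "l \<noteq> 0" and unit: "norm (u t) = 1" "norm (v t) = 1" and ne: "1 - v t \<bullet> u t \<noteq> 0"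
    and u: "(u has_vector_derivative (- (X \<bullet> rot90 (u t)) / l) *\<^sub>R rot90 (u t)) (at t)"
    and v: "(v has_vector_derivative (- (X \<bullet> rot90 (v t)) / l) *\<^sub>R rot90 (v t)) (at t)"
  shows "((\<lambda>t. (v t \<bullet> rot90 (u t)) / (1 - v t \<bullet> u t)) has_real_derivative
     - (X \<bullet> rot90 (u t)) / l - X \<bullet> u t / l * ((v t \<bullet> rot90 (u t)) / (1 - v t \<bullet> u t))) (at t)"
proof -
  define C where "C = v t \<bullet> u t"
  define s where "s = v t \<bullet> rot90 (u t)"
  define a where "a = - (X \<bullet> rot90 (u t)) / l"
  define b where "b = - (X \<bullet> rot90 (v t)) / l"
  note inner' = bounded_bilinear.has_vector_derivative[OF bounded_bilinear_inner]
  have vt: "v t = C *\<^sub>R u t + s *\<^sub>R rot90 (u t)"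
    unfolding C_def s_def by (rule frame_expansion[OF unit(1)])
  have b: "b = a * C + (X \<bullet> u t) / l * s"
    unfolding b_def a_def by (subst vt) (use l in \<open>simp add: rot90_linear inner_add_right inner_diff_right field_simps\<close>)
  have cs: "s * s = (1 - C) * (1 + C)"
  proof -
    have "v t \<bullet> v t = C * C + s * s"
      by (subst (1 2) vt) (use unit(1) in \<open>simp add: inner_add_left inner_add_right norm_eq_1\<close>)
    then show ?thesis using unit(2) by (simp add: norm_eq_1 algebra_simps)
  qed
  have dC: "((\<lambda>t. v t \<bullet> u t) has_real_derivative v t \<bullet> (a *\<^sub>R rot90 (u t)) + (b *\<^sub>R rot90 (v t)) \<bullet> u t) (at t)"
    unfolding has_real_derivative_iff_has_vector_derivative a_def b_def by (intro inner' u v)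
  have ds: "((\<lambda>t. v t \<bullet> rot90 (u t)) has_real_derivative
      v t \<bullet> rot90 (a *\<^sub>R rot90 (u t)) + (b *\<^sub>R rot90 (v t)) \<bullet> rot90 (u t)) (at t)"
    unfolding has_real_derivative_iff_has_vector_derivative a_def b_def
    by (intro inner' has_vector_derivative_rot90 u v)
  have eC: "v t \<bullet> (a *\<^sub>R rot90 (u t)) + (b *\<^sub>R rot90 (v t)) \<bullet> u t = - (b - a) * s"
    by (simp add: inner_rot90_swap s_def algebra_simps)
  have es: "v t \<bullet> rot90 (a *\<^sub>R rot90 (u t)) + (b *\<^sub>R rot90 (v t)) \<bullet> rot90 (u t) = (b - a) * C"
    by (simp add: rot90_linear C_def algebra_simps)
  have ne': "1 - C \<noteq> 0" using ne by (simp add: C_def)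
  have "((\<lambda>t. (v t \<bullet> rot90 (u t)) / (1 - v t \<bullet> u t)) has_real_derivative
     ((b - a) * C * (1 - C) - s * (0 - - (b - a) * s)) / ((1 - C) * (1 - C))) (at t)"
    using DERIV_divide[OF ds[unfolded es] DERIV_diff[OF DERIV_const[of 1] dC[unfolded eC]] ne]
    unfolding C_def[symmetric] s_def[symmetric] .
  moreover have "((b - a) * C * (1 - C) - s * (0 - - (b - a) * s)) / ((1 - C) * (1 - C)) = a - X \<bullet> u t / l * (s / (1 - C))"
  proof -
    have "(b - a) * C * (1 - C) - s * (0 - - (b - a) * s) = (b - a) * (C * (1 - C) - s * s)"
      by (simp add: algebra_simps)
    also have "\<dots> = - (b - a) * (1 - C)" unfolding cs by (simp add: algebra_simps)
    finally have "((b - a) * C * (1 - C) - s * (0 - - (b - a) * s)) / ((1 - C) * (1 - C)) = - (b - a) / (1 - C)"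
      using ne' by simp
    also have "- (b - a) / (1 - C) = a - X \<bullet> u t / l * (s / (1 - C))"
      using ne' l by (simp add: b field_simps)
    finally show ?thesis .
  qed
  ultimately show ?thesis unfolding a_def C_def s_def by simp
qed

text \<open>A continuous angle along \<open>u\<close> is obtained by integrating the angular velocity. It represents \<open>u\<close> because
  the inner product of two unit vectors turning at the same rate is constant.\<close>

lemma heading_reconstruct:
  fixes u :: "real \<Rightarrow> plane"
  assumes u: "continuous_on {c..d} u" and unit: "\<And>t. t \<in> {c..d} \<Longrightarrow> norm (u t) = 1" and \<omega>: "pc \<omega>"
    and du: "\<And>t. t \<in> {c..d} - S \<Longrightarrow> (u has_vector_derivative \<omega> t *\<^sub>R rot90 (u t)) (at t)"
  obtains \<theta>0 where "\<And>t. t \<in> {c..d} \<Longrightarrow> u t = dir (heading \<theta>0 \<omega> t)"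
proof -
  have "norm (u c) = 1" using unit less by simp
  then obtain \<theta>0 where \<theta>0: "u c = dir \<theta>0" by (rule unit_vector_eq_dir)
  let ?v = "\<lambda>t. dir (heading \<theta>0 \<omega> t)"
  have ch: "continuous_on {c..d} (heading \<theta>0 \<omega>)"
    unfolding heading_def by (intro continuous_intros antideriv_continuous \<omega>)
  have dh: "(heading \<theta>0 \<omega> has_real_derivative \<omega> t) (at t)" if "t \<in> {c..d} - S" for t
    unfolding heading_def using DERIV_add[OF DERIV_const antideriv_real[OF \<omega> that]] by simp
  have "u t = ?v t" if t: "t \<in> {c..d}" for t
  proof -
    have "u t \<bullet> ?v t = u c \<bullet> ?v c"
    proof (rule const_if_derivative_zero[OF _ _ t])
      show "continuous_on {c..d} (\<lambda>t. u t \<bullet> ?v t)" by (intro continuous_intros u ch)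
      fix t assume t: "t \<in> {c..d} - S"
      have "((\<lambda>t. u t \<bullet> ?v t) has_vector_derivative
          u t \<bullet> (\<omega> t *\<^sub>R rot90 (?v t)) + (\<omega> t *\<^sub>R rot90 (u t)) \<bullet> ?v t) (at t)"
        by (intro bounded_bilinear.has_vector_derivative[OF bounded_bilinear_inner] du[OF t]
            has_vector_derivative_dir_comp dh[OF t])
      then show "((\<lambda>t. u t \<bullet> ?v t) has_vector_derivative 0) (at t)" by (simp add: inner_rot90_swap)
    qed
    also have "u c \<bullet> ?v c = 1" by (simp add: \<theta>0 heading_def)
    finally have "(u t - ?v t) \<bullet> (u t - ?v t) = 0"
      using unit[OF t] by (simp add: inner_diff_left inner_diff_right inner_commute norm_eq_1)
    then show ?thesis by simp
  qed
  then show thesis by (rule that)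
qed

end

text \<open>The length condition is an equality of integrals over all subintervals, which can be differentiated
  where the velocity is continuous.\<close>

lemma unit_speed_if_length_eq:
  fixes X :: "real \<Rightarrow> plane"
  assumes U: "open U" and t: "t \<in> U" and X: "continuous_on U X"
    and der: "\<And>t. t \<in> U \<Longrightarrow> ((\<lambda>s. pt_x (\<gamma> s)) has_vector_derivative X t) (at t)"
    and len: "\<And>a b. a \<le> b \<Longrightarrow> {a..b} \<subseteq> U \<Longrightarrow> curve_length a b \<gamma> = ennreal (b - a)"
  shows "norm (X t) = 1"
proof -
  obtain r where r: "r > 0" "cball t r \<subseteq> U" using U t open_contains_cball by blast
  define a where "a = t - r" define b where "b = t + r"
  have ab: "{a..b} \<subseteq> U" using r(2) by (simp add: a_def b_def cball_eq_atLeastAtMost)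
  have tab: "t \<in> {a..b}" "a < b" using r(1) by (simp_all add: a_def b_def)
  have cont: "continuous_on {a..b} (\<lambda>t. norm (X t))"
    using X ab continuous_on_subset by (intro continuous_on_norm) blast
  have int: "integral {a..s} (\<lambda>t. norm (X t)) = s - a" if s: "s \<in> {a..b}" for s
  proof -
    have sub: "{a..s} \<subseteq> {a..b}" using s by auto
    have "curve_length a s \<gamma> = (\<integral>\<^sup>+ t. ennreal (norm (X t)) * indicator {a..s} t \<partial>lborel)"
      unfolding curve_length_def
    proof (rule nn_integral_cong)
      fix t
      have "vector_derivative (\<lambda>s. pt_x (\<gamma> s)) (at t) = X t" if "t \<in> {a..s}"
        using that sub ab by (intro vector_derivative_at der) blast
      then show "ennreal (norm (vector_derivative (\<lambda>s. pt_x (\<gamma> s)) (at t))) * indicator {a..s} t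
          = ennreal (norm (X t)) * indicator {a..s} t"
        by (cases "t \<in> {a..s}") simp_all
    qed
    also have "\<dots> = ennreal (integral {a..s} (\<lambda>t. norm (X t)))"
      by (intro nn_integral_has_integral_lebesgue' integrable_integral integrable_continuous_real
          continuous_on_subset[OF cont sub]) auto
    finally have "ennreal (s - a) = ennreal (integral {a..s} (\<lambda>t. norm (X t)))"
      using len[of a s] s subset_trans[OF sub ab] by simp
    moreover have "integral {a..s} (\<lambda>t. norm (X t)) \<ge> 0"
      by (intro integral_nonneg integrable_continuous_real continuous_on_subset[OF cont sub]) auto
    ultimately show ?thesis using s by simp
  qed
  have "((\<lambda>s. integral {a..s} (\<lambda>t. norm (X t))) has_vector_derivative norm (X t)) (at t within {a..b})"
    by (rule integral_has_vector_derivative[OF cont tab(1)])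
  moreover have "((\<lambda>s. integral {a..s} (\<lambda>t. norm (X t))) has_vector_derivative 1) (at t within {a..b})"
  proof (rule has_vector_derivative_transform[OF tab(1)])
    show "((\<lambda>s. s - a) has_vector_derivative 1) (at t within {a..b})"
      by (rule has_vector_derivative_eq_rhs[OF has_vector_derivative_diff[OF has_vector_derivative_id has_vector_derivative_const]]) simp
  qed (rule int)
  ultimately show ?thesis
    using tab by (intro vector_derivative_unique_within[of t "{a..b}"])
      (auto simp: trivial_limit_within)
qed


context breakpoints
begin

lemma driven_reconstruct:
  assumes l: "l > 0" and cont: "continuous_on {c..d} \<gamma>"
    and conf: "\<And>t. t \<in> {c..d} \<Longrightarrow> \<gamma> t \<in> configuration_space l l"
    and X: "continuous_on ({c..d} - S) X"
    and dx: "\<And>t. t \<in> {c..d} - S \<Longrightarrow> ((\<lambda>s. pt_x (\<gamma> s)) has_vector_derivative X t) (at t)"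
    and speed: "\<And>t. t \<in> {c..d} - S \<Longrightarrow> norm (X t) = 1"
    and hor: "\<And>t. t \<in> {c..d} - S \<Longrightarrow> \<exists>k1 k2.
        ((\<lambda>s. pt_m1 (\<gamma> s)) has_vector_derivative k1 *\<^sub>R (pt_m1 (\<gamma> t) - pt_x (\<gamma> t))) (at t) \<and>
        ((\<lambda>s. pt_m2 (\<gamma> s)) has_vector_derivative k2 *\<^sub>R (pt_m2 (\<gamma> t) - pt_x (\<gamma> t))) (at t)"
  shows "\<exists>p \<omega> m \<theta> w. driven l p \<omega> m \<theta> w \<and>
    (\<forall>t\<in>{c..d}. \<gamma> t = linkage_of l (m t) (\<theta> t) (w t)) \<and>
    (\<forall>t\<in>{c..d} - S. (p t)\<^sup>2 + l\<^sup>2 * (\<omega> t)\<^sup>2 = 1)"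
proof -
  let ?x = "\<lambda>t. pt_x (\<gamma> t)" and ?m1 = "\<lambda>t. pt_m1 (\<gamma> t)" and ?m2 = "\<lambda>t. pt_m2 (\<gamma> t)"
  have cx: "continuous_on {c..d} ?x" and cm1: "continuous_on {c..d} ?m1" and cm2: "continuous_on {c..d} ?m2"
    unfolding pt_x_def pt_m1_def pt_m2_def by (intro continuous_intros cont)+
  have len: "dist (?x t) (?m1 t) = l" "dist (?x t) (?m2 t) = l" and m12: "?m1 t \<noteq> ?m2 t"
    if "t \<in> {c..d}" for t
    using conf[OF that] by (simp_all add: configuration_space_def)
  define u where "u = (\<lambda>t. (1 / l) *\<^sub>R (?m1 t - ?x t))"
  define v where "v = (\<lambda>t. (1 / l) *\<^sub>R (?m2 t - ?x t))"
  have cu: "continuous_on {c..d} u" and cv: "continuous_on {c..d} v"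
    unfolding u_def v_def by (intro continuous_intros cx cm1 cm2)+
  have unit: "norm (u t) = 1" "norm (v t) = 1" and uv: "v t \<noteq> u t" if "t \<in> {c..d}" for t
    using len[OF that] m12[OF that] l by (simp_all add: u_def v_def dist_norm norm_minus_commute)
  have arms: "(?m1 has_vector_derivative (X t \<bullet> u t) *\<^sub>R u t) (at t)"
    "(u has_vector_derivative (- (X t \<bullet> rot90 (u t)) / l) *\<^sub>R rot90 (u t)) (at t)"
    "(v has_vector_derivative (- (X t \<bullet> rot90 (v t)) / l) *\<^sub>R rot90 (v t)) (at t)" if t: "t \<in> {c..d} - S" for t
    using hor[OF t] arm_velocity[OF l len(1) t dx[OF t]] arm_velocity(2)[OF l len(2) t dx[OF t]]
    unfolding u_def v_def by blast+
  define p where "p = (\<lambda>t. if t \<in> S then 0 else X t \<bullet> u t)"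
  define \<omega> where "\<omega> = (\<lambda>t. if t \<in> S then 0 else - (X t \<bullet> rot90 (u t)) / l)"
  have sub: "{c..d} - S \<subseteq> {c..d}" by auto
  have pcp: "pc p"
    unfolding piecewise_cont_def
  proof
    have "norm (p t) \<le> 1" if "t \<in> {c..d}" for t
      using that speed[of t] unit(1)[of t] Cauchy_Schwarz_ineq2[of "X t" "u t"] by (cases "t \<in> S") (simp_all add: p_def)
    then show "bounded (p ` {c..d})" unfolding bounded_iff by blast
    have "continuous_on ({c..d} - S) (\<lambda>t. X t \<bullet> u t)"
      by (intro continuous_intros X continuous_on_subset[OF cu sub])
    then show "continuous_on ({c..d} - S) p"
      by (rule continuous_on_eq) (simp add: p_def)
  qed
  have pc\<omega>: "pc \<omega>"
    unfolding piecewise_cont_def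
  proof
    have "norm (\<omega> t) \<le> 1 / l" if "t \<in> {c..d}" for t
      using that l speed[of t] unit(1)[of t] Cauchy_Schwarz_ineq2[of "X t" "rot90 (u t)"]
      by (cases "t \<in> S") (simp_all add: \<omega>_def divide_right_mono)
    then show "bounded (\<omega> ` {c..d})" unfolding bounded_iff by blast
    have "continuous_on ({c..d} - S) (\<lambda>t. - (X t \<bullet> rot90 (u t)) / l)"
      by (intro continuous_intros X continuous_on_subset[OF cu sub]) (use l in auto)
    then show "continuous_on ({c..d} - S) \<omega>"
      by (rule continuous_on_eq) (simp add: \<omega>_def)
  qed
  have du: "(u has_vector_derivative \<omega> t *\<^sub>R rot90 (u t)) (at t)" if "t \<in> {c..d} - S" for t
    using arms(2)[OF that] that by (simp add: \<omega>_def)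
  obtain \<theta>0 where th: "\<And>t. t \<in> {c..d} \<Longrightarrow> u t = dir (heading \<theta>0 \<omega> t)"
    using heading_reconstruct[OF cu unit(1) pc\<omega> du] by blast
  define w where "w = (\<lambda>t. (v t \<bullet> rot90 (u t)) / (1 - v t \<bullet> u t))"
  have ne: "1 - v t \<bullet> u t \<noteq> 0" and vw: "v t = second_dir (heading \<theta>0 \<omega> t) (w t)" if t: "t \<in> {c..d}" for t
    using second_dir_reconstruct[of "v t" "heading \<theta>0 \<omega> t"] unit(2)[OF t] uv[OF t] th[OF t]
    by (simp_all add: w_def)
  have "driven l p \<omega> ?m1 (heading \<theta>0 \<omega>) w"
    unfolding driven_def
  proof (intro conjI ballI)
    show "continuous_on {c..d} (heading \<theta>0 \<omega>)"
      unfolding heading_def by (intro continuous_intros antideriv_continuous pc\<omega>)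
    show "continuous_on {c..d} w"
      unfolding w_def by (intro continuous_intros cu cv) (use ne in auto)
    fix t assume t: "t \<in> {c..d} - S"
    then have t': "t \<in> {c..d}" by simp
    show "(?m1 has_vector_derivative p t *\<^sub>R dir (heading \<theta>0 \<omega> t)) (at t)"
      using arms(1)[OF t] t th[OF t'] by (simp add: p_def)
    show "(heading \<theta>0 \<omega> has_real_derivative \<omega> t) (at t)"
      unfolding heading_def using DERIV_add[OF DERIV_const antideriv_real[OF pc\<omega> t]] by simp
    show "(w has_real_derivative \<omega> t - p t / l * w t) (at t)"
      using slope_derivative[OF _ unit[OF t'] ne[OF t'] arms(2,3)[OF t]] l t
      unfolding w_def p_def \<omega>_def by simp
  qed (use pcp pc\<omega> cm1 in auto)
  moreover have "\<gamma> t = linkage_of l (?m1 t) (heading \<theta>0 \<omega> t) (w t)" if t: "t \<in> {c..d}" for t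
  proof -
    have "l *\<^sub>R dir (heading \<theta>0 \<omega> t) = ?m1 t - ?x t" "l *\<^sub>R second_dir (heading \<theta>0 \<omega> t) (w t) = ?m2 t - ?x t"
      using th[OF t] vw[OF t] l by (simp_all add: u_def v_def flip: th[OF t] vw[OF t])
    then show ?thesis by (simp add: linkage_of_def pt_x_def pt_m1_def pt_m2_def)
  qed
  moreover have "(p t)\<^sup>2 + l\<^sup>2 * (\<omega> t)\<^sup>2 = 1" if t: "t \<in> {c..d} - S" for t
  proof -
    have "X t = (X t \<bullet> u t) *\<^sub>R u t + (X t \<bullet> rot90 (u t)) *\<^sub>R rot90 (u t)"
      using t unit(1) by (intro frame_expansion) auto
    then have "X t \<bullet> X t = (X t \<bullet> u t) * (X t \<bullet> u t) + (X t \<bullet> rot90 (u t)) * (X t \<bullet> rot90 (u t))"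
      by (metis inner_add_right inner_scaleR_right)
    then have "1 = (X t \<bullet> u t)\<^sup>2 + (X t \<bullet> rot90 (u t))\<^sup>2"
      using speed[OF t] by (simp add: norm_eq_1 power2_eq_square)
    then show ?thesis using t l by (simp add: p_def \<omega>_def power_divide)
  qed
  ultimately show ?thesis by blast
qed

end

lemma constant_horizontal:
  assumes "p \<in> configuration_space l l"
  shows "horizontal_curve l l 0 0 (\<lambda>_. p)" "curve_length 0 0 (\<lambda>_. p) = 0"
proof -
  show "horizontal_curve l l 0 0 (\<lambda>_. p)"
    unfolding horizontal_curve_def
    using assms by (auto intro!: C1_differentiable_imp_piecewise exI[of _ "{}"] exI[of _ 0])
  show "curve_length 0 0 (\<lambda>_. p) = 0"
    by (simp add: curve_length_def)
qed

text \<open>The claim about \<open>m\<^sub>1\<close> and \<open>m\<^sub>2\<close> says that their velocities, given off the breakpoints by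
  \<open>arm_velocity\<close>, extend over the breakpoints once \<open>x\<close> is continuously differentiable.\<close>

lemma minimizing_arc:
  assumes l: "l > 0" and cd: "c < d"
    and arc: "\<And>a b. c \<le> a \<Longrightarrow> a \<le> b \<Longrightarrow> b \<le> d \<Longrightarrow> horizontal_curve l l a b \<gamma> \<and> curve_length a b \<gamma> = ennreal (b - a)"
    and min: "\<And>a b c' d' \<delta>. c \<le> a \<Longrightarrow> a \<le> b \<Longrightarrow> b \<le> d \<Longrightarrow> c' \<le> d' \<Longrightarrow> horizontal_curve l l c' d' \<delta> \<Longrightarrow>
      \<delta> c' = \<gamma> a \<Longrightarrow> \<delta> d' = \<gamma> b \<Longrightarrow> curve_length a b \<gamma> \<le> curve_length c' d' \<delta>"
  defines "x \<equiv> \<lambda>t. pt_x (\<gamma> t)" and "m1 \<equiv> \<lambda>t. pt_m1 (\<gamma> t)" and "m2 \<equiv> \<lambda>t. pt_m2 (\<gamma> t)"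
  shows "elastic_on {c..d} x"
    and "\<And>T t. continuous_on {c..d} T \<Longrightarrow>
      (\<And>t. t \<in> {c..d} \<Longrightarrow> (x has_vector_derivative T t) (at t within {c..d})) \<Longrightarrow> t \<in> {c..d} \<Longrightarrow>
      (m1 has_vector_derivative (T t \<bullet> ((1 / l) *\<^sub>R (m1 t - x t))) *\<^sub>R ((1 / l) *\<^sub>R (m1 t - x t))) (at t within {c..d}) \<and>
      (m2 has_vector_derivative (T t \<bullet> ((1 / l) *\<^sub>R (m2 t - x t))) *\<^sub>R ((1 / l) *\<^sub>R (m2 t - x t))) (at t within {c..d})"
proof -
  have hc: "horizontal_curve l l c d \<gamma>" using arc[of c d] cd by simp
  from hc obtain S1 where S1: "finite S1" "\<gamma> C1_differentiable_on {c..d} - S1" and cont: "continuous_on {c..d} \<gamma>"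
    unfolding horizontal_curve_def piecewise_C1_differentiable_on_def by blast
  from hc obtain S2 where S2: "finite S2" "\<And>t. t \<in> {c..d} - S2 \<Longrightarrow> \<exists>k1 k2.
        (m1 has_vector_derivative k1 *\<^sub>R (m1 t - x t)) (at t) \<and>
        (m2 has_vector_derivative k2 *\<^sub>R (m2 t - x t)) (at t)"
    unfolding horizontal_curve_def x_def m1_def m2_def by blast
  from hc have conf: "\<And>t. t \<in> {c..d} \<Longrightarrow> \<gamma> t \<in> configuration_space l l"
    unfolding horizontal_curve_def by blast
  from S1(2) obtain D where D: "\<And>t. t \<in> {c..d} - S1 \<Longrightarrow> (\<gamma> has_vector_derivative D t) (at t)"
      "continuous_on ({c..d} - S1) D"
    unfolding C1_differentiable_on_def by blast
  define S where "S = S1 \<union> S2 \<union> {c, d}"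
  interpret breakpoints c d S
    by unfold_locales (use cd S1 S2 in \<open>auto simp: S_def\<close>)
  define X where "X = (\<lambda>t. fst (D t))"
  have dx: "(x has_vector_derivative X t) (at t)" if "t \<in> {c..d} - S" for t
    unfolding x_def pt_x_def X_def
    using that by (intro bounded_linear.has_vector_derivative[OF bounded_linear_fst] D) (auto simp: S_def)
  have cX: "continuous_on ({c..d} - S) X"
    unfolding X_def by (intro continuous_on_fst continuous_on_subset[OF D(2)]) (auto simp: S_def)
  have speed: "norm (X t) = 1" if t: "t \<in> {c..d} - S" for t
  proof (rule unit_speed_if_length_eq[OF open_pieces t cX dx[unfolded x_def]])
    fix a b :: real assume "a \<le> b" "{a..b} \<subseteq> {c..d} - S"
    then have "c \<le> a" "b \<le> d" by auto
    then show "curve_length a b \<gamma> = ennreal (b - a)" using arc \<open>a \<le> b\<close> by blast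
  qed
  have hor: "\<exists>k1 k2. (m1 has_vector_derivative k1 *\<^sub>R (m1 t - x t)) (at t) \<and>
        (m2 has_vector_derivative k2 *\<^sub>R (m2 t - x t)) (at t)" if "t \<in> {c..d} - S" for t
    by (rule S2(2)) (use that in \<open>auto simp: S_def\<close>)
  obtain p \<omega> m \<theta> w where dr: "driven l p \<omega> m \<theta> w"
    and \<gamma>: "\<And>t. t \<in> {c..d} \<Longrightarrow> \<gamma> t = linkage_of l (m t) (\<theta> t) (w t)"
    and unit: "\<And>t. t \<in> {c..d} - S \<Longrightarrow> (p t)\<^sup>2 + l\<^sup>2 * (\<omega> t)\<^sup>2 = 1"
    using driven_reconstruct[OF l cont conf cX dx[unfolded x_def] speed hor[unfolded x_def m1_def m2_def]]
    by blast
  have ends: "\<gamma> c = linkage_of l (m c) (\<theta> c) (w c)" "\<gamma> d = linkage_of l (m d) (\<theta> d) (w d)"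
    using \<gamma> cd by simp_all

  \<comment> \<open>A repeated configuration would allow a shortcut of length zero.\<close>
  have no_return: False if t: "t1 \<in> {c..d}" "t2 \<in> {c..d}" "t1 < t2" and eq: "\<gamma> t1 = \<gamma> t2" for t1 t2
  proof -
    have "curve_length t1 t2 \<gamma> \<le> curve_length 0 0 (\<lambda>_. \<gamma> t1)"
      using t eq constant_horizontal(1)[OF conf[OF t(1)]] by (intro min) auto
    moreover have "curve_length t1 t2 \<gamma> = ennreal (t2 - t1)" using arc[of t1 t2] t by simp
    ultimately show False
      using constant_horizontal(2)[OF conf[OF t(1)]] t(3) by simp
  qed
  have inj: "inj_on (\<lambda>t. linkage_of l (m t) (\<theta> t) (w t)) {c..d}"
  proof (rule inj_onI)
    fix t1 t2 assume "t1 \<in> {c..d}" "t2 \<in> {c..d}"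
      "linkage_of l (m t1) (\<theta> t1) (w t1) = linkage_of l (m t2) (\<theta> t2) (w t2)"
    then show "t1 = t2" using no_return[of t1 t2] no_return[of t2 t1] \<gamma> by (metis linorder_neqE)
  qed
  let ?E = "\<lambda>t. exp ((integral {c..t} p - integral {c..d} p) / l)"
  have "ennreal (d - c) \<le> curve_length c d \<delta>"
    if "horizontal_curve l l c d \<delta>" "\<delta> c = linkage_of l (m c) (\<theta> c) (w c)" "\<delta> d = linkage_of l (m d) (\<theta> d) (w d)" for \<delta>
    using min[of c d c d \<delta>] arc[of c d] that cd ends by simp
  note first_order_conditions[OF l dr unit this]
  then obtain a b s :: real and v where nz: "(a, b, s, v) \<noteq> 0"
    and c12: "\<forall>t\<in>{c..d} - S. a * p t - s * (?E t * w t / l) + v \<bullet> dir (\<theta> t) = 0 \<and>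
      a * (l\<^sup>2 * \<omega> t) + b + s * ?E t + v \<bullet> rot90 (m d - m t) = 0"
    by blast
  have c1: "a * p t - s * (?E t * w t / l) + v \<bullet> dir (\<theta> t) = 0"
    and c2: "a * (l\<^sup>2 * \<omega> t) + b + s * ?E t + v \<bullet> rot90 (m d - m t) = 0" if "t \<in> {c..d} - S" for t
    using c12 that by blast+
  have "elastic_on {c..d} (\<lambda>t. m t - l *\<^sub>R dir (\<theta> t))"
  proof (cases "a = 0")
    case True
    show ?thesis
      by (rule elastic_if_abnormal[OF l dr unit inj, of b s v])
        (use nz c1 c2 True in \<open>auto simp: zero_prod_def\<close>)
  next
    case False
    show ?thesis
    proof (rule elastic_if_normal[OF l dr unit, of "s / a" "(1 / a) *\<^sub>R v" "b / a"])
      fix t assume t: "t \<in> {c..d} - S"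
      have "a * p t = s * (?E t * w t / l) - v \<bullet> dir (\<theta> t)" using c1[OF t] by linarith
      then have "p t = (s * (?E t * w t / l) - v \<bullet> dir (\<theta> t)) / a" using False by (simp add: eq_divide_eq mult.commute)
      then show "p t = s / a * (?E t * w t / l) - (1 / a) *\<^sub>R v \<bullet> dir (\<theta> t)"
        by (simp add: diff_divide_distrib)
      have "a * (l\<^sup>2 * \<omega> t) = - (b + s * ?E t + v \<bullet> rot90 (m d - m t))" using c2[OF t] by linarith
      then have "l\<^sup>2 * \<omega> t = - (b + s * ?E t + v \<bullet> rot90 (m d - m t)) / a" using False by (simp add: eq_divide_eq mult.commute)
      then show "l\<^sup>2 * \<omega> t = - (b / a + s / a * ?E t + (1 / a) *\<^sub>R v \<bullet> rot90 (m d - m t))"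
        by (simp add: add_divide_distrib diff_divide_distrib)
    qed
  qed
  moreover have "x t = m t - l *\<^sub>R dir (\<theta> t)" if "t \<in> {c..d}" for t
    using \<gamma>[OF that] by (simp add: x_def)
  ultimately show "elastic_on {c..d} x"
    unfolding elastic_on_def by (metis (no_types, lifting) has_vector_derivative_transform)

  fix T t assume T: "continuous_on {c..d} T" and t: "t \<in> {c..d}"
    and dT: "\<And>t. t \<in> {c..d} \<Longrightarrow> (x has_vector_derivative T t) (at t within {c..d})"
  let ?u1 = "\<lambda>t. (1 / l) *\<^sub>R (m1 t - x t)" and ?u2 = "\<lambda>t. (1 / l) *\<^sub>R (m2 t - x t)"
  have cx: "continuous_on {c..d} x" and cm1: "continuous_on {c..d} m1" and cm2: "continuous_on {c..d} m2"
    unfolding x_def m1_def m2_def pt_x_def pt_m1_def pt_m2_def by (intro continuous_intros cont)+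
  have len: "dist (x t) (m1 t) = l" "dist (x t) (m2 t) = l" if "t \<in> {c..d}" for t
    using conf[OF that] by (simp_all add: configuration_space_def x_def m1_def m2_def)
  have XT: "(x has_vector_derivative T t) (at t)" if "t \<in> {c..d} - S" for t
    using dT[of t] that by (simp only: at_within_piece[OF that]) simp
  have v1: "(m1 has_vector_derivative (T t \<bullet> ?u1 t) *\<^sub>R ?u1 t) (at t)"
    and v2: "(m2 has_vector_derivative (T t \<bullet> ?u2 t) *\<^sub>R ?u2 t) (at t)" if "t \<in> {c..d} - S" for t
    using hor[OF that] arm_velocity(1)[OF l len(1) that XT[OF that]] arm_velocity(1)[OF l len(2) that XT[OF that]] by blast+
  show "(m1 has_vector_derivative (T t \<bullet> ?u1 t) *\<^sub>R ?u1 t) (at t within {c..d}) \<and>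
      (m2 has_vector_derivative (T t \<bullet> ?u2 t) *\<^sub>R ?u2 t) (at t within {c..d})"
    by (intro conjI derivative_extends[OF cm1 _ v1 t] derivative_extends[OF cm2 _ v2 t] continuous_intros T cx cm1 cm2)
qed

section \<open>From elastic arcs to one elastica\<close>

text \<open>The elastica equation on a neighbourhood of \<open>t\<close> in \<open>I\<close>, with derivatives taken within \<open>I\<close> so that
  different neighbourhoods can be compared.\<close>

definition elastica_near :: "real \<Rightarrow> real \<Rightarrow> real set \<Rightarrow> (real \<Rightarrow> plane) \<Rightarrow> (real \<Rightarrow> plane) \<Rightarrow> (real \<Rightarrow> real) \<Rightarrow> (real \<Rightarrow> real) \<Rightarrow> real \<Rightarrow> bool" where
  "elastica_near C r I x T \<kappa> \<kappa>1 t \<longleftrightarrow> (\<forall>s\<in>I \<inter> ball t r.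
     (x has_vector_derivative T s) (at s within I) \<and> norm (T s) = 1 \<and>
     (T has_vector_derivative \<kappa> s *\<^sub>R rot90 (T s)) (at s within I) \<and>
     (\<kappa> has_real_derivative \<kappa>1 s) (at s within I) \<and>
     (\<kappa>1 has_real_derivative \<kappa> s * (C - (\<kappa> s)\<^sup>2 / 2)) (at s within I))"

text \<open>The constant \<open>C\<close> comes from the energy integral \<open>\<kappa>\<^sup>2/2 - \<mu> \<bullet> T\<close> of the pendulum. It replaces the
  vector \<open>\<mu>\<close>, which a straight segment does not determine.\<close>

lemma elastica_equation_if_elastic:
  assumes "elastic_on {c..d} x"
  obtains T \<kappa> \<kappa>1 C where "\<And>t. t \<in> {c..d} \<Longrightarrow> (x has_vector_derivative T t) (at t within {c..d})"
    "\<And>t. t \<in> {c..d} \<Longrightarrow> norm (T t) = 1"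
    "\<And>t. t \<in> {c..d} \<Longrightarrow> (T has_vector_derivative \<kappa> t *\<^sub>R rot90 (T t)) (at t within {c..d})"
    "\<And>t. t \<in> {c..d} \<Longrightarrow> (\<kappa> has_real_derivative \<kappa>1 t) (at t within {c..d})"
    "\<And>t. t \<in> {c..d} \<Longrightarrow> (\<kappa>1 has_real_derivative \<kappa> t * (C - (\<kappa> t)\<^sup>2 / 2)) (at t within {c..d})"
proof -
  obtain T \<kappa> \<mu> where x: "\<And>t. t \<in> {c..d} \<Longrightarrow> (x has_vector_derivative T t) (at t within {c..d})"
    and n: "\<And>t. t \<in> {c..d} \<Longrightarrow> norm (T t) = 1"
    and T: "\<And>t. t \<in> {c..d} \<Longrightarrow> (T has_vector_derivative \<kappa> t *\<^sub>R rot90 (T t)) (at t within {c..d})"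
    and \<kappa>: "\<And>t. t \<in> {c..d} \<Longrightarrow> (\<kappa> has_real_derivative \<mu> \<bullet> rot90 (T t)) (at t within {c..d})"
    using assms unfolding elastic_on_def by metis
  have in\<mu>: "((\<lambda>t. \<mu> \<bullet> f t) has_real_derivative \<mu> \<bullet> f') F"
    if "(f has_vector_derivative f') F" for f :: "real \<Rightarrow> plane" and f' F
    using bounded_linear.has_vector_derivative[OF bounded_linear_inner_right[of \<mu>] that]
    by (simp add: has_real_derivative_iff_has_vector_derivative)
  have "\<exists>C. \<forall>t\<in>{c..d}. (\<kappa> t)\<^sup>2 / 2 - \<mu> \<bullet> T t = C"
  proof (rule has_field_derivative_zero_constant)
    fix t assume t: "t \<in> {c..d}"
    show "((\<lambda>t. (\<kappa> t)\<^sup>2 / 2 - \<mu> \<bullet> T t) has_real_derivative 0) (at t within {c..d})"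
      by (rule DERIV_cong[OF DERIV_diff[OF DERIV_cdivide[OF DERIV_power[OF \<kappa>[OF t], of 2]] in\<mu>[OF T[OF t]]]]) simp
  qed simp
  then obtain C where C: "\<And>t. t \<in> {c..d} \<Longrightarrow> \<mu> \<bullet> T t = (\<kappa> t)\<^sup>2 / 2 - C" by (auto simp: algebra_simps)
  have "((\<lambda>t. \<mu> \<bullet> rot90 (T t)) has_real_derivative \<kappa> t * (C - (\<kappa> t)\<^sup>2 / 2)) (at t within {c..d})"
    if t: "t \<in> {c..d}" for t
    by (rule DERIV_cong[OF in\<mu>[OF has_vector_derivative_rot90[OF T[OF t]]]])
      (simp add: rot90_linear C[OF t] algebra_simps)
  then show thesis using that[OF x n T \<kappa>] by blast
qed

text \<open>Gronwall's argument for \<open>F = \<kappa>\<^sup>2 + (\<kappa>')\<^sup>2\<close>: from \<open>\<bar>F'\<bar> \<le> B F\<close> the function \<open>F exp (B t)\<close> is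
  nondecreasing and \<open>F exp (- B t)\<close> is nonincreasing.\<close>

lemma elastica_equation_unique_zero:
  fixes \<kappa> \<kappa>1 :: "real \<Rightarrow> real"
  assumes \<kappa>: "\<And>t. t \<in> {c..d} \<Longrightarrow> (\<kappa> has_real_derivative \<kappa>1 t) (at t within {c..d})"
    and \<kappa>1: "\<And>t. t \<in> {c..d} \<Longrightarrow> (\<kappa>1 has_real_derivative \<kappa> t * (C - (\<kappa> t)\<^sup>2 / 2)) (at t within {c..d})"
    and t: "t \<in> {c..d}" and z: "\<kappa> t = 0" "\<kappa>1 t = 0" and s: "s \<in> {c..d}"
  shows "\<kappa> s = 0 \<and> \<kappa>1 s = 0"
proof -
  have c: "continuous_on {c..d} \<kappa>" "continuous_on {c..d} \<kappa>1"
    by (rule DERIV_continuous_on, erule \<kappa> \<kappa>1)+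
  have "bounded ((\<lambda>t. 1 + C - (\<kappa> t)\<^sup>2 / 2) ` {c..d})"
    by (intro compact_imp_bounded compact_continuous_image continuous_intros c) auto
  then obtain B where "\<forall>y \<in> (\<lambda>t. 1 + C - (\<kappa> t)\<^sup>2 / 2) ` {c..d}. norm y \<le> B"
    unfolding bounded_iff by blast
  then have B: "\<bar>1 + C - (\<kappa> t)\<^sup>2 / 2\<bar> \<le> B" if "t \<in> {c..d}" for t
    using that by simp
  define F where "F = (\<lambda>t. (\<kappa> t)\<^sup>2 + (\<kappa>1 t)\<^sup>2)"
  define F' where "F' = (\<lambda>t. 2 * \<kappa> t * \<kappa>1 t * (1 + C - (\<kappa> t)\<^sup>2 / 2))"
  have cF: "continuous_on {c..d} F" unfolding F_def by (intro continuous_intros c)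
  have dF: "(F has_real_derivative F' t) (at t)" if "c < t" "t < d" for t
  proof -
    have "(F has_real_derivative F' t) (at t within {c..d})"
      unfolding F_def F'_def
      by (rule DERIV_cong[OF DERIV_add[OF DERIV_power[OF \<kappa>, of t 2] DERIV_power[OF \<kappa>1, of t 2]]])
        (use that in \<open>simp_all add: algebra_simps\<close>)
    then show ?thesis using that by (simp add: at_within_Icc_at)
  qed
  have bF: "\<bar>F' t\<bar> \<le> B * F t" if "t \<in> {c..d}" for t
  proof -
    have "\<bar>2 * \<kappa> t * \<kappa>1 t\<bar> \<le> F t"
      using zero_le_power2[of "\<kappa> t - \<kappa>1 t"] zero_le_power2[of "\<kappa> t + \<kappa>1 t"]
      by (simp add: F_def power2_diff power2_sum abs_le_iff)
    then have "\<bar>2 * \<kappa> t * \<kappa>1 t\<bar> * \<bar>1 + C - (\<kappa> t)\<^sup>2 / 2\<bar> \<le> F t * B"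
      using B[OF that] by (intro mult_mono) (auto simp: F_def)
    then show ?thesis by (simp add: F'_def abs_mult mult.commute)
  qed
  have e: "((\<lambda>t. F t * exp (a * t)) has_real_derivative exp (a * t) * (F' t + a * F t)) (at t)"
    if "c < t" "t < d" for t a
    by (rule DERIV_cong[OF DERIV_mult[OF dF[OF that] DERIV_fun_exp[OF DERIV_cmult[OF DERIV_ident]]]])
      (simp add: algebra_simps)
  have "F s \<le> 0"
  proof (cases "s \<le> t")
    case True
    have "F s * exp (B * s) \<le> F t * exp (B * t)"
    proof (rule DERIV_nonneg_imp_increasing_open[OF True])
      fix r assume r: "s < r" "r < t"
      then have "0 \<le> exp (B * r) * (F' r + B * F r)" using bF[of r] s t by (intro mult_nonneg_nonneg) (auto simp: abs_le_iff)
      then show "\<exists>y. ((\<lambda>s. F s * exp (B * s)) has_real_derivative y) (at r) \<and> 0 \<le> y"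
        using e[of r B] r s t by (intro exI[of _ "exp (B * r) * (F' r + B * F r)"]) auto
    qed (use s t in \<open>auto intro!: continuous_intros continuous_on_subset[OF cF]\<close>)
    then show ?thesis using z by (simp add: F_def mult_le_0_iff)
  next
    case False
    then have ts: "t \<le> s" by simp
    have "F s * exp (- B * s) \<le> F t * exp (- B * t)"
    proof (rule DERIV_nonpos_imp_decreasing_open[OF ts])
      fix r assume r: "t < r" "r < s"
      then have "exp (- B * r) * (F' r + - B * F r) \<le> 0" using bF[of r] s t by (intro mult_nonneg_nonpos) (auto simp: abs_le_iff)
      then show "\<exists>y. ((\<lambda>s. F s * exp (- B * s)) has_real_derivative y) (at r) \<and> y \<le> 0"
        using e[of r "- B"] r s t by (intro exI[of _ "exp (- B * r) * (F' r + - B * F r)"]) auto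
    qed (use s t in \<open>auto intro!: continuous_intros continuous_on_subset[OF cF]\<close>)
    then show ?thesis using z by (simp add: F_def mult_le_0_iff)
  qed
  moreover have "F s \<ge> 0" by (simp add: F_def)
  ultimately have "F s = 0" by linarith
  then have "(\<kappa> s)\<^sup>2 + (\<kappa>1 s)\<^sup>2 = 0" by (simp only: F_def)
  then show ?thesis by (simp only: sum_power2_eq_zero_iff)
qed

lemma at_within_arc:
  assumes "{c..d} \<subseteq> I" "I \<inter> ball t r \<subseteq> {c..d}" "s \<in> ball t r"
  shows "at s within {c..d} = at s within (I :: real set)"
  by (rule at_within_nhd[OF assms(3) open_ball]) (use assms(1,2) in auto)

lemma elastica_near_if_elastic:
  assumes I: "{c..d} \<subseteq> I" "I \<inter> ball t r \<subseteq> {c..d}" "t \<in> I" "r > 0" and x: "elastic_on {c..d} x"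
  obtains T \<kappa> \<kappa>1 C where "elastica_near C r I x T \<kappa> \<kappa>1 t"
    "\<And>s. s \<in> I \<inter> ball t r \<Longrightarrow> \<kappa> s = 0 \<and> \<kappa>1 s = 0 \<longleftrightarrow> \<kappa> t = 0 \<and> \<kappa>1 t = 0"
proof -
  obtain T \<kappa> \<kappa>1 C where D: "\<And>t. t \<in> {c..d} \<Longrightarrow> (x has_vector_derivative T t) (at t within {c..d})"
    "\<And>t. t \<in> {c..d} \<Longrightarrow> norm (T t) = 1"
    "\<And>t. t \<in> {c..d} \<Longrightarrow> (T has_vector_derivative \<kappa> t *\<^sub>R rot90 (T t)) (at t within {c..d})"
    "\<And>t. t \<in> {c..d} \<Longrightarrow> (\<kappa> has_real_derivative \<kappa>1 t) (at t within {c..d})"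
    "\<And>t. t \<in> {c..d} \<Longrightarrow> (\<kappa>1 has_real_derivative \<kappa> t * (C - (\<kappa> t)\<^sup>2 / 2)) (at t within {c..d})"
    using elastica_equation_if_elastic[OF x] by blast
  have "elastica_near C r I x T \<kappa> \<kappa>1 t"
    unfolding elastica_near_def
  proof
    fix s assume s: "s \<in> I \<inter> ball t r"
    then have "s \<in> {c..d}" and eq: "at s within {c..d} = at s within I"
      using I(2) at_within_arc[OF I(1,2)] by auto
    from D[OF this(1), unfolded eq] show "(x has_vector_derivative T s) (at s within I) \<and> norm (T s) = 1 \<and>
     (T has_vector_derivative \<kappa> s *\<^sub>R rot90 (T s)) (at s within I) \<and>
     (\<kappa> has_real_derivative \<kappa>1 s) (at s within I) \<and>
     (\<kappa>1 has_real_derivative \<kappa> s * (C - (\<kappa> s)\<^sup>2 / 2)) (at s within I)" by blast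
  qed
  moreover have "\<kappa> s = 0 \<and> \<kappa>1 s = 0 \<longleftrightarrow> \<kappa> t = 0 \<and> \<kappa>1 t = 0" if "s \<in> I \<inter> ball t r" for s
  proof -
    have unique: "\<kappa> b = 0 \<and> \<kappa>1 b = 0" if "a \<in> {c..d}" "b \<in> {c..d}" "\<kappa> a = 0" "\<kappa>1 a = 0" for a b
      by (rule elastica_equation_unique_zero[of c d \<kappa> \<kappa>1 C a b]) (rule D(4) D(5) that | assumption)+
    have "s \<in> {c..d}" "t \<in> {c..d}" using that I by auto
    then show ?thesis using unique by blast
  qed
  ultimately show thesis by (rule that)
qed

lemma has_vector_derivative_locally:
  assumes "(f has_vector_derivative D) (at s within I)" "s \<in> I \<inter> ball t r"
    and "\<And>s. s \<in> I \<inter> ball t r \<Longrightarrow> f s = g s"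
  shows "(g has_vector_derivative D) (at s within I)"
proof -
  have eq: "at s within I = at s within (I \<inter> ball t r)"
    by (rule at_within_nhd[of s "ball t r"]) (use assms(2) in auto)
  have f: "(f has_vector_derivative D) (at s within (I \<inter> ball t r))"
    using assms(1) unfolding eq .
  show ?thesis
    unfolding eq by (rule has_vector_derivative_transform[OF assms(2) _ f]) (simp add: assms(3))
qed

text \<open>Tangent, curvature and its derivative are determined by \<open>x\<close>, so only the constants \<open>C\<close> of overlapping
  neighbourhoods need comparison. They are unique unless \<open>\<kappa>\<close> vanishes on an open piece. By
  \<open>elastica_equation_unique_zero\<close> and connectedness, \<open>\<kappa>\<close> then vanishes on all of \<open>I\<close>, and any constant will
  do. Otherwise \<open>C\<close> is locally constant. Once \<open>C\<close> is fixed, \<open>M\<close> is a first integral.\<close>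

lemma elastica_globalize:
  assumes I: "is_interval I" "interior I \<noteq> {}"
    and loc: "\<And>t. t \<in> I \<Longrightarrow> \<exists>c d r. {c..d} \<subseteq> I \<and> I \<inter> ball t r \<subseteq> {c..d} \<and> r > 0 \<and> elastic_on {c..d} x"
  shows "\<exists>T \<kappa> \<kappa>1 C M. \<forall>t\<in>I. (x has_vector_derivative T t) (at t within I) \<and> norm (T t) = 1 \<and>
    (T has_vector_derivative \<kappa> t *\<^sub>R rot90 (T t)) (at t within I) \<and>
    (\<kappa> has_real_derivative \<kappa>1 t) (at t within I) \<and>
    (\<kappa>1 has_real_derivative \<kappa> t * (C - (\<kappa> t)\<^sup>2 / 2)) (at t within I) \<and>
    (\<kappa>1 t)\<^sup>2 + ((\<kappa> t)\<^sup>2 / 2 - C)\<^sup>2 = M"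
proof -
  have conn: "connected I" using I(1) is_interval_connected_1 by blast
  have "I \<noteq> {y}" for y using I(2) by auto
  then have nb: "at t within I \<noteq> bot" if "t \<in> I" for t
    using connected_imp_perfect[OF conn that] by (simp add: trivial_limit_within)
  note unique = vector_derivative_unique_within[OF nb]
  have "\<exists>r T \<kappa> \<kappa>1 C. r > 0 \<and> elastica_near C r I x T \<kappa> \<kappa>1 t \<and>
      (\<forall>s\<in>I \<inter> ball t r. \<kappa> s = 0 \<and> \<kappa>1 s = 0 \<longleftrightarrow> \<kappa> t = 0 \<and> \<kappa>1 t = 0)" if t: "t \<in> I" for t
  proof -
    obtain c d r where "{c..d} \<subseteq> I" "I \<inter> ball t r \<subseteq> {c..d}" "r > 0" "elastic_on {c..d} x"
      using loc[OF t] by blast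
    from elastica_near_if_elastic[OF this(1,2) t this(3,4)] show ?thesis using \<open>r > 0\<close> by metis
  qed
  then obtain r \<TT> \<KK> \<KK>1 \<CC> where r: "\<And>t. t \<in> I \<Longrightarrow> r t > 0"
    and el: "\<And>t. t \<in> I \<Longrightarrow> elastica_near (\<CC> t) (r t) I x (\<TT> t) (\<KK> t) (\<KK>1 t) t"
    and zero: "\<And>t s. t \<in> I \<Longrightarrow> s \<in> I \<inter> ball t (r t) \<Longrightarrow> \<KK> t s = 0 \<and> \<KK>1 t s = 0 \<longleftrightarrow> \<KK> t t = 0 \<and> \<KK>1 t t = 0"
    by metis
  have D: "(x has_vector_derivative \<TT> t s) (at s within I)" "norm (\<TT> t s) = 1"
     "(\<TT> t has_vector_derivative \<KK> t s *\<^sub>R rot90 (\<TT> t s)) (at s within I)"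
     "(\<KK> t has_vector_derivative \<KK>1 t s) (at s within I)"
     "(\<KK>1 t has_vector_derivative \<KK> t s * (\<CC> t - (\<KK> t s)\<^sup>2 / 2)) (at s within I)"
    if "t \<in> I" "s \<in> I \<inter> ball t (r t)" for t s
    using el[OF that(1)] that(2) unfolding elastica_near_def has_real_derivative_iff_has_vector_derivative by blast+
  have self: "t \<in> I \<inter> ball t (r t)" if "t \<in> I" for t using that r by simp

  define T where "T = (\<lambda>t. \<TT> t t)"
  define \<kappa> where "\<kappa> = (\<lambda>t. \<KK> t t)"
  define \<kappa>1 where "\<kappa>1 = (\<lambda>t. \<KK>1 t t)"
  have T: "\<TT> t s = T s" if t: "t \<in> I" and s: "s \<in> I \<inter> ball t (r t)" for t s
  proof -
    have "s \<in> I" using s by simp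
    from unique[OF this D(1)[OF t s] D(1)[OF this self[OF this]]] show ?thesis by (simp add: T_def)
  qed
  have dT: "(T has_vector_derivative \<KK> t s *\<^sub>R rot90 (T s)) (at s within I)"
    if t: "t \<in> I" and s: "s \<in> I \<inter> ball t (r t)" for t s
    using has_vector_derivative_locally[OF D(3)[OF t s] s T[OF t]] T[OF t s] by simp
  have \<kappa>: "\<KK> t s = \<kappa> s" if t: "t \<in> I" and s: "s \<in> I \<inter> ball t (r t)" for t s
  proof -
    have s': "s \<in> I" using s by simp
    have "rot90 (T s) \<noteq> 0" using D(2)[OF t s] T[OF t s] by (metis norm_rot90 norm_zero zero_neq_one)
    then show ?thesis
      using unique[OF s' dT[OF t s] dT[OF s' self[OF s']]] by (simp add: \<kappa>_def)
  qed
  have d\<kappa>: "(\<kappa> has_vector_derivative \<KK>1 t s) (at s within I)"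
    if t: "t \<in> I" and s: "s \<in> I \<inter> ball t (r t)" for t s
    using has_vector_derivative_locally[OF D(4)[OF t s] s \<kappa>[OF t]] .
  have \<kappa>1: "\<KK>1 t s = \<kappa>1 s" if t: "t \<in> I" and s: "s \<in> I \<inter> ball t (r t)" for t s
  proof -
    have s': "s \<in> I" using s by simp
    show ?thesis using unique[OF s' d\<kappa>[OF t s] d\<kappa>[OF s' self[OF s']]] by (simp add: \<kappa>1_def)
  qed
  have d\<kappa>1: "(\<kappa>1 has_vector_derivative \<kappa> s * (\<CC> t - (\<kappa> s)\<^sup>2 / 2)) (at s within I)"
    if t: "t \<in> I" and s: "s \<in> I \<inter> ball t (r t)" for t s
    using has_vector_derivative_locally[OF D(5)[OF t s] s \<kappa>1[OF t]] \<kappa>[OF t s] by simp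
  have near: "eventually (\<lambda>s. s \<in> I \<inter> ball t (r t)) (at t within I)" if "t \<in> I" for t
    unfolding eventually_at using r[OF that] by (auto intro!: exI[of _ "r t"] simp: dist_commute)

  have all_or_none: "(\<kappa> s = 0 \<and> \<kappa>1 s = 0) = (\<kappa> t = 0 \<and> \<kappa>1 t = 0)" if "s \<in> I" "t \<in> I" for s t
  proof (rule connected_local_const[OF conn that])
    show "\<forall>t\<in>I. \<forall>\<^sub>F s in at t within I. (\<kappa> t = 0 \<and> \<kappa>1 t = 0) = (\<kappa> s = 0 \<and> \<kappa>1 s = 0)"
    proof
      fix t assume t: "t \<in> I"
      from near[OF t] show "\<forall>\<^sub>F s in at t within I. (\<kappa> t = 0 \<and> \<kappa>1 t = 0) = (\<kappa> s = 0 \<and> \<kappa>1 s = 0)"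
      proof eventually_elim
        case (elim s)
        show ?case
          using zero[OF t elim] \<kappa>[OF t elim] \<kappa>1[OF t elim] \<kappa>[OF t self[OF t]] \<kappa>1[OF t self[OF t]] by simp
      qed
    qed
  qed
  have "\<exists>C. \<forall>t\<in>I. (\<kappa>1 has_vector_derivative \<kappa> t * (C - (\<kappa> t)\<^sup>2 / 2)) (at t within I)"
  proof (cases "\<exists>t\<in>I. \<kappa> t = 0 \<and> \<kappa>1 t = 0")
    case True
    then have "\<kappa> t = 0" if "t \<in> I" for t using all_or_none that by blast
    then show ?thesis using d\<kappa>1 self by force
  next
    case False
    \<comment> \<open>Two different constants would force \<open>\<kappa> = 0\<close> on the overlap, hence \<open>\<kappa>' = 0\<close> there.\<close>
    have "\<CC> t = \<CC> s" if t: "t \<in> I" and s: "s \<in> I \<inter> ball t (r t)" for t s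
    proof (rule ccontr)
      assume ne: "\<CC> t \<noteq> \<CC> s"
      have s': "s \<in> I" using s by simp
      have "s \<in> ball t (r t) \<inter> ball s (r s)" using s self[OF s'] by blast
      then obtain \<rho> where \<rho>: "\<rho> > 0" "ball s \<rho> \<subseteq> ball t (r t) \<inter> ball s (r s)"
        using openE[OF open_Int[OF open_ball open_ball]] by metis
      have 0: "\<kappa> q = 0" if q: "q \<in> I \<inter> ball s \<rho>" for q
      proof -
        have "q \<in> I" "q \<in> I \<inter> ball t (r t)" "q \<in> I \<inter> ball s (r s)" using q \<rho> by auto
        from unique[OF this(1) d\<kappa>1[OF t this(2)] d\<kappa>1[OF s' this(3)]]
        show ?thesis using ne by auto
      qed
      have sq: "s \<in> I \<inter> ball s \<rho>" using s' \<rho>(1) by simp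
      have "(\<kappa> has_vector_derivative 0) (at s within I)"
        by (rule has_vector_derivative_locally[OF has_vector_derivative_const[of 0] sq]) (simp add: 0)
      then have "\<kappa>1 s = 0" using unique[OF s' d\<kappa>[OF s' self[OF s']]] by (simp add: \<kappa>1_def)
      then show False using False 0[OF sq] s' by blast
    qed
    then have "\<forall>\<^sub>F s in at t within I. \<CC> t = \<CC> s" if "t \<in> I" for t
      using near[OF that] that by (rule_tac eventually_mono) blast+
    then have "\<CC> s = \<CC> t" if "s \<in> I" "t \<in> I" for s t
      using connected_local_const[OF conn that] by blast
    moreover obtain t0 where "t0 \<in> I" using I(2) interior_subset by blast
    ultimately show ?thesis using d\<kappa>1 self by metis
  qed
  then obtain C where C: "\<And>t. t \<in> I \<Longrightarrow> (\<kappa>1 has_real_derivative \<kappa> t * (C - (\<kappa> t)\<^sup>2 / 2)) (at t within I)"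
    unfolding has_real_derivative_iff_has_vector_derivative by blast
  have \<kappa>': "(\<kappa> has_real_derivative \<kappa>1 t) (at t within I)" if "t \<in> I" for t
    using d\<kappa>[OF that self[OF that]] unfolding has_real_derivative_iff_has_vector_derivative \<kappa>1_def .
  have "\<exists>M. \<forall>t\<in>I. (\<kappa>1 t)\<^sup>2 + ((\<kappa> t)\<^sup>2 / 2 - C)\<^sup>2 = M"
  proof (rule has_field_derivative_zero_constant)
    show "convex I" using I(1) is_interval_convex by blast
    fix t assume t: "t \<in> I"
    show "((\<lambda>t. (\<kappa>1 t)\<^sup>2 + ((\<kappa> t)\<^sup>2 / 2 - C)\<^sup>2) has_real_derivative 0) (at t within I)"
      by (rule DERIV_cong[OF DERIV_add[OF DERIV_power[OF C[OF t]] DERIV_power[OF DERIV_diff[OF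
            DERIV_cdivide[OF DERIV_power[OF \<kappa>'[OF t]]] DERIV_const]]]])
        (simp add: algebra_simps)
  qed
  then obtain M where M: "\<And>t. t \<in> I \<Longrightarrow> (\<kappa>1 t)\<^sup>2 + ((\<kappa> t)\<^sup>2 / 2 - C)\<^sup>2 = M" by blast
  show ?thesis
  proof (rule exI[of _ T], rule exI[of _ \<kappa>], rule exI[of _ \<kappa>1], rule exI[of _ C], rule exI[of _ M],
      intro ballI conjI)
    fix t assume t: "t \<in> I"
    show "(\<kappa> has_real_derivative \<kappa>1 t) (at t within I)" by (rule \<kappa>'[OF t])
    show "(\<kappa>1 has_real_derivative \<kappa> t * (C - (\<kappa> t)\<^sup>2 / 2)) (at t within I)" by (rule C[OF t])
    show "(\<kappa>1 t)\<^sup>2 + ((\<kappa> t)\<^sup>2 / 2 - C)\<^sup>2 = M" by (rule M[OF t])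
    show "(x has_vector_derivative T t) (at t within I)" "norm (T t) = 1"
      using D(1,2)[OF t self[OF t]] by (simp_all add: T_def)
    show "(T has_vector_derivative \<kappa> t *\<^sub>R rot90 (T t)) (at t within I)"
      using dT[OF t self[OF t]] by (simp add: \<kappa>_def)
  qed
qed

text \<open>At an endpoint of \<open>I\<close> that belongs to \<open>I\<close> the arc starts or ends at \<open>t\<close>. The ball of radius \<open>r\<close> records
  that the arc is nevertheless a neighbourhood of \<open>t\<close> in \<open>I\<close>.\<close>

lemma arc_around:
  assumes I: "is_interval (I :: real set)" "interior I \<noteq> {}" and t: "t \<in> I" and e: "e > 0"
  obtains c d r where "c < d" "{c..d} \<subseteq> I \<inter> ball t e" "I \<inter> ball t r \<subseteq> {c..d}" "r > 0"
proof -
  have between: "b \<in> I" if "a \<in> I" "c \<in> I" "a \<le> b" "b \<le> c" for a b c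
    using I(1) that unfolding is_interval_1 by blast
  obtain c r1 where c: "c \<in> I" "t - e < c" "c \<le> t" "r1 > 0" "\<And>s. s \<in> I \<Longrightarrow> t - r1 < s \<Longrightarrow> c \<le> s"
  proof (cases "\<exists>s\<in>I. s < t")
    case True
    then obtain s where "s \<in> I" "s < t" by blast
    then have "max s (t - e / 2) \<in> I" using between[of s t "max s (t - e / 2)"] t e by auto
    then show thesis using that[of "max s (t - e / 2)" "t - max s (t - e / 2)"] \<open>s < t\<close> e by auto
  next
    case False
    show thesis by (rule that[of t 1]) (use t e False in \<open>auto simp: not_less\<close>)
  qed
  obtain d r2 where d: "d \<in> I" "d < t + e" "t \<le> d" "r2 > 0" "\<And>s. s \<in> I \<Longrightarrow> s < t + r2 \<Longrightarrow> s \<le> d"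
  proof (cases "\<exists>s\<in>I. t < s")
    case True
    then obtain s where "s \<in> I" "t < s" by blast
    then have "min s (t + e / 2) \<in> I" using between[of t s "min s (t + e / 2)"] t e by auto
    then show thesis using that[of "min s (t + e / 2)" "min s (t + e / 2) - t"] \<open>t < s\<close> e by auto
  next
    case False
    show thesis by (rule that[of t 1]) (use t e False in \<open>auto simp: not_less\<close>)
  qed
  have near: "I \<inter> ball t (min r1 r2) \<subseteq> {c..d}"
    using c(5) d(5) by (auto simp: dist_real_def abs_less_iff)
  have "c < d"
  proof (rule ccontr)
    assume "\<not> c < d"
    then have "I \<inter> ball t (min r1 r2) \<subseteq> {t}" using near c(3) d(3) by auto
    moreover have "t islimpt I"
      using I t by (intro connected_imp_perfect) (auto simp: is_interval_connected_1)
    ultimately show False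
    proof -
      assume sub: "I \<inter> ball t (min r1 r2) \<subseteq> {t}" and "t islimpt I"
      moreover have "min r1 r2 > 0" using c(4) d(4) by simp
      ultimately obtain s where "s \<in> I" "s \<noteq> t" "dist s t < min r1 r2"
        unfolding islimpt_approachable by blast
      then have "s \<in> I \<inter> ball t (min r1 r2)" by (simp add: dist_commute)
      then show False using sub \<open>s \<noteq> t\<close> by blast
    qed
  qed
  moreover have "{c..d} \<subseteq> I \<inter> ball t e"
  proof
    fix s assume "s \<in> {c..d}"
    then have "s \<in> I" "t - e < s" "s < t + e" using between[OF c(1) d(1)] c(2) d(2) by auto
    then show "s \<in> I \<inter> ball t e" by (auto simp: dist_real_def abs_less_iff)
  qed
  moreover have "min r1 r2 > 0" using c(4) d(4) by simp
  ultimately show thesis using near by (intro that)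
qed

section \<open>The soliton equation\<close>

text \<open>Here \<open>L = 1 / l\<close>, and \<open>p\<close>, \<open>q\<close> are cosine and sine of the angle between the segment and the velocity of
  \<open>x\<close>. The functions \<open>k1\<close> to \<open>k4\<close> in the proof are the successive derivatives of the new curvature as
  polynomials in \<open>K\<close>, \<open>K1\<close>, \<open>p\<close>, \<open>q\<close>, reduced by means of \<open>p\<^sup>2 + q\<^sup>2 = 1\<close> and the first integral \<open>M\<close>. The
  constants of the soliton equation come out as \<open>a = (M - C\<^sup>2)/2 + C L\<^sup>2\<close> and \<open>b = - C - L\<^sup>2\<close>.\<close>

lemma soliton_equation_of_transform:
  fixes K K1 p q :: "real \<Rightarrow> real"
  assumes dK: "\<And>t. t \<in> I \<Longrightarrow> (K has_real_derivative K1 t) (at t within I)"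
    and dK1: "\<And>t. t \<in> I \<Longrightarrow> (K1 has_real_derivative K t * (C - (K t)\<^sup>2 / 2)) (at t within I)"
    and dp: "\<And>t. t \<in> I \<Longrightarrow> (p has_real_derivative - (K t * q t) - L * (q t)\<^sup>2) (at t within I)"
    and dq: "\<And>t. t \<in> I \<Longrightarrow> (q has_real_derivative K t * p t + L * p t * q t) (at t within I)"
    and pq: "\<And>t. t \<in> I \<Longrightarrow> (p t)\<^sup>2 + (q t)\<^sup>2 = 1"
    and M: "\<And>t. t \<in> I \<Longrightarrow> (K1 t)\<^sup>2 + ((K t)\<^sup>2 / 2 - C)\<^sup>2 = M"
  shows "\<exists>k1 k2 k3 k4.
    (\<forall>t\<in>I. ((\<lambda>t. - K t - 2 * q t * L) has_real_derivative k1 t) (at t within I) \<and>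
       (k1 has_real_derivative k2 t) (at t within I) \<and>
       (k2 has_real_derivative k3 t) (at t within I) \<and>
       (k3 has_real_derivative k4 t) (at t within I)) \<and>
    (\<exists>a b. \<forall>t\<in>I. a * E0 (- K t - 2 * q t * L) + b * E2 (- K t - 2 * q t * L) (k2 t)
       + E4 (- K t - 2 * q t * L) (k1 t) (k2 t) (k4 t) = 0)"
proof -
  define k where "k = (\<lambda>t. - K t - 2 * q t * L)"
  define k1 where "k1 = (\<lambda>t. - 2 * K t * p t * L - K1 t - 2 * p t * q t * L ^ 2)"
  define k2 where "k2 = (\<lambda>t. (1 / 2) * K t ^ 3 + 2 * K t ^ 2 * q t * L + 6 * K t * q t ^ 2 * L ^ 2 - K t * C
      - 2 * K t * L ^ 2 - 2 * K1 t * p t * L + 4 * q t ^ 3 * L ^ 3 - 2 * q t * L ^ 3)"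
  define k3 where "k3 = (\<lambda>t. 3 * K t ^ 3 * p t * L + (3 / 2) * K t ^ 2 * K1 t + 14 * K t ^ 2 * p t * q t * L ^ 2
      + 6 * K t * K1 t * q t * L + 24 * K t * p t * q t ^ 2 * L ^ 3 - 2 * K t * p t * C * L
      - 2 * K t * p t * L ^ 3 + 8 * K1 t * q t ^ 2 * L ^ 2 - K1 t * C - 2 * K1 t * L ^ 2
      + 12 * p t * q t ^ 3 * L ^ 4 - 2 * p t * q t * L ^ 4)"
  define k4 where "k4 = (\<lambda>t. - (3 / 2) * K t ^ 5 - (15 / 2) * K t ^ 4 * q t * L - 35 * K t ^ 3 * q t ^ 2 * L ^ 2
      + 5 * K t ^ 3 * C + 15 * K t ^ 3 * L ^ 2 + 15 * K t ^ 2 * K1 t * p t * L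
      - 100 * K t ^ 2 * q t ^ 3 * L ^ 3 + 14 * K t ^ 2 * q t * C * L + 64 * K t ^ 2 * q t * L ^ 3
      + 50 * K t * K1 t * p t * q t * L ^ 2 - 120 * K t * q t ^ 4 * L ^ 4
      + 10 * K t * q t ^ 2 * C * L ^ 2 + 90 * K t * q t ^ 2 * L ^ 4 - 4 * K t * C ^ 2
      - 2 * K t * C * L ^ 2 + 3 * K t * M - 2 * K t * L ^ 4 + 40 * K1 t * p t * q t ^ 2 * L ^ 3
      - 2 * K1 t * p t * C * L - 2 * K1 t * p t * L ^ 3 - 48 * q t ^ 5 * L ^ 5 + 40 * q t ^ 3 * L ^ 5
      - 6 * q t * C ^ 2 * L + 6 * q t * M * L - 2 * q t * L ^ 5)"
  have square: "((\<lambda>t. f t ^ 2) has_real_derivative 2 * f t * f') (at t within I)"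
    and cube: "((\<lambda>t. f t ^ 3) has_real_derivative 3 * f t ^ 2 * f') (at t within I)"
    if "(f has_real_derivative f') (at t within I)" for f f' t
    using DERIV_power[OF that, of 2] DERIV_power[OF that, of 3] by (simp_all add: mult_ac)
  note d = dK dK1 dp dq square cube DERIV_add DERIV_diff DERIV_minus DERIV_mult DERIV_const
  have k: "(k has_real_derivative k1 t) (at t within I)" if t: "t \<in> I" for t
    unfolding k_def k1_def
    by (rule DERIV_cong, (rule d t)+) algebra
  have k1: "(k1 has_real_derivative k2 t) (at t within I)" if t: "t \<in> I" for t
    unfolding k1_def k2_def
    by (rule DERIV_cong, (rule d t)+)
      (use pq[OF t] in algebra)
  have k2: "(k2 has_real_derivative k3 t) (at t within I)" if t: "t \<in> I" for t
    unfolding k2_def k3_def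
    by (rule DERIV_cong, (rule d t)+) algebra
  have pq': "(p t)\<^sup>2 = 1 - (q t)\<^sup>2" and M': "(K1 t)\<^sup>2 = M - ((K t)\<^sup>2 / 2 - C)\<^sup>2" if "t \<in> I" for t
    using pq[OF that] M[OF that] by linarith+
  \<comment> \<open>The two added terms vanish. With these cofactors of the relations \<open>pq'\<close> and \<open>M'\<close> the
    equation becomes an identity of polynomials, and likewise below.\<close>
  have k3: "(k3 has_real_derivative k4 t
      + (14 * K t ^ 3 * L ^ 2 + 62 * K t ^ 2 * q t * L ^ 3 + 84 * K t * q t ^ 2 * L ^ 4 - 2 * K t * L ^ 4
          + 36 * q t ^ 3 * L ^ 5 - 2 * q t * L ^ 5) * ((p t)\<^sup>2 - (1 - (q t)\<^sup>2))
      + (3 * K t + 6 * q t * L) * ((K1 t)\<^sup>2 - (M - ((K t)\<^sup>2 / 2 - C)\<^sup>2))) (at t within I)" if t: "t \<in> I" for t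
    unfolding k3_def k4_def
    by (rule DERIV_cong, (rule d t)+) (simp add: field_simps eval_nat_numeral)
  have k3: "(k3 has_real_derivative k4 t) (at t within I)" if t: "t \<in> I" for t
    using k3[OF t] unfolding pq'[OF t] M'[OF t] by simp
  have "(M / 2 - C\<^sup>2 / 2 + C * L\<^sup>2) * E0 (k t) + (- C - L\<^sup>2) * E2 (k t) (k2 t)
       + E4 (k t) (k1 t) (k2 t) (k4 t) = 0" if t: "t \<in> I" for t
  proof -
    have "(M / 2 - C\<^sup>2 / 2 + C * L\<^sup>2) * E0 (k t) + (- C - L\<^sup>2) * E2 (k t) (k2 t) + E4 (k t) (k1 t) (k2 t) (k4 t)
      = (- 10 * K t ^ 3 * L ^ 2 - 40 * K t ^ 2 * q t * L ^ 3 - 50 * K t * q t ^ 2 * L ^ 4 - 20 * q t ^ 3 * L ^ 5)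
          * ((p t)\<^sup>2 - (1 - (q t)\<^sup>2))
        + (- (5 / 2) * K t - 5 * q t * L) * ((K1 t)\<^sup>2 - (M - ((K t)\<^sup>2 / 2 - C)\<^sup>2))"
      unfolding E0_def E2_def E4_def k_def k1_def k2_def k4_def
      by (simp add: field_simps eval_nat_numeral)
    then show ?thesis unfolding pq'[OF t] M'[OF t] by simp
  qed
  then show ?thesis
    using k k1 k2 k3 unfolding k_def by blast
qed

text \<open>The unit tangent of the new curve is \<open>2 (T \<bullet> u) u - T\<close>, the reflection of \<open>T\<close> in \<open>u\<close>. Its angle is twice
  that of \<open>u\<close> minus that of \<open>T\<close>, which gives the curvature \<open>2 (- q / l) - \<kappa>\<close>.\<close>

lemma bicycle_transform_soliton:
  fixes x m T :: "real \<Rightarrow> plane" and \<kappa> \<kappa>1 :: "real \<Rightarrow> real"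
  assumes l: "l > 0" and len: "\<And>t. t \<in> I \<Longrightarrow> dist (x t) (m t) = l"
    and x: "\<And>t. t \<in> I \<Longrightarrow> (x has_vector_derivative T t) (at t within I)"
    and nT: "\<And>t. t \<in> I \<Longrightarrow> norm (T t) = 1"
    and T: "\<And>t. t \<in> I \<Longrightarrow> (T has_vector_derivative \<kappa> t *\<^sub>R rot90 (T t)) (at t within I)"
    and \<kappa>: "\<And>t. t \<in> I \<Longrightarrow> (\<kappa> has_real_derivative \<kappa>1 t) (at t within I)"
    and \<kappa>1: "\<And>t. t \<in> I \<Longrightarrow> (\<kappa>1 has_real_derivative \<kappa> t * (C - (\<kappa> t)\<^sup>2 / 2)) (at t within I)"
    and M: "\<And>t. t \<in> I \<Longrightarrow> (\<kappa>1 t)\<^sup>2 + ((\<kappa> t)\<^sup>2 / 2 - C)\<^sup>2 = M"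
    and m: "\<And>t. t \<in> I \<Longrightarrow> (m has_vector_derivative
       (T t \<bullet> ((1 / l) *\<^sub>R (m t - x t))) *\<^sub>R ((1 / l) *\<^sub>R (m t - x t))) (at t within I)"
  shows "two_soliton I (\<lambda>t. x t + 2 *\<^sub>R (m t - x t))"
proof -
  define u where "u = (\<lambda>t. (1 / l) *\<^sub>R (m t - x t))"
  define p where "p = (\<lambda>t. T t \<bullet> u t)"
  define q where "q = (\<lambda>t. T t \<bullet> rot90 (u t))"
  note inner' = bounded_bilinear.has_vector_derivative[OF bounded_bilinear_inner]
  have nu: "norm (u t) = 1" if "t \<in> I" for t
    using len[OF that] l by (simp add: u_def dist_norm norm_minus_commute)
  have Tpq: "T t = p t *\<^sub>R u t + q t *\<^sub>R rot90 (u t)" if "t \<in> I" for t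
    unfolding p_def q_def by (rule frame_expansion[OF nu[OF that]])
  have m': "(m has_vector_derivative p t *\<^sub>R u t) (at t within I)" if "t \<in> I" for t
    using m[OF that] by (simp only: p_def u_def)
  have du: "(u has_vector_derivative (- (L * q t)) *\<^sub>R rot90 (u t)) (at t within I)"
    if t: "t \<in> I" and L: "L = 1 / l" for t L
  proof -
    have "(u has_vector_derivative (1 / l) *\<^sub>R (p t *\<^sub>R u t - T t)) (at t within I)"
      using bounded_linear.has_vector_derivative[OF bounded_linear_scaleR_right
          has_vector_derivative_diff[OF m'[OF t] x[OF t]], of "1 / l"]
      unfolding u_def .
    moreover have "(1 / l) *\<^sub>R (p t *\<^sub>R u t - T t) = (- (L * q t)) *\<^sub>R rot90 (u t)"
      by (subst Tpq[OF t]) (simp add: L)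
    ultimately show ?thesis by simp
  qed
  define L where "L = 1 / l"
  note du = du[OF _ L_def]
  have pq: "(p t)\<^sup>2 + (q t)\<^sup>2 = 1" if t: "t \<in> I" for t
  proof -
    have "T t \<bullet> T t = p t * p t + q t * q t"
      by (subst (1 2) Tpq[OF t]) (use nu[OF t] in \<open>simp add: inner_add_left inner_add_right norm_eq_1\<close>)
    then show ?thesis using nT[OF t] by (simp add: norm_eq_1 power2_eq_square)
  qed
  have dp: "(p has_real_derivative - (\<kappa> t * q t) - L * (q t)\<^sup>2) (at t within I)" if t: "t \<in> I" for t
  proof -
    have "(p has_vector_derivative T t \<bullet> ((- (L * q t)) *\<^sub>R rot90 (u t)) + (\<kappa> t *\<^sub>R rot90 (T t)) \<bullet> u t) (at t within I)"
      unfolding p_def by (intro inner' T du t)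
    moreover have "T t \<bullet> ((- (L * q t)) *\<^sub>R rot90 (u t)) + (\<kappa> t *\<^sub>R rot90 (T t)) \<bullet> u t = - (\<kappa> t * q t) - L * (q t)\<^sup>2"
      by (simp add: q_def inner_rot90_swap power2_eq_square)
    ultimately show ?thesis by (simp add: has_real_derivative_iff_has_vector_derivative)
  qed
  have dq: "(q has_real_derivative \<kappa> t * p t + L * p t * q t) (at t within I)" if t: "t \<in> I" for t
  proof -
    have "(q has_vector_derivative T t \<bullet> rot90 ((- (L * q t)) *\<^sub>R rot90 (u t)) + (\<kappa> t *\<^sub>R rot90 (T t)) \<bullet> rot90 (u t)) (at t within I)"
      unfolding q_def by (intro inner' has_vector_derivative_rot90 T du[unfolded q_def] t)
    moreover have "T t \<bullet> rot90 ((- (L * q t)) *\<^sub>R rot90 (u t)) + (\<kappa> t *\<^sub>R rot90 (T t)) \<bullet> rot90 (u t) = \<kappa> t * p t + L * p t * q t"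
      by (simp add: p_def rot90_linear)
    ultimately show ?thesis by (simp add: has_real_derivative_iff_has_vector_derivative)
  qed
  let ?k = "\<lambda>t. - \<kappa> t - 2 * q t * L"
  define Ty where "Ty = (\<lambda>t. (2 * p t) *\<^sub>R u t - T t)"
  have "arclength_curve_with_curvature I (\<lambda>t. x t + 2 *\<^sub>R (m t - x t)) ?k"
    unfolding arclength_curve_with_curvature_def
  proof (intro exI[of _ Ty] ballI conjI)
    fix t assume t: "t \<in> I"
    have "((\<lambda>t. x t + 2 *\<^sub>R (m t - x t)) has_vector_derivative T t + 2 *\<^sub>R (p t *\<^sub>R u t - T t)) (at t within I)"
      by (intro has_vector_derivative_add x t has_vector_derivative_diff m'
          bounded_linear.has_vector_derivative[OF bounded_linear_scaleR_right])
    then show "((\<lambda>t. x t + 2 *\<^sub>R (m t - x t)) has_vector_derivative Ty t) (at t within I)"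
      by (simp add: Ty_def algebra_simps scaleR_2)
    have Ty: "Ty t = p t *\<^sub>R u t - q t *\<^sub>R rot90 (u t)"
      unfolding Ty_def by (subst Tpq[OF t]) (simp add: algebra_simps scaleR_2 flip: scaleR_scaleR)
    have "Ty t \<bullet> Ty t = (p t)\<^sup>2 + (q t)\<^sup>2"
      unfolding Ty using nu[OF t] by (simp add: inner_diff_left inner_diff_right norm_eq_1 power2_eq_square)
    then show "norm (Ty t) = 1" using pq[OF t] by (simp add: norm_eq_1)
    have "(Ty has_vector_derivative
       ((2 * p t) *\<^sub>R (- (L * q t)) *\<^sub>R rot90 (u t) + (2 * (- (\<kappa> t * q t) - L * (q t)\<^sup>2)) *\<^sub>R u t)
        - \<kappa> t *\<^sub>R rot90 (T t)) (at t within I)"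
      unfolding Ty_def
      by (intro has_vector_derivative_diff has_vector_derivative_scaleR DERIV_cmult dp du T t)
    moreover have "((2 * p t) *\<^sub>R (- (L * q t)) *\<^sub>R rot90 (u t) + (2 * (- (\<kappa> t * q t) - L * (q t)\<^sup>2)) *\<^sub>R u t)
        - \<kappa> t *\<^sub>R rot90 (T t) = ?k t *\<^sub>R rot90 (Ty t)"
    proof -
      have rT: "rot90 (T t) = p t *\<^sub>R rot90 (u t) - q t *\<^sub>R u t"
        by (subst Tpq[OF t]) (simp add: rot90_linear)
      have "rot90 (Ty t) = p t *\<^sub>R rot90 (u t) + q t *\<^sub>R u t"
        unfolding Ty by (simp add: rot90_linear)
      moreover have "2 * p t * - (L * q t) - \<kappa> t * p t = ?k t * p t"
        "2 * (- (\<kappa> t * q t) - L * (q t)\<^sup>2) + \<kappa> t * q t = ?k t * q t"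
        by (simp_all add: algebra_simps power2_eq_square)
      ultimately have goal: "?k t *\<^sub>R rot90 (Ty t) = (2 * p t * - (L * q t) - \<kappa> t * p t) *\<^sub>R rot90 (u t)
          + (2 * (- (\<kappa> t * q t) - L * (q t)\<^sup>2) + \<kappa> t * q t) *\<^sub>R u t"
        by (simp only: scaleR_add_right scaleR_scaleR)
      have regroup: "a *\<^sub>R n + b *\<^sub>R v - k *\<^sub>R (p t *\<^sub>R n - q t *\<^sub>R v) = (a - k * p t) *\<^sub>R n + (b + k * q t) *\<^sub>R v"
        for a b k and n v :: plane by (simp add: algebra_simps)
      show ?thesis
        unfolding rT scaleR_scaleR regroup by (rule goal[symmetric])
    qed
    ultimately show "(Ty has_vector_derivative ?k t *\<^sub>R rot90 (Ty t)) (at t within I)" by simp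
  qed
  moreover have "\<exists>k1 k2 k3 k4.
    (\<forall>t\<in>I. (?k has_real_derivative k1 t) (at t within I) \<and>
       (k1 has_real_derivative k2 t) (at t within I) \<and>
       (k2 has_real_derivative k3 t) (at t within I) \<and>
       (k3 has_real_derivative k4 t) (at t within I)) \<and>
    (\<exists>a b. \<forall>t\<in>I. a * E0 (?k t) + b * E2 (?k t) (k2 t) + E4 (?k t) (k1 t) (k2 t) (k4 t) = 0)"
    by (rule soliton_equation_of_transform[of I \<kappa> \<kappa>1 C p q L M]) (rule \<kappa> \<kappa>1 dp dq pq M, assumption)+
  ultimately show ?thesis
    unfolding two_soliton_def by - (rule exI[where x = ?k], blast)
qed

theorem corollary8p1:
  fixes l l1 l2 :: real and I :: "real set" and \<gamma> :: "real \<Rightarrow> linkage"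
  assumes "l1 = l" and "l2 = l" and "l > 0"
    and "tricycling_geodesic l1 l2 I \<gamma>"
  shows "two_soliton I (\<lambda>t. pt_y1 (\<gamma> t)) \<and> two_soliton I (\<lambda>t. pt_y2 (\<gamma> t))"
proof -
  note l = \<open>l > 0\<close>
  have geo: "tricycling_geodesic l l I \<gamma>" using assms by simp
  then have I: "is_interval I" "interior I \<noteq> {}"
    and arc: "\<And>c d. c \<le> d \<Longrightarrow> {c..d} \<subseteq> I \<Longrightarrow>
        horizontal_curve l l c d \<gamma> \<and> curve_length c d \<gamma> = ennreal (d - c)"
    and min: "\<And>t. t \<in> I \<Longrightarrow> \<exists>e>0. \<forall>c d. c \<le> d \<longrightarrow> {c..d} \<subseteq> I \<inter> ball t e \<longrightarrow>
        (\<forall>c' d' \<delta>. c' \<le> d' \<longrightarrow> horizontal_curve l l c' d' \<delta> \<longrightarrow>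
           \<delta> c' = \<gamma> c \<longrightarrow> \<delta> d' = \<gamma> d \<longrightarrow> curve_length c d \<gamma> \<le> curve_length c' d' \<delta>)"
    unfolding tricycling_geodesic_def by blast+
  let ?x = "\<lambda>t. pt_x (\<gamma> t)" and ?m1 = "\<lambda>t. pt_m1 (\<gamma> t)" and ?m2 = "\<lambda>t. pt_m2 (\<gamma> t)"
  let ?u1 = "\<lambda>t. (1 / l) *\<^sub>R (?m1 t - ?x t)" and ?u2 = "\<lambda>t. (1 / l) *\<^sub>R (?m2 t - ?x t)"
  have local: "\<exists>c d r. {c..d} \<subseteq> I \<and> I \<inter> ball t r \<subseteq> {c..d} \<and> r > 0 \<and> elastic_on {c..d} ?x \<and>
    (\<forall>T. continuous_on {c..d} T \<longrightarrow>
      (\<forall>t\<in>{c..d}. (?x has_vector_derivative T t) (at t within {c..d})) \<longrightarrow> (\<forall>t\<in>{c..d}.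
      (?m1 has_vector_derivative (T t \<bullet> ?u1 t) *\<^sub>R ?u1 t) (at t within {c..d}) \<and>
      (?m2 has_vector_derivative (T t \<bullet> ?u2 t) *\<^sub>R ?u2 t) (at t within {c..d})))" if t: "t \<in> I" for t
  proof -
    from min[OF t] obtain e where e: "e > 0" and short: "\<forall>c d. c \<le> d \<longrightarrow> {c..d} \<subseteq> I \<inter> ball t e \<longrightarrow>
        (\<forall>c' d' \<delta>. c' \<le> d' \<longrightarrow> horizontal_curve l l c' d' \<delta> \<longrightarrow>
           \<delta> c' = \<gamma> c \<longrightarrow> \<delta> d' = \<gamma> d \<longrightarrow> curve_length c d \<gamma> \<le> curve_length c' d' \<delta>)"
      by (elim exE conjE) (rule that)
    obtain c d r where cd: "c < d" "{c..d} \<subseteq> I \<inter> ball t e" "I \<inter> ball t r \<subseteq> {c..d}" "r > 0"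
      by (rule arc_around[OF I t e])
    have sub: "{a..b} \<subseteq> I \<inter> ball t e" if "c \<le> a" "b \<le> d" for a b
      using cd(2) that by (meson atLeastatMost_subset_iff order_trans)
    have A: "horizontal_curve l l a b \<gamma> \<and> curve_length a b \<gamma> = ennreal (b - a)" if "c \<le> a" "a \<le> b" "b \<le> d" for a b
      using arc[OF that(2)] sub[OF that(1,3)] by blast
    have B: "curve_length a b \<gamma> \<le> curve_length c' d' \<delta>"
      if "c \<le> a" "a \<le> b" "b \<le> d" "c' \<le> d'" "horizontal_curve l l c' d' \<delta>" "\<delta> c' = \<gamma> a" "\<delta> d' = \<gamma> b" for a b c' d' \<delta>
      using short[rule_format, OF that(2) sub[OF that(1,3)] that(4-7)] .
    have "elastic_on {c..d} ?x" by (rule minimizing_arc(1)[OF l cd(1) A B])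
    moreover have "(?m1 has_vector_derivative (T t \<bullet> ?u1 t) *\<^sub>R ?u1 t) (at t within {c..d}) \<and>
      (?m2 has_vector_derivative (T t \<bullet> ?u2 t) *\<^sub>R ?u2 t) (at t within {c..d})"
      if "continuous_on {c..d} T" "\<And>t. t \<in> {c..d} \<Longrightarrow> (?x has_vector_derivative T t) (at t within {c..d})" "t \<in> {c..d}"
      for T t
      by (rule minimizing_arc(2)[OF l cd(1) A B that])
    ultimately show ?thesis using cd by (intro exI[of _ c] exI[of _ d] exI[of _ r]) auto
  qed
  have "\<exists>c d r. {c..d} \<subseteq> I \<and> I \<inter> ball t r \<subseteq> {c..d} \<and> r > 0 \<and> elastic_on {c..d} ?x" if "t \<in> I" for t
    using local[OF that] by (elim exE conjE, intro exI conjI)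
  then have "\<exists>T \<kappa> \<kappa>1 C M. \<forall>t\<in>I. (?x has_vector_derivative T t) (at t within I) \<and> norm (T t) = 1 \<and>
    (T has_vector_derivative \<kappa> t *\<^sub>R rot90 (T t)) (at t within I) \<and>
    (\<kappa> has_real_derivative \<kappa>1 t) (at t within I) \<and>
    (\<kappa>1 has_real_derivative \<kappa> t * (C - (\<kappa> t)\<^sup>2 / 2)) (at t within I) \<and>
    (\<kappa>1 t)\<^sup>2 + ((\<kappa> t)\<^sup>2 / 2 - C)\<^sup>2 = M"
    by (rule elastica_globalize[OF I])
  then obtain T \<kappa> \<kappa>1 C M where x_elastica: "\<forall>t\<in>I. (?x has_vector_derivative T t) (at t within I) \<and> norm (T t) = 1 \<and>
    (T has_vector_derivative \<kappa> t *\<^sub>R rot90 (T t)) (at t within I) \<and>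
    (\<kappa> has_real_derivative \<kappa>1 t) (at t within I) \<and>
    (\<kappa>1 has_real_derivative \<kappa> t * (C - (\<kappa> t)\<^sup>2 / 2)) (at t within I) \<and>
    (\<kappa>1 t)\<^sup>2 + ((\<kappa> t)\<^sup>2 / 2 - C)\<^sup>2 = M"
    by (elim exE) (rule that)
  have D: "(?x has_vector_derivative T t) (at t within I)" "norm (T t) = 1"
    "(T has_vector_derivative \<kappa> t *\<^sub>R rot90 (T t)) (at t within I)"
    "(\<kappa> has_real_derivative \<kappa>1 t) (at t within I)"
    "(\<kappa>1 has_real_derivative \<kappa> t * (C - (\<kappa> t)\<^sup>2 / 2)) (at t within I)"
    "(\<kappa>1 t)\<^sup>2 + ((\<kappa> t)\<^sup>2 / 2 - C)\<^sup>2 = M" if "t \<in> I" for t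
    using bspec[OF x_elastica that] by simp_all
  have arms: "(?m1 has_vector_derivative (T t \<bullet> ?u1 t) *\<^sub>R ?u1 t) (at t within I) \<and>
      (?m2 has_vector_derivative (T t \<bullet> ?u2 t) *\<^sub>R ?u2 t) (at t within I)" if t: "t \<in> I" for t
  proof -
    obtain c d r where cd: "{c..d} \<subseteq> I" "I \<inter> ball t r \<subseteq> {c..d}" "r > 0"
      and arms: "\<forall>T. continuous_on {c..d} T \<longrightarrow>
      (\<forall>t\<in>{c..d}. (?x has_vector_derivative T t) (at t within {c..d})) \<longrightarrow> (\<forall>t\<in>{c..d}.
      (?m1 has_vector_derivative (T t \<bullet> ?u1 t) *\<^sub>R ?u1 t) (at t within {c..d}) \<and>
      (?m2 has_vector_derivative (T t \<bullet> ?u2 t) *\<^sub>R ?u2 t) (at t within {c..d}))"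
      using local[OF t] by (elim exE conjE) (rule that)
    have tc: "t \<in> ball t r" "t \<in> {c..d}" using t cd by auto
    have "continuous_on I T" using D(3) by (rule continuous_on_vector_derivative)
    then have "continuous_on {c..d} T" using cd(1) continuous_on_subset by blast
    moreover have "\<forall>t\<in>{c..d}. (?x has_vector_derivative T t) (at t within {c..d})"
      using D(1) cd(1) has_vector_derivative_within_subset by blast
    ultimately have "\<forall>t\<in>{c..d}.
      (?m1 has_vector_derivative (T t \<bullet> ?u1 t) *\<^sub>R ?u1 t) (at t within {c..d}) \<and>
      (?m2 has_vector_derivative (T t \<bullet> ?u2 t) *\<^sub>R ?u2 t) (at t within {c..d})"
      by (rule arms[THEN spec, THEN mp, THEN mp])
    from bspec[OF this tc(2)] show ?thesis
      unfolding at_within_arc[OF cd(1,2) tc(1)] .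
  qed
  have len: "dist (?x t) (?m1 t) = l" "dist (?x t) (?m2 t) = l" if "t \<in> I" for t
  proof -
    have "horizontal_curve l l t t \<gamma>" using arc[of t t] that by simp
    then have "\<gamma> t \<in> configuration_space l l" by (simp add: horizontal_curve_def)
    then show "dist (?x t) (?m1 t) = l" "dist (?x t) (?m2 t) = l" by (simp_all add: configuration_space_def)
  qed
  have "two_soliton I (\<lambda>t. ?x t + 2 *\<^sub>R (?m1 t - ?x t))"
    by (rule bicycle_transform_soliton[OF l]) (rule len(1) D arms[THEN conjunct1], assumption)+
  moreover have "two_soliton I (\<lambda>t. ?x t + 2 *\<^sub>R (?m2 t - ?x t))"
    by (rule bicycle_transform_soliton[OF l]) (rule len(2) D arms[THEN conjunct2], assumption)+
  ultimately show ?thesis unfolding pt_y1_def pt_y2_def ..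
qed

end
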